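(* Let $n\ge2$ and $p,q\ge0$ be integers, and let $\alpha_{p,q}$ be the measure $$\alpha_{p,q}=\mathrm{mes}(S^{2n-3})\cdot t^{1-2n}\,a_{p,q}(t)\,(1-t^2)^{n-2}\,dt$$ on the interval $(0,1)$, extended by zero to the whole of $\mathbb R_{>0}$. The distribution $\alpha_{p,q}$ is invertible in the convolution algebra $A$. Its inverse $\beta_{p,q}$ is $$\beta_{p,q}(t)=\frac{1}{2^{n+m-2}\,\pi^{n-1}\,\Gamma(m)}\prod_{j=1}^{n+m-1}\left(-\frac{d}{dt}\cdot t+p+q-2j\right)\left(t^{-p-q-2n+1}(1-t^2)_+^{m-1}\right)dt,\qquad m=\min(p,q).$$ The Mellin transforms are given by $$\mathfrak M\beta_{p,q}(s)=\frac1{\mathfrak M\alpha_{p,q}(s)}=\pi^{1-n}\,\frac{\Gamma\!\left(\frac{s+p+q}2\right)}{\Gamma\!\left(\frac{s+|p-q|}2-n+1\right)}\cdot\frac{\Gamma\!\left(\frac{s-p-q}2-n+1\right)}{\Gamma\!\left(\frac{s-|p-q|}2-n+1\right)}.$$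
   Context: $A$ is the space of distributions on $\mathbb R_{>0}$ supported on $(0,1]$, which is an algebra under the convolution product $*$ induced by multiplication on $\mathbb R_{>0}$ (unit: the delta distribution at $1$). $S^{2n-1}$ is the unit sphere in $\mathbb C^n=\mathbb R^{2n}$; $\mathrm{mes}(S^{2n-3})$ is the surface area of the unit $(2n-3)$-sphere. $\mathcal C(S^{2n-1})$ is the space of smooth $U(n)$-finite complex-valued functions on $S^{2n-1}$. $H^{p,q}$ is the space of homogeneous polynomials $Y$ of degree $p+q$ on $\mathbb R^{2n}=\mathbb C^n$ that are harmonic and satisfy $Y(\lambda z)=\lambda^p\bar\lambda^qY(z)$ for $\lambda\in\mathbb C$, $z\in\mathbb C^n$; the restrictions $H^{p,q}|S^{2n-1}$ are irreducible, pairwise non-isomorphic $U(n)$-representations. For $t\in(-1,1)$ let $A_t:\mathcal C(S^{2n-1})\to\mathcal C(S^{2n-1})$ be the operator such that $(A_tf)(x)$ is the average of $f$ over the $(2n-3)$-sphere $\{\omega\in S^{2n-1}:\omega\cdot\bar x=t\}$, where $\omega\cdot\bar x=\sum\omega_i\bar x_i$. It is $U(n)$-equivariant, hence acts on $H^{p,q}|S^{2n-1}$ by a scalar, denoted $a_{p,q}(t)$; $a_{p,q}$ is a smooth function on $(-1,1)$ with $|a_{p,q}(t)|\le1$. The derivative $\frac d{dt}$ is taken in the sense of generalized functions on $\mathbb R_{>0}$, and $-\frac d{dt}\cdot t$ is the operator $g\mapsto-\frac d{dt}(tg)$. For $\mathrm{Re}(\lambda)>-1$, $(1-t)_+^\lambda$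 is the generalized function equal to $(1-t)^\lambda$ on $(0,1)$ and $0$ on $[1,\infty)$, extended to $\lambda\in\mathbb C$ not a negative integer by analytic continuation, and $(1-t^2)_+^\lambda=(1+t)^\lambda(1-t)_+^\lambda$. For $m=0$ the expression $\frac1{\Gamma(m)}(1-t^2)_+^{m-1}$ is understood by analytic continuation in $m$: the regularization of $\frac2{\Gamma(m)}(1-t^2)_+^{m-1}dt$ at $m=0$ is $\delta(1-t)$, the delta distribution at $t=1$. Mellin transform: $\mathfrak M\gamma(s)$ is obtained by integrating $t^s$ against the distribution $\gamma$, i.e. $\mathfrak M\gamma(s)=\int_{\mathbb R_{>0}}t^s\gamma(t)$, for $\mathrm{Re}(s)$ sufficiently large ($\mathrm{Re}(s)>2n-2$ in the case of $\alpha_{p,q}$), and by analytic continuation elsewhere; the formulas are identities of meromorphic functions of $s\in\mathbb C$. *)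

theory Defs
  imports "HOL-Complex_Analysis.Complex_Analysis" "HOL-Algebra.Ring"
begin

subsection \<open>Distributions on the positive half-line\<close>

definition vderiv :: "(real \<Rightarrow> complex) \<Rightarrow> real \<Rightarrow> complex" where
  "vderiv f = (\<lambda>x. vector_derivative f (at x))"

definition smooth :: "(real \<Rightarrow> complex) \<Rightarrow> bool" where
  "smooth f \<longleftrightarrow> (\<forall>k x. (vderiv ^^ k) f differentiable (at x))"

definition tsupport :: "(real \<Rightarrow> complex) \<Rightarrow> real set" where
  "tsupport f = closure {t. f t \<noteq> 0}"

text \<open>A test function on \<open>{0<..}\<close> is represented by its extension by zero to the real line.\<close>

definition test_functions :: "(real \<Rightarrow> complex) set" (\<open>\<D>\<close>) where
  "\<D> = {\<phi>. smooth \<phi> \<and> compact (tsupport \<phi>) \<and> tsupport \<phi> \<subseteq> {0<..}}"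

type_synonym functional = "(real \<Rightarrow> complex) \<Rightarrow> complex"

text \<open>
  A distribution is a functional with the fixed value \<open>undefined\<close> outside \<open>\<D>\<close>, so that equality
  in HOL is equality of distributions. A locally integrable \<open>g\<close> on \<open>{0<..}\<close>, equivalently the
  distribution \<open>g dt\<close>, is the functional \<open>\<phi> \<mapsto> \<integral> g \<phi> dt\<close>.
\<close>

definition distributions :: "functional set" where
  "distributions = {u \<in> extensional \<D>.
     (\<forall>\<phi>\<in>\<D>. \<forall>\<psi>\<in>\<D>. \<forall>a b. u (\<lambda>t. a * \<phi> t + b * \<psi> t) = a * u \<phi> + b * u \<psi>) \<and>
     (\<forall>K. compact K \<and> K \<subseteq> {0<..} \<longrightarrow>
        (\<exists>C N. \<forall>\<phi>\<in>\<D>. tsupport \<phi> \<subseteq> K \<longrightarrow>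
           norm (u \<phi>) \<le> C * (\<Sum>k\<le>(N::nat). SUP t. norm ((vderiv ^^ k) \<phi> t))))}"

definition supported_in_unit :: "functional \<Rightarrow> bool" where
  "supported_in_unit u \<longleftrightarrow> (\<forall>\<phi>\<in>\<D>. tsupport \<phi> \<subseteq> {1<..} \<longrightarrow> u \<phi> = 0)"

text \<open>
  A distribution supported on \<open>{0<..1}\<close> pairs with every function \<open>\<psi>\<close> that coincides with a test
  function on a neighbourhood of \<open>{..1}\<close>, that is, \<open>\<psi>\<close> smooth there and vanishing below some
  positive number; the value does not depend on the chosen test function.
\<close>

definition pairing :: "functional \<Rightarrow> (real \<Rightarrow> complex) \<Rightarrow> complex" where
  "pairing u \<psi> = u (SOME \<phi>. \<phi> \<in> \<D> \<and> (\<exists>e>0. \<forall>t<1 + e. \<phi> t = \<psi> t))"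

subsection \<open>The convolution algebra\<close>

definition convolution :: "functional \<Rightarrow> functional \<Rightarrow> functional" where
  "convolution u v =
     (\<lambda>\<phi>\<in>\<D>. pairing u (\<lambda>x. if x > 0 then v (\<lambda>y. \<phi> (x * y)) else 0))"

definition delta_one :: functional where
  "delta_one = (\<lambda>\<phi>\<in>\<D>. \<phi> 1)"

definition conv_algebra :: "functional ring" where
  "conv_algebra =
     \<lparr> carrier = {u \<in> distributions. supported_in_unit u},
       mult = convolution, one = delta_one,
       zero = (\<lambda>\<phi>\<in>\<D>. 0), add = (\<lambda>u v. \<lambda>\<phi>\<in>\<D>. u \<phi> + v \<phi>) \<rparr>"

subsection \<open>Mellin transform\<close>

text \<open>
  The value at \<open>t powr s\<close> of a distribution supported on \<open>{0<..1}\<close>: the function \<open>t powr s\<close> does not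
  vanish near 0, so it is cut off smoothly below \<open>e\<close> and \<open>e\<close> tends to 0.
\<close>

definition has_mellin :: "functional \<Rightarrow> complex \<Rightarrow> complex \<Rightarrow> bool" where
  "has_mellin u s c \<longleftrightarrow>
     (\<forall>\<eta>. smooth \<eta> \<and> (\<forall>t\<le>1. \<eta> t = 0) \<and> (\<forall>t\<ge>2. \<eta> t = 1) \<longrightarrow>
        ((\<lambda>e. pairing u (\<lambda>t. \<eta> (t / e) * of_real t powr s)) \<longlongrightarrow> c) (at_right 0))"

text \<open>
  Meromorphic continuation to the plane; \<open>nicely_meromorphic_on\<close> removes removable singularities
  and fixes the value 0 at poles, which makes the function unique.
\<close>

definition mellin :: "functional \<Rightarrow> complex \<Rightarrow> complex" where
  "mellin u = (THE F. F nicely_meromorphic_on UNIV \<and>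
                      (\<exists>\<sigma>. \<forall>s. Re s > \<sigma> \<longrightarrow> has_mellin u s (F s)))"

subsection \<open>Spherical means on the unit sphere of complex n-space\<close>

text \<open>
  Lebesgue measure on the real span of an orthonormal set \<open>B\<close>, as in the definition of \<open>lborel\<close>, and
  on a linear subspace \<open>V\<close> (it does not depend on the orthonormal basis).
\<close>

definition span_lborel :: "'a::euclidean_space set \<Rightarrow> 'a measure" where
  "span_lborel B = distr (\<Pi>\<^sub>M b\<in>B. lborel) borel (\<lambda>c. \<Sum>b\<in>B. c b *\<^sub>R b)"

definition subspace_lborel :: "'a::euclidean_space set \<Rightarrow> 'a measure" where
  "subspace_lborel V =
     span_lborel (SOME B. pairwise orthogonal B \<and> (\<forall>b\<in>B. norm b = 1) \<and> span B = V)"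

text \<open>
  Surface measure of the unit sphere of \<open>V\<close> in polar coordinates: the area of \<open>E\<close> is \<open>dim V\<close> times
  the volume of \<open>{r *\<^sub>R y | r y. 0 < r \<and> r < 1 \<and> y \<in> E}\<close>.
\<close>

definition sphere_measure :: "'a::euclidean_space set \<Rightarrow> 'a measure" where
  "sphere_measure V = scale_measure (ennreal (real (dim V)))
     (distr (restrict_space (subspace_lborel V) (ball 0 1)) borel sgn)"

text \<open>The average over the sphere of centre \<open>c\<close> and radius \<open>r\<close> in the affine subspace \<open>c + V\<close>.\<close>

definition sphere_average ::
    "'a::euclidean_space set \<Rightarrow> 'a \<Rightarrow> real \<Rightarrow> ('a \<Rightarrow> complex) \<Rightarrow> complex" where
  "sphere_average V c r f =
     (\<integral>y. f (c + r *\<^sub>R y) \<partial>sphere_measure V) / of_real (measure (sphere_measure V) UNIV)"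

definition sphere_area :: "nat \<Rightarrow> real" where
  \<comment> \<open>the unit \<open>k\<close>-sphere bounds the unit ball of dimension \<open>k + 1\<close>\<close>
  "sphere_area k = real (k + 1) * unit_ball_vol (real (k + 1))"

definition cdot :: "complex ^ 'n::finite \<Rightarrow> complex ^ 'n \<Rightarrow> complex" where
  "cdot w x = (\<Sum>i\<in>UNIV. w $ i * cnj (x $ i))"

definition mean_op ::
    "real \<Rightarrow> (complex ^ 'n::finite \<Rightarrow> complex) \<Rightarrow> complex ^ 'n \<Rightarrow> complex" where
  "mean_op t f x = sphere_average {y. cdot y x = 0} (t *\<^sub>R x) (sqrt (1 - t\<^sup>2)) f"

lemma norm_sq_cdot: "of_real ((norm x)\<^sup>2) = cdot x (x :: complex ^ 'n::finite)"
proof -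
  have "(norm x)\<^sup>2 = (\<Sum>i\<in>UNIV. (norm (x $ i))\<^sup>2)"
    by (simp add: norm_vec_def L2_set_def sum_nonneg)
  then show ?thesis
    by (simp add: cdot_def complex_norm_square del: of_real_power)
qed

lemma cdot_add_left: "cdot (a + b) c = cdot a c + cdot b c"
  and cdot_add_right: "cdot c (a + b) = cdot c a + cdot c b"
  and cdot_diff_left: "cdot (a - b) c = cdot a c - cdot b c"
  and cdot_scaleR_left: "cdot (r *\<^sub>R a) c = of_real r * cdot a c"
  and cdot_scaleR_right: "cdot c (r *\<^sub>R a) = of_real r * cdot c a"
  and cdot_cnj: "cnj (cdot a c) = cdot c a"
  by (simp_all add: cdot_def algebra_simps sum.distrib sum_subtractf sum_distrib_left,
      simp_all add: vector_scaleR_component scaleR_conv_of_real mult_ac)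

text \<open>The sphere over which \<open>mean_op t f x\<close> is the average:\<close>

lemma mean_op_sphere:
  fixes x :: "complex ^ 'n::finite"
  assumes "norm x = 1" and t: "-1 < t" "t < 1"
  shows "{w \<in> sphere 0 1. cdot w x = of_real t} =
         (\<lambda>y. t *\<^sub>R x + sqrt (1 - t\<^sup>2) *\<^sub>R y) ` {y \<in> sphere 0 1. cdot y x = 0}"
proof -
  define r where "r = sqrt (1 - t\<^sup>2)"
  have "t\<^sup>2 < 1"
    using t by (simp add: abs_square_less_1)
  then have r: "r > 0" "r\<^sup>2 = 1 - t\<^sup>2"
    by (auto simp: r_def)
  have xx: "cdot x x = 1"
    using norm_sq_cdot[of x] assms(1) by simp
  have pyth: "(norm (t *\<^sub>R x + r *\<^sub>R y))\<^sup>2 = t\<^sup>2 + r\<^sup>2 * (norm y)\<^sup>2" if "cdot y x = 0" for y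
  proof -
    have "cdot x y = 0"
      using cdot_cnj[of y x] that by simp
    then have "complex_of_real ((norm (t *\<^sub>R x + r *\<^sub>R y))\<^sup>2) = of_real (t\<^sup>2 + r\<^sup>2 * (norm y)\<^sup>2)"
      unfolding norm_sq_cdot of_real_add of_real_mult
      by (simp add: cdot_add_left cdot_add_right cdot_scaleR_left cdot_scaleR_right xx that
          power2_eq_square)
    then show ?thesis
      unfolding of_real_eq_iff .
  qed
  have cd: "cdot (t *\<^sub>R x + r *\<^sub>R y) x = of_real t + of_real r * cdot y x" for y
    by (simp add: cdot_add_left cdot_scaleR_left xx)
  have "w \<in> (\<lambda>y. t *\<^sub>R x + r *\<^sub>R y) ` {y \<in> sphere 0 1. cdot y x = 0}"
    if w: "norm w = 1" "cdot w x = of_real t" for w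
  proof (rule image_eqI)
    define y where "y = (1 / r) *\<^sub>R (w - t *\<^sub>R x)"
    show weq: "w = t *\<^sub>R x + r *\<^sub>R y"
      using r(1) by (simp add: y_def)
    have y0: "cdot y x = 0"
      by (simp add: y_def cdot_scaleR_left cdot_diff_left w xx)
    have "1 = t\<^sup>2 + r\<^sup>2 * (norm y)\<^sup>2"
      using pyth[OF y0] w(1) weq by simp
    then have "r\<^sup>2 * (norm y)\<^sup>2 = r\<^sup>2 * 1"
      using r(2) by linarith
    then have "(norm y)\<^sup>2 = 1"
      using r(1) by (metis mult_cancel_left power_not_zero less_irrefl)
    then have "norm y = 1"
      using norm_ge_zero[of y] by (simp add: power2_eq_1_iff)
    with y0 show "y \<in> {y \<in> sphere 0 1. cdot y x = 0}"
      by simp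
  qed
  moreover have "norm (t *\<^sub>R x + r *\<^sub>R y) = 1 \<and> cdot (t *\<^sub>R x + r *\<^sub>R y) x = of_real t"
    if "norm y = 1" "cdot y x = 0" for y
  proof -
    have "(norm (t *\<^sub>R x + r *\<^sub>R y))\<^sup>2 = 1"
      using pyth[OF that(2)] that(1) r(2) by simp
    then show ?thesis
      using that(2) cd[of y] norm_ge_zero[of "t *\<^sub>R x + r *\<^sub>R y"] by (simp add: power2_eq_1_iff)
  qed
  ultimately show ?thesis
    unfolding r_def by auto
qed

subsection \<open>The multipliers\<close>

definition laplacian :: "('a::euclidean_space \<Rightarrow> complex) \<Rightarrow> 'a \<Rightarrow> complex" where
  "laplacian Y z = (\<Sum>b\<in>Basis. (vderiv ^^ 2) (\<lambda>h. Y (z + h *\<^sub>R b)) 0)"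

definition harmonics :: "nat \<Rightarrow> nat \<Rightarrow> (complex ^ 'n::finite \<Rightarrow> complex) set" where
  "harmonics p q = {Y. polynomial_function Y \<and>
     (\<forall>r z. Y (r *\<^sub>R z) = of_real r ^ (p + q) * Y z) \<and>
     (\<forall>z. laplacian Y z = 0) \<and>
     (\<forall>l z. Y (l *s z) = l ^ p * cnj l ^ q * Y z)}"

definition multiplier :: "'n::finite itself \<Rightarrow> nat \<Rightarrow> nat \<Rightarrow> real \<Rightarrow> complex" where
  "multiplier _ p q t = (THE a. \<forall>Y \<in> harmonics p q. \<forall>x :: complex ^ 'n \<in> sphere 0 1.
                            mean_op t Y x = a * Y x)"

subsection \<open>The two distributions\<close>

definition alpha :: "'n::finite itself \<Rightarrow> nat \<Rightarrow> nat \<Rightarrow> functional" where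
  "alpha N p q = (let n = CARD('n) in
     (\<lambda>\<phi>\<in>\<D>. of_real (sphere_area (2 * n - 3)) *
       (LBINT t:{0<..<1}. of_real (t powi (1 - 2 * int n)) * multiplier N p q t *
                          of_real ((1 - t\<^sup>2) ^ (n - 2)) * \<phi> t)))"

definition gf_deriv :: "functional \<Rightarrow> functional" where
  "gf_deriv u = (\<lambda>\<phi>\<in>\<D>. - u (vderiv \<phi>))"

definition gf_mult :: "(real \<Rightarrow> complex) \<Rightarrow> functional \<Rightarrow> functional" where
  "gf_mult h u = (\<lambda>\<phi>\<in>\<D>. u (\<lambda>t. h t * \<phi> t))"

text \<open>The operator \<open>- d/dt \<cdot> t + c\<close>; these operators commute for different \<open>c\<close>.\<close>

definition euler_op :: "complex \<Rightarrow> functional \<Rightarrow> functional" where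
  "euler_op c u = (\<lambda>\<phi>\<in>\<D>. - gf_deriv (gf_mult of_real u) \<phi> + c * u \<phi>)"

text \<open>
  The generalized function \<open>(1 - t\<^sup>2)\<^sub>+ powr (m - 1) / Gamma m\<close>, by analytic continuation in \<open>m\<close> from
  the half-plane \<open>Re m > 0\<close>, where it is a locally integrable function, to \<open>Re m > - 1\<close>. For \<open>m = 0\<close>
  it is half the delta distribution at 1.
\<close>

definition plus_power :: "nat \<Rightarrow> functional" where
  "plus_power m = (\<lambda>\<phi>\<in>\<D>. THE c. \<exists>F. F holomorphic_on {w. Re w > - 1} \<and>
     (\<forall>w. Re w > 0 \<longrightarrow>
        F w = (LBINT t:{0<..<1}. of_real (1 - t\<^sup>2) powr (w - 1) * \<phi> t) / Gamma w) \<and>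
     c = F (of_nat m))"

definition beta :: "nat \<Rightarrow> nat \<Rightarrow> nat \<Rightarrow> functional" where
  "beta n p q = (let m = min p q in
     (\<lambda>\<phi>\<in>\<D>. 1 / (2 ^ (n + m - 2) * of_real pi ^ (n - 1)) *
       foldr (\<lambda>j. euler_op (of_nat p + of_nat q - 2 * of_nat j)) [1..<n + m]
         (gf_mult (\<lambda>t. of_real (t powi (1 - int p - int q - 2 * int n))) (plus_power m)) \<phi>))"

end

theory Submission
  imports Defs "HOL-Probability.Distributions"
begin

text \<open>
  A distribution \<open>u\<close> supported on \<open>(0, 1]\<close> acts on smooth functions that vanish near \<open>(- \<infinity>, 0]\<close> by
  \<open>(R f) x = u (t \<mapsto> f (x t))\<close>, and convolution becomes composition. With \<open>\<theta> = t d/dt\<close>, a power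
  \<open>t powr (c - 1)\<close> on \<open>(0, 1)\<close> acts as the inverse of \<open>\<theta> + c\<close> and the Euler operators of \<open>beta\<close> as
  \<open>\<theta> + c\<close>, so everything takes place among rational functions of \<open>\<theta>\<close>. The Laplace equation and
  rotational symmetry determine the average of a harmonic polynomial, and a Rodrigues formula shows
  that the density of \<open>alpha\<close> is a combination of powers whose exponents differ by 2 and whose
  coefficients are, up to \<open>(- 1) ^ j (M choose j)\<close>, the values of a polynomial of degree
  \<open>m\<close> at \<open>- j\<close>. By Lagrange interpolation this is the partial fraction expansion of a constant times
  \<open>(\<Prod>i<m. \<theta> + d + 2 i) / (\<Prod>i<n+m-1. \<theta> + c + 2 i)\<close>, and \<open>beta\<close> acts as the reciprocal. The Mellin
  transform substitutes \<open>s\<close> for \<open>\<theta>\<close>, and the products over arithmetic progressions are the quotients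
  of Gamma functions.
\<close>

subsection \<open>Smooth functions\<close>

text \<open>Test functions are not stable under the inverse of \<open>\<theta> + c\<close>: a
  primitive of a test function need not vanish for large \<open>t\<close>. A functional supported in
  (0, 1] does not see large \<open>t\<close>, so compact support can be weakened to vanishing near
  0; this rules out \<open>t powr (- c)\<close>, the kernel of \<open>\<theta> + c\<close>, and
  makes the inverse unique. The constants, with K = |p - q| and m = min p q: the density of
  \<open>alpha\<close> has the exponents K - 2 n + 1 + 2 j, hence c = K - 2 n + 2; the power in
  \<open>beta\<close> has exponent 1 - p - q - 2 n, hence d = 2 - p - q - 2 n. The relation c - d =
  2 (K + m) turns the roots K + 1 + i of the interpolating polynomial into the factors
  \<open>\<theta> + d + 2 i\<close>. The multiplier is read off from each harmonic polynomial Y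
  separately. Homogeneity fixes Y on the complex line through x up to the factor Y x; the Laplace
  equation then determines, one degree at a time in the directions orthogonal to that line, the
  averages of Y. For m = 0 the generalized function in \<open>beta\<close> is half a delta and no
  combination of powers; both cases obey the same operator identity, with the constant 2^m /
  2.\<close>

primrec cdiff :: "nat \<Rightarrow> (real \<Rightarrow> complex) \<Rightarrow> bool" where
  "cdiff 0 f = (\<forall>x. f differentiable (at x))"
| "cdiff (Suc k) f = ((\<forall>x. f differentiable (at x)) \<and> cdiff k (vderiv f))"

text \<open>Thus \<open>cdiff k\<close> means \<open>k + 1\<close> times differentiable. The
  recursion peels off the first derivative, so closure properties follow by induction on
  \<open>k\<close> with the function generalised.\<close>

lemma cdiff_iff: "cdiff k f \<longleftrightarrow> (\<forall>j\<le>k. \<forall>x. (vderiv ^^ j) f differentiable (at x))"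
proof (induction k arbitrary: f)
  case (Suc k)
  have "(\<forall>j\<le>Suc k. \<forall>x. (vderiv ^^ j) f differentiable (at x)) \<longleftrightarrow>
    (\<forall>x. f differentiable (at x)) \<and> (\<forall>j\<le>k. \<forall>x. (vderiv ^^ Suc j) f differentiable (at x))"
    by (metis (no_types, lifting) Suc_le_mono bot_nat_0.extremum funpow_0 not0_implies_Suc)
  then show ?case
    by (simp add: Suc.IH funpow_swap1)
qed auto

lemma smooth_iff_cdiff: "smooth f \<longleftrightarrow> (\<forall>k. cdiff k f)"
  by (auto simp: smooth_def cdiff_iff)

lemma cdiff_mono: "cdiff k f \<Longrightarrow> j \<le> k \<Longrightarrow> cdiff j f"
  by (auto simp: cdiff_iff)

lemma cdiff_imp_differentiable: "cdiff k f \<Longrightarrow> f differentiable (at x)"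
  by (cases k) auto

lemma vderiv_works: "f differentiable (at x) \<Longrightarrow> (f has_vector_derivative vderiv f x) (at x)"
  by (simp add: vderiv_def vector_derivative_works)

lemma vderiv_eqI: "(f has_vector_derivative d) (at x) \<Longrightarrow> vderiv f x = d"
  by (simp add: vderiv_def vector_derivative_at)

lemma cdiff_SucI:
  assumes "\<And>x. (f has_vector_derivative f' x) (at x)" "cdiff k f'"
  shows "cdiff (Suc k) f"
proof -
  have "vderiv f = f'"
    using vderiv_eqI[OF assms(1)] by auto
  then show ?thesis
    using assms by (auto intro: differentiableI_vector)
qed

lemma cdiff_SucD:
  assumes "cdiff (Suc k) f"
  shows "(f has_vector_derivative vderiv f x) (at x)" "cdiff k (vderiv f)" "cdiff k f"
  using assms cdiff_mono[OF assms, of k] vderiv_works by auto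

lemma cdiff_const: "cdiff k (\<lambda>x. c)"
  by (induction k arbitrary: c) (auto simp: vderiv_def)

lemma cdiff_add: "cdiff k f \<Longrightarrow> cdiff k g \<Longrightarrow> cdiff k (\<lambda>x. f x + g x)"
proof (induction k arbitrary: f g)
  case (Suc k)
  note d = cdiff_SucD[OF Suc.prems(1)] cdiff_SucD[OF Suc.prems(2)]
  show ?case
    by (rule cdiff_SucI[OF has_vector_derivative_add[OF d(1) d(4)] Suc.IH[OF d(2) d(5)]])
qed auto

lemma cdiff_mult: "cdiff k f \<Longrightarrow> cdiff k g \<Longrightarrow> cdiff k (\<lambda>x. f x * g x)"
proof (induction k arbitrary: f g)
  case 0
  then show ?case
    using differentiable_mult by force
next
  case (Suc k)
  note d = cdiff_SucD[OF Suc.prems(1)] cdiff_SucD[OF Suc.prems(2)]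
  show ?case
    by (rule cdiff_SucI[OF has_vector_derivative_mult[OF d(1) d(4)]
          cdiff_add[OF Suc.IH[OF d(3) d(5)] Suc.IH[OF d(2) d(6)]]])
qed

lemma cdiff_id: "cdiff k complex_of_real"
proof (cases k)
  case 0
  then show ?thesis
    using bounded_linear_imp_differentiable[OF bounded_linear_of_real] by auto
next
  case (Suc j)
  have "(complex_of_real has_vector_derivative 1) (at x)" for x
    using has_vector_derivative_of_real[OF DERIV_ident] by force
  then show ?thesis
    unfolding Suc by (rule cdiff_SucI) (rule cdiff_const)
qed

lemma cdiff_affine: "cdiff k f \<Longrightarrow> cdiff k (\<lambda>x. f (a * x + b))"
proof (induction k arbitrary: f)
  case 0
  have "(\<lambda>x. a * x + b) differentiable (at x)" for x
    by (intro differentiable_add differentiable_mult) auto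
  then show ?case
    using 0 by (auto intro!: differentiable_compose[of f "\<lambda>x. a * x + b"] simp: differentiable_at_withinI)
next
  case (Suc k)
  note d = cdiff_SucD[OF Suc.prems(1)]
  have "((\<lambda>x. f (a * x + b)) has_vector_derivative of_real a * vderiv f (a * x + b)) (at x)" for x
  proof -
    have "((\<lambda>x. a * x + b) has_vector_derivative a) (at x)"
      by (auto intro!: derivative_eq_intros simp flip: has_real_derivative_iff_has_vector_derivative)
    from vector_diff_chain_at[OF this d(1)] show ?thesis
      by (simp add: o_def scaleR_conv_of_real)
  qed
  then show ?case
    by (rule cdiff_SucI) (intro cdiff_mult cdiff_const Suc.IH d)
qed

text \<open>The power is singular at 0 and meets its branch cut on the negative axis, but
  \<open>f\<close> vanishes below the positive number \<open>a\<close>; so the product rule holds at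
  every real \<open>t\<close>.\<close>

lemma has_vector_derivative_vanishing_powr:
  fixes f :: "real \<Rightarrow> complex"
  assumes "\<forall>t<a. f t = 0" "a > 0" "(f has_vector_derivative f') (at t)"
  shows "((\<lambda>t. f t * of_real t powr s) has_vector_derivative
           (f' * of_real t powr s + s * (f t * of_real t powr (s - 1)))) (at t)"
proof (cases "t < a")
  case True
  have ev: "eventually (\<lambda>x. x \<in> {..<a}) (nhds t)"
    using True by (intro eventually_nhds_in_open) auto
  have "f' = 0"
  proof (rule vector_derivative_unique_at[OF assms(3)])
    show "(f has_vector_derivative 0) (at t)"
      by (rule has_vector_derivative_transform_within_open[of "\<lambda>_. 0" _ _ "{..<a}"])
         (use assms True in auto)
  qed
  moreover have "((\<lambda>t. f t * of_real t powr s) has_vector_derivative 0) (at t)"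
    by (rule has_vector_derivative_transform_within_open[of "\<lambda>_. 0" _ _ "{..<a}"])
       (use assms True in auto)
  ultimately show ?thesis
    using assms True by simp
next
  case False
  then have t: "t > 0"
    using assms by auto
  have "((\<lambda>z. z powr s) has_field_derivative (s * of_real t powr (s - 1))) (at (of_real t))"
    using has_field_derivative_powr[of "of_real t" s] t by simp
  from has_vector_derivative_real_field[OF this]
  have "((\<lambda>t. complex_of_real t powr s) has_vector_derivative (s * of_real t powr (s - 1))) (at t)" .
  from has_vector_derivative_mult[OF assms(3) this] show ?thesis
    by (simp add: algebra_simps)
qed

lemma vderiv_vanishing:
  assumes "\<forall>t<a. f t = 0" 
  shows "\<forall>t<a. vderiv f t = 0"
proof (intro allI impI vderiv_eqI)
  fix t assume t: "t < a"
  show "(f has_vector_derivative 0) (at t)"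
    by (rule has_vector_derivative_transform_within_open[of "\<lambda>_. 0" _ _ "{..<a}"])
       (use assms t in auto)
qed

lemma cdiff_vanishing_powr:
  assumes "\<forall>t<a. f t = 0" "a > 0" "cdiff k f"
  shows "cdiff k (\<lambda>t. f t * of_real t powr s)"
  using assms
proof (induction k arbitrary: f s)
  case 0
  then have "((\<lambda>t. f t * of_real t powr s) has_vector_derivative
           (vderiv f t * of_real t powr s + s * (f t * of_real t powr (s - 1)))) (at t)" for t
    by (intro has_vector_derivative_vanishing_powr[of a f] vderiv_works) auto
  then show ?case
    by (auto intro: differentiableI_vector)
next
  case (Suc k)
  note d = cdiff_SucD[OF Suc.prems(3)]
  show ?case
    by (rule cdiff_SucI[OF has_vector_derivative_vanishing_powr[OF Suc.prems(1,2) d(1)]])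
      (intro cdiff_add cdiff_mult cdiff_const Suc.IH vderiv_vanishing d Suc.prems)
qed

section \<open>The exponential bump function and a smooth cut-off\<close>

lemma poly_times_exp_tendsto_0: "((\<lambda>x. poly p x * exp (- x)) \<longlongrightarrow> (0::real)) at_top"
proof -
  have "((\<lambda>x. \<Sum>i\<le>degree p. coeff p i * (x ^ i / exp x)) \<longlongrightarrow> (\<Sum>i\<le>degree p. coeff p i * 0)) at_top"
    by (intro tendsto_intros tendsto_power_div_exp_0)
  then show ?thesis
    by (simp add: poly_altdef exp_minus field_simps sum_distrib_left sum_divide_distrib)
qed

text \<open>The functions p(1/x) exp(-1/x), extended by 0, are closed under differentiation: since
  1/x and exp(-1/x) have the derivatives -1/x^2 and exp(-1/x)/x^2, the polynomial p is replaced by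
  X^2 (p - p'). Quantifying over all \<open>p\<close> lets the induction reach every order.\<close>

lemma cdiff_bump:
  "cdiff k (\<lambda>x. of_real (if x > 0 then poly p (1 / x) * exp (- 1 / x) else 0))"
proof -
  define g where "g p x = (if x > 0 then poly p (1 / x) * exp (- 1 / x) else 0)" for p and x :: real
  have "(g p has_real_derivative g ([:0, 0, 1:] * (p - pderiv p)) x) (at x)" for p x
  proof (cases x "0::real" rule: linorder_cases)
    case less
    have "((\<lambda>_. 0) has_real_derivative 0) (at x)"
      by simp
    then have "(g p has_real_derivative 0) (at x)"
      by (rule has_field_derivative_transform_within[where d = "- x"]) (use less in \<open>auto simp:
          g_def dist_real_def\<close>)
    then show ?thesis
      using less by (simp add: g_def)
  next
    case equal
    have "((\<lambda>h. g p h / h) \<longlongrightarrow> 0) (at_left 0)"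
      by (rule tendsto_eventually) (auto simp: g_def eventually_at_filter)
    moreover have "((\<lambda>h. g p h / h) \<longlongrightarrow> 0) (at_right 0)"
    proof -
      have "filterlim (\<lambda>x::real. 1 / x) at_top (at_right 0)"
        using filterlim_inverse_at_top_right by (simp add: inverse_eq_divide)
      \<comment> \<open>Dividing by \<open>h\<close> multiplies the polynomial by X, so the
        difference quotient at 0 is again covered by the limit.\<close>
      from filterlim_compose[OF poly_times_exp_tendsto_0[of "[:0, 1:] * p"] this]
      have "((\<lambda>x. poly ([:0, 1:] * p) (1 / x) * exp (- (1 / x))) \<longlongrightarrow> 0) (at_right 0)" .
      then show ?thesis
        by (rule Lim_transform_eventually)
           (auto simp: g_def eventually_at_right_field field_simps intro!: exI[of _ 1])
    qed
    ultimately have "((\<lambda>h. g p h / h) \<longlongrightarrow> 0) (at 0)"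
      using filterlim_split_at by blast
    then show ?thesis
      using equal by (simp add: DERIV_def g_def cong: if_cong)
  next
    case greater
    have "((\<lambda>x. poly p (1 / x) * exp (- 1 / x)) has_real_derivative
        poly ([:0, 0, 1:] * (p - pderiv p)) (1 / x) * exp (- 1 / x)) (at x)"
      using greater
      by (auto intro!: derivative_eq_intros simp: field_simps power2_eq_square)
    then have "(g p has_real_derivative poly ([:0, 0, 1:] * (p - pderiv p)) (1 / x) * exp (- 1 / x)) (at x)"
      by (rule has_field_derivative_transform_within[where d = x]) (use greater in \<open>auto simp: g_def
          dist_real_def\<close>)
    then show ?thesis
      using greater by (simp add: g_def)
  qed
  then have d: "((\<lambda>x. complex_of_real (g p x)) has_vector_derivative
      of_real (g ([:0, 0, 1:] * (p - pderiv p)) x)) (at x)" for p x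
    by (rule has_vector_derivative_of_real)
  have "cdiff k (\<lambda>x. complex_of_real (g p x))" for p
  proof (induction k arbitrary: p)
    case 0
    show ?case
      using d by (auto intro: differentiableI_vector)
  next
    case (Suc k)
    show ?case
      by (rule cdiff_SucI[OF d Suc])
  qed
  then show ?thesis
    by (simp add: g_def)
qed

lemma ex_smooth_cutoff:
  obtains h :: "real \<Rightarrow> complex" where "smooth h" "\<And>t. t \<le> 2 \<Longrightarrow> h t = 1" "\<And>t. t \<ge> 3 \<Longrightarrow> h t = 0"
proof -
  define f where "f x = (if x > 0 then exp (- 1 / x) else 0)" for x :: real
  have sf: "cdiff k (\<lambda>x. complex_of_real (f x))" for k
    using cdiff_bump[of k 1] by (simp add: f_def cong: if_cong)
  \<comment> \<open>The product f(x - 2) f(3 - x) is positive exactly on (2, 3); the cut-off is 1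
    minus its normalised primitive.\<close>
  define B where "B x = f (1 * x + (- 2)) * f ((- 1) * x + 3)" for x
  have sB: "cdiff k (\<lambda>x. complex_of_real (B x))" for k
    unfolding B_def of_real_mult by (intro cdiff_mult cdiff_affine[of k "\<lambda>x. complex_of_real (f x)"] sf)
  have "isCont (\<lambda>x. Re (complex_of_real (B x))) x" for x
    using differentiable_imp_continuous_within[OF cdiff_imp_differentiable[OF sB[of 0], of x]]
    by (rule continuous_Re)
  then have contB: "continuous_on A B" for A
    by (simp add: continuous_at_imp_continuous_on)
  have Bnn: "B x \<ge> 0" for x
    by (simp add: B_def f_def)
  have B0: "B x = 0" if "x \<le> 2 \<or> x \<ge> 3" for x
    using that by (auto simp: B_def f_def)
  define I where "I t = integral {0..t} B" for t
  have I: "(I has_real_derivative B t) (at t)" for t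
  proof (cases "t > 0")
    case True
    have "(I has_real_derivative B t) (at t within {0..t + 1})"
      unfolding I_def by (rule integral_has_real_derivative) (use contB True in auto)
    moreover have "at t within {0..t + 1} = at t"
      using True by (intro at_within_interior) auto
    ultimately show ?thesis
      by simp
  next
    case False
    have Iz: "I x = 0" if "x < 2" for x
      unfolding I_def by (rule integral_unique, rule has_integral_is_0) (use B0 that in auto)
    have "((\<lambda>_. 0) has_real_derivative 0) (at t)"
      by simp
    then have "(I has_real_derivative 0) (at t)"
      by (rule has_field_derivative_transform_within[where d = 1]) (use False Iz in \<open>auto simp:
          dist_real_def\<close>)
    then show ?thesis
      using False B0 by simp
  qed
  have I_le2: "I t = 0" if "t \<le> 2" for t
    unfolding I_def by (rule integral_unique, rule has_integral_is_0) (use B0 that in auto)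
  have I_ge3: "I t = I 3" if "t \<ge> 3" for t
  proof -
    have "integral {0..t} B = integral {0..3} B + integral {3..t} B"
      using Henstock_Kurzweil_Integration.integral_combine[of 0 3 t B] that
          integrable_continuous_interval[OF contB]
      by simp
    moreover have "integral {3..t} B = 0"
      by (rule integral_unique, rule has_integral_is_0) (use B0 in auto)
    ultimately show ?thesis
      by (simp add: I_def)
  qed
  have I3: "I 3 \<noteq> 0"
  proof
    assume "I 3 = 0"
    then have "\<forall>x\<in>cbox 0 3. B x = 0"
      using integral_cbox_eq_0_iff[of 0 3 B] contB Bnn by (auto simp: I_def)
    then have "B (5 / 2) = 0"
      by simp
    then show False
      by (simp add: B_def f_def)
  qed
  have sI: "cdiff k (\<lambda>x. complex_of_real (I x))" for k
  proof -
    have "cdiff (Suc k) (\<lambda>x. complex_of_real (I x))"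
      by (rule cdiff_SucI[OF has_vector_derivative_of_real[OF I] sB])
    then show ?thesis
      by (rule cdiff_SucD(3))
  qed
  show ?thesis
  proof (rule that)
    show "smooth (\<lambda>t. 1 + (- 1 / of_real (I 3)) * of_real (I t))"
      unfolding smooth_iff_cdiff by (intro allI cdiff_add cdiff_mult cdiff_const sI)
    show "1 + (- 1 / of_real (I 3)) * complex_of_real (I t) = 1" if "t \<le> 2" for t
      using I_le2[OF that] by simp
    show "1 + (- 1 / of_real (I 3)) * complex_of_real (I t) = 0" if "t \<ge> 3" for t
      unfolding I_ge3[OF that] using I3 by simp
  qed
qed

subsection \<open>Calculus of the Euler operator\<close>

text \<open>Unlike test functions, these are closed under the inverses of \<open>\<theta> + c\<close>.\<close>

definition half_smooth :: "(real \<Rightarrow> complex) set" (\<open>\<E>\<close>) where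
  "\<E> = {f. smooth f \<and> (\<exists>a>0. \<forall>t<a. f t = 0)}"

lemma half_smooth_cdiff: "f \<in> \<E> \<Longrightarrow> cdiff k f"
  by (simp add: half_smooth_def smooth_iff_cdiff)

lemma half_smoothE:
  assumes "f \<in> \<E>" obtains a where "a > 0" "\<forall>t<a. f t = 0"
  using assms by (auto simp: half_smooth_def)

lemma half_smoothI: "(\<And>k. cdiff k f) \<Longrightarrow> a > 0 \<Longrightarrow> \<forall>t<a. f t = 0 \<Longrightarrow> f \<in> \<E>"
  by (auto simp: half_smooth_def smooth_iff_cdiff)

lemma half_smooth_vderiv: "f \<in> \<E> \<Longrightarrow> (f has_vector_derivative vderiv f t) (at t)"
  using cdiff_SucD(1) half_smooth_cdiff by blast

lemma half_smooth_continuous: "f \<in> \<E> \<Longrightarrow> continuous_on A f"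
  by (meson continuous_at_imp_continuous_on half_smooth_vderiv has_vector_derivative_continuous)

lemma half_smooth_nonpos: "f \<in> \<E> \<Longrightarrow> t \<le> 0 \<Longrightarrow> f t = 0"
  by (auto simp: half_smooth_def)

lemma half_smooth_mult:
  assumes "f \<in> \<E>" "\<And>k. cdiff k g"
  shows "(\<lambda>t. g t * f t) \<in> \<E>"
proof -
  obtain a where "a > 0" "\<forall>t<a. f t = 0"
    using assms(1) by (rule half_smoothE)
  then show ?thesis
    by (intro half_smoothI[of _ a]) (auto intro: cdiff_mult assms half_smooth_cdiff)
qed

lemma half_smooth_cmult: "f \<in> \<E> \<Longrightarrow> (\<lambda>t. c * f t) \<in> \<E>"
  by (rule half_smooth_mult[OF _ cdiff_const])

lemma half_smooth_add:
  assumes "f \<in> \<E>" "g \<in> \<E>"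
  shows "(\<lambda>t. f t + g t) \<in> \<E>"
proof -
  obtain a b where "a > 0" "\<forall>t<a. f t = 0" "b > 0" "\<forall>t<b. g t = 0"
    using assms by (meson half_smoothE)
  then show ?thesis
    by (intro half_smoothI[of _ "min a b"]) (auto intro: cdiff_add assms half_smooth_cdiff)
qed

lemma half_smooth_zero: "(\<lambda>t. 0) \<in> \<E>"
  by (rule half_smoothI[OF cdiff_const, of 1]) auto

lemma half_smooth_sum: "finite I \<Longrightarrow> (\<And>i. i \<in> I \<Longrightarrow> f i \<in> \<E>) \<Longrightarrow> (\<lambda>t. \<Sum>i\<in>I. f i t) \<in> \<E>"
  by (induction I rule: finite_induct) (auto intro: half_smooth_zero half_smooth_add)

lemma half_smooth_powr:
  assumes "f \<in> \<E>"
  shows "(\<lambda>t. f t * of_real t powr s) \<in> \<E>"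
proof -
  obtain a where "a > 0" "\<forall>t<a. f t = 0"
    using assms(1) by (rule half_smoothE)
  then show ?thesis
    by (intro half_smoothI[of _ a]) (auto intro: cdiff_vanishing_powr assms half_smooth_cdiff)
qed

lemma half_smooth_dilate:
  assumes "f \<in> \<E>" "x > 0"
  shows "(\<lambda>t. f (x * t)) \<in> \<E>"
proof -
  obtain a where "a > 0" "\<forall>t<a. f t = 0"
    using assms(1) by (rule half_smoothE)
  then show ?thesis
    using assms cdiff_affine[of _ f x 0]
    by (intro half_smoothI[of _ "a / x"]) (auto simp: field_simps half_smooth_cdiff)
qed

section \<open>The Euler operator and polynomials in it\<close>

definition theta :: "(real \<Rightarrow> complex) \<Rightarrow> real \<Rightarrow> complex" where
  "theta f = (\<lambda>t. of_real t * vderiv f t)"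

lemma half_smooth_in_vderiv:
  assumes "f \<in> \<E>" shows "vderiv f \<in> \<E>"
proof -
  obtain a where "a > 0" "\<forall>t<a. f t = 0"
    using assms(1) by (rule half_smoothE)
  then show ?thesis
    using assms cdiff_SucD(2)[OF half_smooth_cdiff]
    by (intro half_smoothI[of _ a]) (auto simp: vderiv_vanishing)
qed

lemma theta_in: "f \<in> \<E> \<Longrightarrow> theta f \<in> \<E>"
  unfolding theta_def by (intro half_smooth_mult half_smooth_in_vderiv cdiff_id)

lemma theta_lincomb:
  assumes "f \<in> \<E>" "g \<in> \<E>"
  shows "theta (\<lambda>t. a * f t + b * g t) = (\<lambda>t. a * theta f t + b * theta g t)"
proof
  fix t
  have "vderiv (\<lambda>t. a * f t + b * g t) t = a * vderiv f t + b * vderiv g t"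
    by (rule vderiv_eqI)
      (intro has_vector_derivative_add has_vector_derivative_mult_right half_smooth_vderiv assms)
  then show "theta (\<lambda>t. a * f t + b * g t) t = a * theta f t + b * theta g t"
    by (simp add: theta_def algebra_simps)
qed

lemma theta_dilate:
  assumes "f \<in> \<E>"
  shows "theta (\<lambda>t. f (x * t)) = (\<lambda>t. theta f (x * t))"
proof
  fix t
  have "((\<lambda>t. x * t) has_vector_derivative x) (at t)"
    by (auto intro!: derivative_eq_intros simp flip: has_real_derivative_iff_has_vector_derivative)
  from vector_diff_chain_at[OF this half_smooth_vderiv[OF assms]]
  have "vderiv (\<lambda>t. f (x * t)) t = of_real x * vderiv f (x * t)"
    by (intro vderiv_eqI) (simp add: o_def scaleR_conv_of_real)
  then show "theta (\<lambda>t. f (x * t)) t = theta f (x * t)"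
    by (simp add: theta_def algebra_simps)
qed

text \<open>The differential operator P(\<theta>). By \<open>act_add\<close> and
  \<open>act_mult\<close> it makes \<open>\<E>\<close> a module over the polynomial ring, so
  identities between operators reduce to identities between polynomials.\<close>

definition act :: "complex poly \<Rightarrow> (real \<Rightarrow> complex) \<Rightarrow> real \<Rightarrow> complex" where
  "act P f = (\<lambda>t. \<Sum>i\<le>degree P. coeff P i * (theta ^^ i) f t)"

lemma act_bound: "degree P \<le> N \<Longrightarrow> act P f t = (\<Sum>i\<le>N. coeff P i * (theta ^^ i) f t)"
  unfolding act_def
  by (rule sum.mono_neutral_left) (auto simp: coeff_eq_0 not_le)

lemma act_0 [simp]: "act 0 f = (\<lambda>t. 0)"
  by (simp add: act_def)

lemma act_add: "act (P + Q) f = (\<lambda>t. act P f t + act Q f t)"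
proof
  fix t
  define N where "N = max (degree P) (degree Q)"
  have "degree (P + Q) \<le> N" "degree P \<le> N" "degree Q \<le> N"
    by (auto simp: N_def degree_add_le_max)
  then show "act (P + Q) f t = act P f t + act Q f t"
    by (simp add: act_bound[of _ N] sum.distrib algebra_simps)
qed

lemma act_smult: "act (smult c P) f = (\<lambda>t. c * act P f t)"
  by (rule ext, subst act_bound[OF degree_smult_le]) (simp add: act_def sum_distrib_left mult_ac)

lemma act_sum: "act (\<Sum>i\<in>I. P i) f = (\<lambda>t. \<Sum>i\<in>I. act (P i) f t)"
  by (induction I rule: infinite_finite_induct) (auto simp: act_add)

lemma act_pCons: "act (pCons a P) f = (\<lambda>t. a * f t + act P (theta f) t)"
proof
  fix t
  have "act (pCons a P) f t = (\<Sum>i\<le>Suc (degree P). coeff (pCons a P) i * (theta ^^ i) f t)"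
    by (rule act_bound) (rule degree_pCons_le)
  also have "\<dots> = a * f t + (\<Sum>i\<le>degree P. coeff P i * (theta ^^ Suc i) f t)"
    by (simp only: sum.atMost_Suc_shift coeff_pCons_Suc coeff_pCons_0 funpow_0)
  also have "\<dots> = a * f t + act P (theta f) t"
    by (simp add: act_def funpow_swap1)
  finally show "act (pCons a P) f t = a * f t + act P (theta f) t" .
qed

lemma act_in: "f \<in> \<E> \<Longrightarrow> act P f \<in> \<E>"
proof (induction P arbitrary: f)
  case 0
  then show ?case
    by (simp add: half_smooth_zero)
next
  case (pCons a P)
  then show ?case
    by (simp add: act_pCons half_smooth_add half_smooth_cmult theta_in)
qed

lemma act_lincomb:
  assumes "f \<in> \<E>" "g \<in> \<E>"
  shows "act P (\<lambda>t. a * f t + b * g t) = (\<lambda>t. a * act P f t + b * act P g t)"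
  using assms
proof (induction P arbitrary: f g)
  case (pCons c P)
  then show ?case
    by (auto simp: act_pCons theta_lincomb theta_in algebra_simps)
qed auto

lemma act_theta:
  assumes "f \<in> \<E>"
  shows "act P (theta f) = theta (act P f)"
  using assms
proof (induction P arbitrary: f)
  case 0
  have "theta (\<lambda>t. 0) = (\<lambda>t. 0)"
    using theta_lincomb[OF half_smooth_zero half_smooth_zero, of 0 0] by simp
  then show ?case
    by simp
next
  case (pCons c P)
  have "theta (\<lambda>t. c * f t + 1 * act P (theta f) t) = (\<lambda>t. c * theta f t + 1 * theta (act P (theta f)) t)"
    using pCons by (intro theta_lincomb act_in theta_in)
  then show ?case
    using pCons by (simp add: act_pCons theta_in)
qed

lemma act_mult:
  assumes "f \<in> \<E>"
  shows "act (P * Q) f = act P (act Q f)"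
  using assms
proof (induction P arbitrary: f)
  case (pCons c P)
  then show ?case
    by (simp add: mult_pCons_left act_add act_smult act_pCons theta_in act_theta act_in)
qed auto

lemma act_1 [simp]: "act 1 f = f"
  by (simp add: one_pCons act_pCons)

lemma act_sum_arg:
  assumes "finite I" "\<And>i. i \<in> I \<Longrightarrow> f i \<in> \<E>"
  shows "act P (\<lambda>t. \<Sum>i\<in>I. r i * f i t) = (\<lambda>t. \<Sum>i\<in>I. r i * act P (f i) t)"
  using assms
proof (induction I rule: finite_induct)
  case empty
  show ?case
    using act_lincomb[OF half_smooth_zero half_smooth_zero, of P 0 0] by simp
next
  case (insert i I)
  have "(\<lambda>t. \<Sum>i\<in>I. r i * f i t) \<in> \<E>"
    using insert by (intro half_smooth_sum half_smooth_cmult) auto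
  from act_lincomb[OF _ this, of "f i" P "r i" 1] show ?case
    using insert by auto
qed

lemma act_dilate:
  assumes "f \<in> \<E>" "x > 0"
  shows "act P (\<lambda>t. f (x * t)) = (\<lambda>t. act P f (x * t))"
  using assms by (induction P arbitrary: f) (auto simp: act_pCons theta_dilate theta_in)

text \<open>Integrating factor: if \<open>h\<close> is annihilated by \<open>\<theta> + c\<close>,
  then \<open>h t * t powr c\<close> has derivative 0, and it is 0 near 0.\<close>

lemma act_linear_inj:
  assumes "f \<in> \<E>" "g \<in> \<E>" "act [:c, 1:] f = act [:c, 1:] g"
  shows "f = g"
proof
  fix x
  define h where "h = (\<lambda>t. 1 * f t + (- 1) * g t)"
  have h: "h \<in> \<E>"
    unfolding h_def by (intro half_smooth_add half_smooth_cmult assms)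
  have "act [:c, 1:] h = (\<lambda>t. 0)"
    unfolding h_def by (subst act_lincomb[OF assms(1,2)]) (simp add: assms(3))
  then have lh: "c * h t + of_real t * vderiv h t = 0" for t
    by (simp add: act_pCons theta_def fun_eq_iff)
  obtain a where a: "a > 0" "\<forall>t<a. h t = 0"
    using h by (rule half_smoothE)
  define k where "k = (\<lambda>t. h t * of_real t powr c)"
  have "(k has_vector_derivative 0) (at t)" for t
  proof -
    have "vderiv h t * of_real t powr c + c * (h t * of_real t powr (c - 1)) = 0"
    proof (cases "t > 0")
      case True
      have "of_real t * of_real t powr (c - 1) = complex_of_real t powr c"
        using True powr_add[of "complex_of_real t" 1 "c - 1"] by simp
      then have "vderiv h t * of_real t powr c + c * (h t * of_real t powr (c - 1)) =
          (c * h t + of_real t * vderiv h t) * of_real t powr (c - 1)"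
        by (simp add: algebra_simps flip: \<open>_ = complex_of_real t powr c\<close>)
      then show ?thesis
        using lh by simp
    next
      case False
      then have "t < a"
        using a by simp
      then show ?thesis
        using a vderiv_vanishing[OF a(2)] by simp
    qed
    then show ?thesis
      using has_vector_derivative_vanishing_powr[OF a(2,1) half_smooth_vderiv[OF h], where t = t and s = c]
      by (simp add: k_def)
  qed
  then obtain d where d: "k t = d" for t
    using has_vector_derivative_zero_constant[of UNIV k] by auto
  have "k 0 = 0"
    using a by (simp add: k_def)
  then have "k x = 0"
    using d by metis
  then have "h x = 0"
    using half_smooth_nonpos[OF h] by (cases "x > 0") (auto simp: k_def)
  then show "f x = g x"
    by (simp add: h_def)
qed

text \<open>The inverse of \<open>\<theta> + c\<close> on \<open>\<E>\<close>.\<close>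

definition prim :: "complex \<Rightarrow> (real \<Rightarrow> complex) \<Rightarrow> real \<Rightarrow> complex" where
  "prim c f x = integral {0..x} (\<lambda>t. f t * of_real t powr (c - 1)) * of_real x powr (- c)"

lemma half_smooth_integral:
  assumes "f \<in> \<E>"
  shows "((\<lambda>x. integral {0..x} f) has_vector_derivative f x) (at x)"
    and "\<forall>t<a. f t = 0 \<Longrightarrow> \<forall>x<a. integral {0..x} f = 0"
proof -
  show vanish: "\<forall>x<a. integral {0..x} f = 0" if "\<forall>t<a. f t = 0" for a
    using that by (auto intro!: integral_unique has_integral_is_0)
  show "((\<lambda>x. integral {0..x} f) has_vector_derivative f x) (at x)"
  proof (cases "x > 0")
    case True
    have "((\<lambda>x. integral {0..x} f) has_vector_derivative f x) (at x within {0..x + 1})"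
      by (rule integral_has_vector_derivative) (use half_smooth_continuous[OF assms] True in auto)
    moreover have "at x within {0..x + 1} = at x"
      using True by (intro at_within_interior) auto
    ultimately show ?thesis
      by simp
  next
    case False
    obtain a where a: "a > 0" "\<forall>t<a. f t = 0"
      using assms by (rule half_smoothE)
    have "((\<lambda>x. integral {0..x} f) has_vector_derivative 0) (at x)"
      by (rule has_vector_derivative_transform_within_open[of "\<lambda>_. 0" _ _ "{..<a}"])
         (use False a vanish[OF a(2)] in auto)
    then show ?thesis
      using False a by simp
  qed
qed

text \<open>Variation of constants: with G the primitive of \<open>f t * t powr (c - 1)\<close>,
  applying \<theta> to \<open>G t * t powr (- c)\<close> gives \<open>f\<close> minus
  \<open>c\<close> times the same function. As \<open>f\<close> vanishes near 0, the integral from 0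
  converges and vanishes there too.\<close>

lemma prim_in_act:
  assumes "f \<in> \<E>"
  shows "prim c f \<in> \<E>" "act [:c, 1:] (prim c f) = f"
proof -
  define h where "h = (\<lambda>t. f t * of_real t powr (c - 1))"
  define G where "G = (\<lambda>x. integral {0..x} h)"
  have h: "h \<in> \<E>"
    unfolding h_def by (rule half_smooth_powr) fact
  obtain a where a: "a > 0" "\<forall>t<a. h t = 0"
    using h by (rule half_smoothE)
  note G = half_smooth_integral(1)[OF h, folded G_def] half_smooth_integral(2)[OF h a(2), folded
      G_def fun_cong[OF G_def]]
  have G2: "\<forall>x<a. G x = 0"
    unfolding G_def by (rule half_smooth_integral(2)[OF h a(2)])
  have "G \<in> \<E>"
  proof (rule half_smoothI[OF _ a(1) G2])
    fix k
    have "cdiff (Suc k) G"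
      by (rule cdiff_SucI[OF G(1)]) (rule half_smooth_cdiff[OF h])
    then show "cdiff k G"
      by (rule cdiff_SucD(3))
  qed
  moreover have p: "prim c f = (\<lambda>x. G x * of_real x powr (- c))"
    by (auto simp: prim_def G_def h_def)
  ultimately show "prim c f \<in> \<E>"
    using half_smooth_powr by simp
  show "act [:c, 1:] (prim c f) = f"
  proof
    fix x
    have d: "vderiv (prim c f) x = h x * of_real x powr (- c) + (- c) * (G x * of_real x powr (- c - 1))"
      unfolding p by (rule vderiv_eqI, rule has_vector_derivative_vanishing_powr) (use a G(1) G2 in auto)
    show "act [:c, 1:] (prim c f) x = f x"
    proof (cases "x > 0")
      case True
      have 1: "of_real x * of_real x powr (- c - 1) = complex_of_real x powr (- c)"
        using True powr_add[of "complex_of_real x" 1 "- c - 1"] by simp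
      have 2: "of_real x * (of_real x powr (c - 1) * complex_of_real x powr (- c)) = 1"
        using True powr_add[of "complex_of_real x" "c - 1" "- c"] by (simp add: powr_minus field_simps)
      have "of_real x * vderiv (prim c f) x = f x - c * prim c f x"
      proof -
        have "of_real x * vderiv (prim c f) x = 
          f x * (of_real x * (of_real x powr (c - 1) * complex_of_real x powr (- c))) - 
          c * G x * (of_real x * of_real x powr (- c - 1))"
          unfolding d by (simp add: h_def algebra_simps)
        then show ?thesis
          unfolding 1 2 p by simp
      qed
      then show ?thesis
        by (simp add: act_pCons theta_def)
    next
      case False
      then show ?thesis
        using half_smooth_nonpos[OF \<open>prim c f \<in> \<E>\<close>] half_smooth_nonpos[OF assms]
          half_smooth_nonpos[OF act_in[OF \<open>prim c f \<in> \<E>\<close>]] by simp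
    qed
  qed
qed

text \<open>Characterises \<open>prim\<close> by its equation. Linearity and commutation with
  dilations and with \<open>act\<close> are then inherited from \<open>act\<close>, without
  returning to the integral.\<close>

lemma prim_eqI:
  assumes "f \<in> \<E>" "g \<in> \<E>" "act [:c, 1:] g = f"
  shows "prim c f = g"
  by (rule act_linear_inj[of _ _ c]) (use assms prim_in_act in auto)

lemma prim_act:
  assumes "f \<in> \<E>"
  shows "prim c (act P f) = act P (prim c f)"
proof (rule prim_eqI)
  have "act [:c, 1:] (act P (prim c f)) = act (P * [:c, 1:]) (prim c f)"
    by (simp only: act_mult[OF prim_in_act(1)[OF assms], symmetric] mult.commute)
  then show "act [:c, 1:] (act P (prim c f)) = act P f"
    using assms by (simp only: act_mult prim_in_act)
qed (use assms in \<open>simp_all add: act_in prim_in_act\<close>)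

lemma prim_dilate:
  assumes "f \<in> \<E>" "x > 0"
  shows "prim c (\<lambda>t. f (x * t)) = (\<lambda>t. prim c f (x * t))"
  using assms
  by (intro prim_eqI) (simp_all add: half_smooth_dilate act_dilate prim_in_act)

text \<open>This locality is what corresponds, on the operator side, to support in (0, 1].\<close>

lemma prim_cong:
  assumes "\<And>t. t \<le> x \<Longrightarrow> f t = g t"
  shows "prim c f x = prim c g x"
proof -
  have "integral {0..x} (\<lambda>t. f t * of_real t powr (c - 1)) = integral {0..x} (\<lambda>t. g t * of_real t
      powr (c - 1))"
    by (rule integral_cong) (use assms in auto)
  then show ?thesis
    by (simp add: prim_def)
qed

lemma prim_at_1: "prim c f 1 = integral {0..1} (\<lambda>t. f t * of_real t powr (c - 1))"
  by (simp add: prim_def)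

text \<open>A sum of partial fractions in \<theta>. Evaluated at 1 it is integration over (0, 1)
  against the density with terms \<open>r i * t powr (c i - 1)\<close>.\<close>

definition prim_sum :: "nat \<Rightarrow> (nat \<Rightarrow> complex) \<Rightarrow> (nat \<Rightarrow> complex) \<Rightarrow> (real \<Rightarrow> complex) \<Rightarrow> real \<Rightarrow> complex" where
  "prim_sum N r c f = (\<lambda>x. \<Sum>i<N. r i * prim (c i) f x)"

lemma prim_sum_in: "f \<in> \<E> \<Longrightarrow> prim_sum N r c f \<in> \<E>"
  unfolding prim_sum_def by (intro half_smooth_sum half_smooth_cmult prim_in_act) auto

lemma prim_sum_act: "f \<in> \<E> \<Longrightarrow> prim_sum N r c (act P f) = act P (prim_sum N r c f)"
  unfolding prim_sum_def by (subst act_sum_arg) (auto simp: prim_act prim_in_act)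

lemma prim_sum_dilate: "f \<in> \<E> \<Longrightarrow> x > 0 \<Longrightarrow> prim_sum N r c (\<lambda>t. f (x * t)) = (\<lambda>t. prim_sum N r c f (x * t))"
  by (simp add: prim_sum_def prim_dilate)

lemma prim_sum_cong: "(\<And>t. t \<le> x \<Longrightarrow> f t = g t) \<Longrightarrow> prim_sum N r c f x = prim_sum N r c g x"
  unfolding prim_sum_def by (intro sum.cong arg_cong2[of _ _ _ _ "(*)"] prim_cong) auto

text \<open>Clearing denominators: in the j-th summand the factor \<open>\<theta> + c j\<close>
  cancels the inverse and the other factors remain.\<close>

lemma act_prim_sum:
  assumes "f \<in> \<E>"
  shows "act (\<Prod>i<N. [:c i, 1:]) (prim_sum N r c f) = act (\<Sum>j<N. smult (r j) (\<Prod>i\<in>{..<N} - {j}. [:c i,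
      1:])) f"
proof -
  have *: "act (\<Prod>i<N. [:c i, 1:]) (prim (c j) f) = act (\<Prod>i\<in>{..<N} - {j}. [:c i, 1:]) f" if "j < N" for j
  proof -
    have "(\<Prod>i<N. [:c i, 1:]) = (\<Prod>i\<in>{..<N} - {j}. [:c i, 1:]) * [:c j, 1:]"
      using that by (subst prod.remove[of "{..<N}" j]) (simp_all only: mult.commute finite_lessThan
          lessThan_iff)
    then show ?thesis
      using assms by (simp only: act_mult prim_in_act)
  qed
  show ?thesis
    unfolding prim_sum_def
    by (subst act_sum_arg) (use * assms in \<open>auto simp: prim_in_act act_sum act_smult\<close>)
qed

subsection \<open>Distributions as operators\<close>

lemma test_functionI:
  assumes "\<And>k. cdiff k f" "a > 0" "\<And>t. t \<notin> {a..b} \<Longrightarrow> f t = 0"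
  shows "f \<in> \<D>" "tsupport f \<subseteq> {a..b}"
proof -
  show "tsupport f \<subseteq> {a..b}"
    unfolding tsupport_def by (rule closure_minimal) (use assms(3) in \<open>blast, simp\<close>)
  then have sub: "{a..b} \<inter> tsupport f = tsupport f"
    by blast
  have "compact ({a..b} \<inter> tsupport f)"
    by (intro compact_Int_closed) (auto simp: tsupport_def)
  then show "f \<in> \<D>"
    using assms(1,2) \<open>tsupport f \<subseteq> {a..b}\<close>
    by (force simp: test_functions_def smooth_iff_cdiff sub)
qed

lemma tsupport_outside: "t \<notin> tsupport f \<Longrightarrow> f t = 0"
  using closure_subset[of "{t. f t \<noteq> 0}"] by (auto simp: tsupport_def)

lemma compact_pos_bounds:
  fixes K :: "real set"
  assumes "compact K" "K \<subseteq> {0<..}"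
  obtains a b where "a > 0" "K \<subseteq> {a..b}"
proof (cases "K = {}")
  case True
  then show ?thesis
    using that[of 1 1] by simp
next
  case False
  obtain a where a: "a \<in> K" "\<forall>t\<in>K. a \<le> t"
    using compact_attains_inf[OF assms(1) False] by auto
  obtain b where b: "b \<in> K" "\<forall>t\<in>K. t \<le> b"
    using compact_attains_sup[OF assms(1) False] by auto
  show ?thesis
    by (rule that[of a b]) (use a b assms in auto)
qed

lemma test_functionE:
  assumes "f \<in> \<D>"
  obtains a b where "a > 0" "\<forall>t. t \<notin> {a..b} \<longrightarrow> f t = 0" "tsupport f \<subseteq> {a..b}"
proof -
  have "compact (tsupport f)" "tsupport f \<subseteq> {0<..}"
    using assms by (auto simp: test_functions_def)
  then obtain a b where ab: "a > 0" "tsupport f \<subseteq> {a..b}"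
    by (rule compact_pos_bounds)
  show ?thesis
    by (rule that[OF ab(1) _ ab(2)]) (use ab tsupport_outside in blast)
qed

lemma test_cdiff: "f \<in> \<D> \<Longrightarrow> cdiff k f"
  by (simp add: test_functions_def smooth_iff_cdiff)

lemma test_half_smooth: "f \<in> \<D> \<Longrightarrow> f \<in> \<E>"
proof -
  assume f: "f \<in> \<D>"
  then obtain a b where ab: "a > 0" "\<forall>t. t \<notin> {a..b} \<longrightarrow> f t = 0" "tsupport f \<subseteq> {a..b}"
    by (rule test_functionE)
  show ?thesis
    by (rule half_smoothI[OF _ ab(1)]) (use f ab(2) in \<open>simp_all add: test_cdiff\<close>)
qed

lemma test_half_smoothI:
  assumes "f \<in> \<E>" "\<And>t. t > b \<Longrightarrow> f t = 0"
  shows "f \<in> \<D>"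
proof -
  obtain a where "a > 0" "\<forall>t<a. f t = 0"
    using assms(1) by (rule half_smoothE)
  then show ?thesis
    using assms by (intro test_functionI(1)[of f a b]) (auto simp: half_smooth_cdiff)
qed

lemma test_bound:
  assumes "f \<in> \<D>" obtains b where "\<And>t. t > b \<Longrightarrow> f t = 0"
proof -
  obtain a b where "a > 0" and ab: "\<forall>t. t \<notin> {a..b} \<longrightarrow> f t = 0" and "tsupport f \<subseteq> {a..b}"
    using assms by (rule test_functionE)
  show ?thesis
    by (rule that[of b]) (use ab in simp)
qed

lemma test_lincomb:
  assumes "f \<in> \<D>" "g \<in> \<D>"
  shows "(\<lambda>t. a * f t + b * g t) \<in> \<D>"
proof -
  obtain c d where "\<And>t. t > c \<Longrightarrow> f t = 0" "\<And>t. t > d \<Longrightarrow> g t = 0"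
    using assms by (meson test_bound)
  then show ?thesis
    by (intro test_half_smoothI[of _ "max c d"] half_smooth_add half_smooth_cmult
        test_half_smooth[OF assms(1)]
        test_half_smooth[OF assms(2)]) auto
qed

lemma vderiv_vanishing_above:
  assumes "\<And>t. t > b \<Longrightarrow> f t = 0" "t > b"
  shows "vderiv f t = 0"
  by (rule vderiv_eqI, rule has_vector_derivative_transform_within_open[of "\<lambda>_. 0" _ _ "{b<..}"])
     (use assms in auto)

lemma test_theta:
  assumes "f \<in> \<D>" shows "theta f \<in> \<D>"
proof -
  obtain c where "\<And>t. t > c \<Longrightarrow> f t = 0"
    using assms by (meson test_bound)
  then show ?thesis
    using vderiv_vanishing_above[of c f]
    by (intro test_half_smoothI[of _ c] theta_in test_half_smooth[OF assms]) (simp add: theta_def)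
qed

lemma test_act: "f \<in> \<D> \<Longrightarrow> act P f \<in> \<D>"
proof (induction P arbitrary: f)
  case 0
  then show ?case
    using test_lincomb[of f f 0 0] by simp
next
  case (pCons a P)
  then show ?case
    using test_lincomb[of f "act P (theta f)" a 1] by (simp add: act_pCons test_theta)
qed

lemma test_dilate:
  assumes "f \<in> \<D>" "x > 0" shows "(\<lambda>t. f (x * t)) \<in> \<D>"
proof -
  obtain c where "\<And>t. t > c \<Longrightarrow> f t = 0"
    using assms by (meson test_bound)
  then show ?thesis
    using assms(2)
    by (intro test_half_smoothI[of _ "c / x"] half_smooth_dilate test_half_smooth[OF assms(1)])
        (auto simp: field_simps)
qed

lemma test_powr:
  assumes "f \<in> \<D>" shows "(\<lambda>t. f t * of_real t powr s) \<in> \<D>"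
proof -
  obtain c where "\<And>t. t > c \<Longrightarrow> f t = 0"
    using assms by (meson test_bound)
  then show ?thesis
    using assms by (intro test_half_smoothI[of _ c]) (auto simp: half_smooth_powr test_half_smooth)
qed

text \<open>The bound 2 is a convenient point beyond 1: agreement up to 2 covers a neighbourhood of
  (0, 1], which determines the pairing.\<close>

lemma ex_test_cutoff:
  assumes "f \<in> \<E>"
  obtains \<phi> where "\<phi> \<in> \<D>" "\<forall>t\<le>2. \<phi> t = f t"
proof -
  obtain h where h: "smooth h" "\<And>t. t \<le> 2 \<Longrightarrow> h t = 1" "\<And>t. t \<ge> 3 \<Longrightarrow> h t = 0"
    using ex_smooth_cutoff by blast
  have "(\<lambda>t. h t * f t) \<in> \<D>"
    by (rule test_half_smoothI[of _ 3]) (use h assms half_smooth_mult in \<open>auto simp: smooth_iff_cdiff\<close>)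
  then show ?thesis
    by (rule that) (use h in auto)
qed

lemma conv_carrier_iff: "u \<in> carrier conv_algebra \<longleftrightarrow> u \<in> distributions \<and> supported_in_unit u"
  by (simp add: conv_algebra_def)

lemma distribution_lincomb:
  assumes "u \<in> distributions" "f \<in> \<D>" "g \<in> \<D>"
  shows "u (\<lambda>t. a * f t + b * g t) = a * u f + b * u g"
  using assms by (auto simp: distributions_def)

lemma carrier_local:
  assumes "u \<in> carrier conv_algebra" "f \<in> \<D>" "g \<in> \<D>" "e > 0" "\<And>t. t < 1 + e \<Longrightarrow> f t = g t"
  shows "u f = u g"
proof -
  let ?d = "\<lambda>t. 1 * f t + (- 1) * g t"
  have d: "?d \<in> \<D>"
    by (rule test_lincomb) fact+
  have "tsupport ?d \<subseteq> {1 + e..}"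
    unfolding tsupport_def by (rule closure_minimal) (use assms(5) in \<open>auto simp: not_less[symmetric]\<close>)
  then have "tsupport ?d \<subseteq> {1<..}"
    using assms(4) by auto
  then have "u ?d = 0"
    using assms(1) d by (simp add: conv_carrier_iff supported_in_unit_def)
  moreover have "u ?d = 1 * u f + (- 1) * u g"
    by (rule distribution_lincomb) (use assms in \<open>auto simp: conv_carrier_iff\<close>)
  ultimately show ?thesis
    by simp
qed

text \<open>Removes the choice in \<open>pairing\<close>: two admissible test functions agree below
  1 plus the smaller of their margins, and \<open>u\<close> annihilates their difference by its
  support.\<close>

lemma pairing_eq:
  assumes "u \<in> carrier conv_algebra" "f \<in> \<D>" "e > 0" "\<And>t. t < 1 + e \<Longrightarrow> f t = g t"
  shows "pairing u g = u f"
proof -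
  let ?P = "\<lambda>\<phi>. \<phi> \<in> \<D> \<and> (\<exists>e>0. \<forall>t<1 + e. \<phi> t = g t)"
  have "?P (SOME \<phi>. ?P \<phi>)"
    by (rule someI[of ?P f]) (use assms in auto)
  then obtain d where d: "(SOME \<phi>. ?P \<phi>) \<in> \<D>" "d > 0" "\<And>t. t < 1 + d \<Longrightarrow> (SOME \<phi>. ?P \<phi>) t = g t"
    by blast
  show ?thesis
    unfolding pairing_def
    by (rule carrier_local[OF assms(1) d(1) assms(2), of "min d e"]) (use d assms in auto)
qed

text \<open>The operator of \<open>u\<close> is \<open>(R f) x = u (t \<mapsto> f (x t))\<close>; commuting with dilations, it is determined by
  \<open>u f = R f 1\<close>.\<close>

definition dilation_operator :: "((real \<Rightarrow> complex) \<Rightarrow> real \<Rightarrow> complex) \<Rightarrow> bool" where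
  "dilation_operator R \<longleftrightarrow>
     (\<forall>f\<in>\<E>. R f \<in> \<E>) \<and>
     (\<forall>f\<in>\<E>. \<forall>x>0. R (\<lambda>t. f (x * t)) = (\<lambda>t. R f (x * t))) \<and>
     (\<forall>f\<in>\<E>. \<forall>g\<in>\<E>. \<forall>x. (\<forall>t<x. f t = g t) \<longrightarrow> (\<forall>t<x. R f t = R g t))"

text \<open>The value of \<open>u\<close> is prescribed on test functions only. On the larger space
  \<open>\<E>\<close> the operator supplies the extension of \<open>u\<close>, which coincides with
  \<open>pairing\<close> by \<open>pairing_represents\<close>.\<close>

definition represents :: "((real \<Rightarrow> complex) \<Rightarrow> real \<Rightarrow> complex) \<Rightarrow> functional \<Rightarrow> bool" where
  "represents R u \<longleftrightarrow> u \<in> carrier conv_algebra \<and> dilation_operator R \<and> (\<forall>f\<in>\<D>. u f = R f 1)"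

lemma dilation_operatorD:
  assumes "dilation_operator R"
  shows "f \<in> \<E> \<Longrightarrow> R f \<in> \<E>"
    and "f \<in> \<E> \<Longrightarrow> x > 0 \<Longrightarrow> R (\<lambda>t. f (x * t)) = (\<lambda>t. R f (x * t))"
    and "f \<in> \<E> \<Longrightarrow> g \<in> \<E> \<Longrightarrow> (\<And>t. t < x \<Longrightarrow> f t = g t) \<Longrightarrow> t < x \<Longrightarrow> R f t = R g t"
  using assms unfolding dilation_operator_def by blast+

lemma pairing_represents:
  assumes "represents R u" "f \<in> \<E>"
  shows "pairing u f = R f 1"
proof -
  have u: "u \<in> carrier conv_algebra" "dilation_operator R" "\<And>f. f \<in> \<D> \<Longrightarrow> u f = R f 1"
    using assms by (auto simp: represents_def)
  obtain \<phi> where \<phi>: "\<phi> \<in> \<D>" "\<forall>t\<le>2. \<phi> t = f t"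
    using assms(2) by (rule ex_test_cutoff) 
  have "pairing u f = u \<phi>"
    by (rule pairing_eq[OF u(1) \<phi>(1), of 1]) (use \<phi> in auto)
  also have "\<dots> = R \<phi> 1"
    using u \<phi> by simp
  also have "\<dots> = R f 1"
    by (rule dilation_operatorD(3)[OF u(2), of _ _ 2]) (use \<phi> assms test_half_smooth in auto)
  finally show ?thesis .
qed

text \<open>Equivariance under dilations identifies the inner pairing at \<open>x > 0\<close> with
  \<open>S f x\<close>; for \<open>x \<le> 0\<close> both sides are 0 because \<open>S f\<close>
  lies in \<open>\<E>\<close>. The left factor \<open>u\<close> is arbitrary, so that the formula
  applies to an unknown left inverse.\<close>

lemma convolution_right_represents:
  assumes "represents S v" "f \<in> \<D>"
  shows "Defs.convolution u v f = pairing u (S f)"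
proof -
  have v: "dilation_operator S" "\<And>f. f \<in> \<D> \<Longrightarrow> v f = S f 1"
    using assms by (auto simp: represents_def)
  note f = assms(2) test_half_smooth[OF assms(2)]
  have "(if x > 0 then v (\<lambda>y. f (x * y)) else 0) = S f x" for x
  proof (cases "x > 0")
    case True
    then show ?thesis
      using v(2)[OF test_dilate[OF f(1) True]] dilation_operatorD(2)[OF v(1) f(2) True] by simp
  next
    case False
    then show ?thesis
      using half_smooth_nonpos dilation_operatorD(1)[OF v(1) f(2)] by simp
  qed
  then show ?thesis
    using f by (simp add: Defs.convolution_def)
qed

lemma convolution_represents:
  assumes "represents R u" "represents S v" "\<And>f. f \<in> \<E> \<Longrightarrow> R (S f) = f"
  shows "Defs.convolution u v = delta_one"
proof
  fix f
  show "Defs.convolution u v f = delta_one f"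
  proof (cases "f \<in> \<D>")
    case True
    have "S f \<in> \<E>"
      using assms(2) True by (auto simp: represents_def intro: dilation_operatorD(1) test_half_smooth)
    then have "Defs.convolution u v f = R (S f) 1"
      using convolution_right_represents[OF assms(2) True] pairing_represents[OF assms(1)] by simp
    then show ?thesis
      using True assms(3) test_half_smooth by (simp add: delta_one_def)
  next
    case False
    then show ?thesis
      by (simp add: Defs.convolution_def delta_one_def)
  qed
qed

text \<open>
  Uniqueness of the inverse without associativity of the convolution: if \<open>y\<close> is a left inverse of
  \<open>u\<close>, then a test function \<open>f = R (S f)\<close> is paired with \<open>y\<close> by evaluating \<open>y * u\<close> at a cut-off of
  \<open>S f\<close>.
\<close>

lemma inverse_represents:
  assumes "represents R u" "represents S v"
    and RS: "\<And>f. f \<in> \<E> \<Longrightarrow> R (S f) = f" and SR: "\<And>f. f \<in> \<E> \<Longrightarrow> S (R f) = f"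
  shows "u \<in> Units conv_algebra \<and> inv\<^bsub>conv_algebra\<^esub> u = v"
proof -
  have u: "u \<in> carrier conv_algebra" "dilation_operator R" "\<And>f. f \<in> \<D> \<Longrightarrow> u f = R f 1"
    and v: "v \<in> carrier conv_algebra" "dilation_operator S" "\<And>f. f \<in> \<D> \<Longrightarrow> v f = S f 1"
    using assms by (auto simp: represents_def)
  have [simp]: "x \<otimes>\<^bsub>conv_algebra\<^esub> y = Defs.convolution x y" "\<one>\<^bsub>conv_algebra\<^esub> = delta_one" for x y
    by (simp_all add: conv_algebra_def)
  have uv: "Defs.convolution u v = delta_one" "Defs.convolution v u = delta_one"
    using convolution_represents assms by blast+
  have uniq: "y = v" if y: "y \<in> carrier conv_algebra" "Defs.convolution y u = delta_one" for y
  proof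
    fix f
    show "y f = v f"
    proof (cases "f \<in> \<D>")
      case True
      have Sf: "S f \<in> \<E>"
        using dilation_operatorD(1)[OF v(2) test_half_smooth[OF True]] .
      then obtain \<phi> where \<phi>: "\<phi> \<in> \<D>" "\<forall>t\<le>2. \<phi> t = S f t"
        by (rule ex_test_cutoff) 
      \<comment> \<open>By locality of \<open>R\<close> the cut-off does no harm below 2, so the
        test function \<open>f\<close> itself can represent \<open>R \<phi>\<close> in the pairing
        with \<open>y\<close>.\<close>
      have "R \<phi> t = f t" if "t < 2" for t
      proof -
        have "R \<phi> t = R (S f) t"
          by (rule dilation_operatorD(3)[OF u(2), of _ _ 2]) (use that \<phi> Sf test_half_smooth in auto)
        then show ?thesis
          using RS True test_half_smooth by simp
      qed
      then have "pairing y (R \<phi>) = y f"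
        by (intro pairing_eq[OF y(1) True, of 1]) auto
      then have "y f = Defs.convolution y u \<phi>"
        using convolution_right_represents[OF assms(1) \<phi>(1)] by simp
      also have "\<dots> = S f 1"
        using y(2) \<phi> by (simp add: delta_one_def)
      finally show ?thesis
        using v True by simp
    next
      case False
      have "y f = undefined" "v f = undefined"
        using y(1) v(1) False by (auto simp: conv_carrier_iff distributions_def extensional_def)
      then show ?thesis
        by simp
    qed
  qed
  have "inv\<^bsub>conv_algebra\<^esub> u = v"
    unfolding m_inv_def by (rule the_equality) (use v(1) uv in simp, rule uniq, simp_all)
  moreover have "u \<in> Units conv_algebra"
    using u(1) v(1) uv by (auto simp: Units_def)
  ultimately show ?thesis
    by simp
qed

lemma dilation_operator_act: "dilation_operator (act P)"
  unfolding dilation_operator_def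
proof (intro conjI ballI allI impI)
  fix f g x t assume fg: "f \<in> \<E>" "g \<in> \<E>" "\<forall>t<x. f t = g t" "(t::real) < x"
  then show "act P f t = act P g t"
  proof (induction P arbitrary: f g)
    case (pCons a P)
    \<comment> \<open>Agreement on an open half-line passes to derivatives; this is the reason for
      the strict inequality in the locality clause.\<close>
    have "vderiv f t = vderiv g t" if "t < x" for t
      by (rule vderiv_eqI, rule has_vector_derivative_transform_within_open[of g _ _ "{..<x}"])
         (use pCons that half_smooth_vderiv in auto)
    then show ?case
      using pCons.prems pCons.IH[of "theta f" "theta g"]
      by (simp add: act_pCons theta_in) (simp add: theta_def)
  qed auto
qed (auto simp: act_in act_dilate)

lemma dilation_operator_prim_sum: "dilation_operator (prim_sum N r c)"
  unfolding dilation_operator_def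
proof (intro conjI ballI allI impI)
  fix f g x t assume fg: "f \<in> \<E>" "g \<in> \<E>" "\<forall>t<x. f t = g t" "(t::real) < x"
  then show "prim_sum N r c f t = prim_sum N r c g t"
    by (intro prim_sum_cong) auto
qed (auto simp: prim_sum_in prim_sum_dilate)

lemma dilation_operator_compose:
  assumes "dilation_operator R" "dilation_operator S"
  shows "dilation_operator (\<lambda>f. R (S f))"
  unfolding dilation_operator_def
proof (intro conjI ballI allI impI)
  fix f g x t assume "f \<in> \<E>" "g \<in> \<E>" "\<forall>t<x. f t = g t" "(t::real) < x"
  then show "R (S f) t = R (S g) t"
    using dilation_operatorD(3)[OF assms(1), of "S f" "S g" x t] dilation_operatorD(1)[OF assms(2)]
      dilation_operatorD(3)[OF assms(2), of f g x] by blast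
qed (simp_all add: dilation_operatorD[OF assms(1)] dilation_operatorD[OF assms(2)])

lemma dilation_operator_cmult:
  assumes "dilation_operator R" shows "dilation_operator (\<lambda>f t. k * R f t)"
  unfolding dilation_operator_def
proof (intro conjI ballI allI impI)
  fix f g x t assume "f \<in> \<E>" "g \<in> \<E>" "\<forall>t<x. f t = g t" "(t::real) < x"
  then show "k * R f t = k * R g t"
    using dilation_operatorD(3)[OF assms, of f g x t] by simp
qed (simp_all add: dilation_operatorD[OF assms] half_smooth_cmult)

lemma dilation_operator_id: "dilation_operator (\<lambda>f. f)"
  unfolding dilation_operator_def by auto

section \<open>Continuity estimates: the functionals that occur belong to the algebra\<close>

lemma test_vderiv:
  assumes "f \<in> \<D>" shows "(vderiv ^^ k) f \<in> \<D>"
proof (induction k)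
  case (Suc k)
  obtain b where b: "\<And>t. t > b \<Longrightarrow> (vderiv ^^ k) f t = 0"
    using Suc by (meson test_bound)
  show ?case
    using vderiv_vanishing_above[of b "(vderiv ^^ k) f"] b
    by (intro test_half_smoothI[of _ b]) (auto intro: half_smooth_in_vderiv test_half_smooth[OF Suc])
qed (use assms in auto)

lemma test_bdd:
  assumes "f \<in> \<D>" shows "bdd_above (range (\<lambda>t. norm (f t)))"
proof -
  obtain a b where ab: "a > 0" "\<forall>t. t \<notin> {a..b} \<longrightarrow> f t = 0" "tsupport f \<subseteq> {a..b}"
    using assms by (rule test_functionE)
  have "compact (f ` {a..b})"
    by (intro compact_continuous_image half_smooth_continuous[OF test_half_smooth[OF assms]]) auto
  then have "bounded (f ` {a..b})"
    by (rule compact_imp_bounded)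
  then obtain B where "\<forall>t\<in>{a..b}. norm (f t) \<le> B" 
    by (auto simp: bounded_iff)
  then have "norm (f t) \<le> max B 0" for t
    using ab(2) by (cases "t \<in> {a..b}") (auto simp: le_max_iff_disj)
  then show ?thesis
    by (intro bdd_aboveI[of _ "max B 0"]) auto
qed

lemma test_le_SUP:
  assumes "f \<in> \<D>" shows "norm (f t) \<le> (SUP t. norm (f t))"
  by (rule cSUP_upper[OF _ test_bdd[OF assms]]) simp

text \<open>A criterion for distributions of order 0, applied to the delta distribution and to the
  densities. Euler operators raise the order and have their own estimate in
  \<open>represents_euler_op\<close>.\<close>

lemma carrierI:
  assumes "u \<in> extensional \<D>"
    and lin: "\<And>f g a b. f \<in> \<D> \<Longrightarrow> g \<in> \<D> \<Longrightarrow> u (\<lambda>t. a * f t + b * g t) = a * u f + b * u g"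
    and bd: "\<And>a b. a > 0 \<Longrightarrow> \<exists>C. \<forall>f\<in>\<D>. tsupport f \<subseteq> {a..b} \<longrightarrow> norm (u f) \<le> C * (SUP t. norm (f t))"
    and sup: "\<And>f. f \<in> \<D> \<Longrightarrow> \<forall>t\<le>1. f t = 0 \<Longrightarrow> u f = 0"
  shows "u \<in> carrier conv_algebra"
  unfolding conv_carrier_iff distributions_def supported_in_unit_def
proof safe
  fix K :: "real set" assume K: "compact K" "K \<subseteq> {0<..}"
  obtain a b where ab: "a > 0" "K \<subseteq> {a..b}"
    using K by (rule compact_pos_bounds)
  obtain C where "\<forall>f\<in>\<D>. tsupport f \<subseteq> {a..b} \<longrightarrow> norm (u f) \<le> C * (SUP t. norm (f t))"
    using bd[OF ab(1)] by blast
  then show "\<exists>C N. \<forall>\<phi>\<in>\<D>. tsupport \<phi> \<subseteq> K \<longrightarrow>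
      norm (u \<phi>) \<le> C * (\<Sum>k\<le>(N::nat). SUP t. norm ((vderiv ^^ k) \<phi> t))"
    using ab(2) by (intro exI[of _ C] exI[of _ 0]) auto
next
  fix f assume f: "f \<in> \<D>" "tsupport f \<subseteq> {1<..}"
  have "t \<notin> tsupport f" if "t \<le> 1" for t
    using f(2) that by auto
  then show "u f = 0"
    using sup[OF f(1)] tsupport_outside by blast
qed (use assms in auto)

lemma prim_lincomb:
  assumes "f \<in> \<E>" "g \<in> \<E>"
  shows "prim c (\<lambda>t. a * f t + b * g t) = (\<lambda>t. a * prim c f t + b * prim c g t)"
  using assms
  by (intro prim_eqI) (simp_all add: half_smooth_add half_smooth_cmult act_lincomb prim_in_act)

text \<open>The modulus of \<open>t powr (c - 1)\<close> is monotone on [a, 1], hence bounded by the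
  larger of its two end values; below \<open>a\<close> the function \<open>f\<close>
  vanishes.\<close>

lemma norm_prim_le:
  assumes "f \<in> \<D>" "a > 0" "tsupport f \<subseteq> {a..b}"
  shows "norm (prim c f 1) \<le> max (a powr (Re c - 1)) 1 * (SUP t. norm (f t))"
proof -
  have "norm (f t * of_real t powr (c - 1)) \<le> max (a powr (Re c - 1)) 1 * (SUP t. norm (f t))" if "t
      \<in> {0..1}" for t
  proof (cases "t < a")
    case True
    then have "t \<notin> tsupport f"
      using assms(3) by auto
    then have "f t = 0"
      by (rule tsupport_outside)
    moreover have "0 \<le> (SUP t. norm (f t))"
      using test_le_SUP[OF assms(1), of 0] norm_ge_zero order_trans by blast
    ultimately show ?thesis
      by simp
  next
    case False
    then have t: "a \<le> t" "t \<le> 1" "t > 0"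
      using that assms by auto
    have "t powr (Re c - 1) \<le> max (a powr (Re c - 1)) 1"
    proof (cases "Re c \<ge> 1")
      case True
      then show ?thesis
        using t powr_mono2[of "Re c - 1" t 1] by (simp add: le_max_iff_disj)
    next
      case False
      then show ?thesis
        using t assms(2) powr_mono2'[of "Re c - 1" a t] by (simp add: le_max_iff_disj)
    qed
    then show ?thesis
      using t test_le_SUP[OF assms(1), of t] 
      by (auto simp: norm_mult norm_powr_real_powr mult.commute[of "norm (f t)"] intro!: mult_mono)
  qed
  moreover have "continuous_on {0..1} (\<lambda>t. f t * of_real t powr (c - 1))"
    by (intro half_smooth_continuous half_smooth_powr test_half_smooth assms)
  ultimately show ?thesis
    unfolding prim_at_1 using integral_bound[of 0 1] by force
qed

lemma prim_sum_carrier: "(\<lambda>\<phi>\<in>\<D>. prim_sum N r c \<phi> 1) \<in> carrier conv_algebra"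
proof (rule carrierI)
  fix a b :: real assume a: "a > 0"
  show "\<exists>C. \<forall>f\<in>\<D>. tsupport f \<subseteq> {a..b} \<longrightarrow>
          norm ((\<lambda>\<phi>\<in>\<D>. prim_sum N r c \<phi> 1) f) \<le> C * (SUP t. norm (f t))"
  proof (intro exI ballI impI)
    fix f assume f: "f \<in> \<D>" "tsupport f \<subseteq> {a..b}"
    have "norm (prim_sum N r c f 1) \<le> (\<Sum>i<N. norm (r i) * (max (a powr (Re (c i) - 1)) 1 * (SUP t.
        norm (f t))))"
      unfolding prim_sum_def
      by (rule sum_norm_le) (auto simp: norm_mult intro!: mult_left_mono norm_prim_le[OF f(1) a f(2)])
    also have "\<dots> = (\<Sum>i<N. norm (r i) * max (a powr (Re (c i) - 1)) 1) * (SUP t. norm (f t))"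
      by (simp add: sum_distrib_right mult.assoc)
    finally show "norm ((\<lambda>\<phi>\<in>\<D>. prim_sum N r c \<phi> 1) f) \<le> 
        (\<Sum>i<N. norm (r i) * max (a powr (Re (c i) - 1)) 1) * (SUP t. norm (f t))"
      using f(1) by simp
  qed
next
  fix f assume f: "f \<in> \<D>" "\<forall>t\<le>1. f t = 0"
  have "prim d f 1 = 0" for d
    unfolding prim_at_1 by (rule integral_unique, rule has_integral_is_0) (use f in auto)
  then show "(\<lambda>\<phi>\<in>\<D>. prim_sum N r c \<phi> 1) f = 0"
    using f(1) by (simp add: prim_sum_def)
qed (auto simp: prim_sum_def prim_lincomb test_lincomb test_half_smooth sum.distrib sum_distrib_left
    algebra_simps)

lemma represents_prim_sum: "represents (prim_sum N r c) (\<lambda>\<phi>\<in>\<D>. prim_sum N r c \<phi> 1)"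
  by (simp add: represents_def prim_sum_carrier dilation_operator_prim_sum)

lemma represents_delta: "represents (\<lambda>f t. k * f t) (\<lambda>\<phi>\<in>\<D>. k * \<phi> 1)"
proof -
  have "(\<lambda>\<phi>\<in>\<D>. k * \<phi> 1) \<in> carrier conv_algebra"
  proof (rule carrierI)
    fix a b :: real
    show "\<exists>C. \<forall>f\<in>\<D>. tsupport f \<subseteq> {a..b} \<longrightarrow>
            norm ((\<lambda>\<phi>\<in>\<D>. k * \<phi> 1) f) \<le> C * (SUP t. norm (f t))"
      by (intro exI[of _ "norm k"]) (auto simp: norm_mult intro!: mult_left_mono test_le_SUP)
  qed (auto simp: test_lincomb algebra_simps)
  then show ?thesis
    using dilation_operator_cmult[OF dilation_operator_id] by (simp add: represents_def)
qed

lemma represents_cmult: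
  assumes "represents R u"
  shows "represents (\<lambda>f t. k * R f t) (\<lambda>\<phi>\<in>\<D>. k * u \<phi>)"
proof -
  have u: "u \<in> distributions" "supported_in_unit u" "dilation_operator R" "\<And>f. f \<in> \<D> \<Longrightarrow> u f = R f 1"
    using assms by (auto simp: represents_def conv_carrier_iff)
  have "(\<lambda>\<phi>\<in>\<D>. k * u \<phi>) \<in> carrier conv_algebra"
    unfolding conv_carrier_iff distributions_def
  proof safe
    fix K :: "real set" assume K: "compact K" "K \<subseteq> {0<..}"
    then obtain C N where C: "\<forall>\<phi>\<in>\<D>. tsupport \<phi> \<subseteq> K \<longrightarrow>
        norm (u \<phi>) \<le> C * (\<Sum>k\<le>(N::nat). SUP t. norm ((vderiv ^^ k) \<phi> t))"
      using u(1) unfolding distributions_def by blast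
    have "norm (k * u \<phi>) \<le> norm k * C * (\<Sum>k\<le>N. SUP t. norm ((vderiv ^^ k) \<phi> t))" 
      if "\<phi> \<in> \<D>" "tsupport \<phi> \<subseteq> K" for \<phi>
      using mult_left_mono[OF C[rule_format, OF that] norm_ge_zero[of k]] by (simp add: norm_mult
          mult.assoc)
    then show "\<exists>C N. \<forall>\<phi>\<in>\<D>. tsupport \<phi> \<subseteq> K \<longrightarrow>
        norm ((\<lambda>\<phi>\<in>\<D>. k * u \<phi>) \<phi>) \<le> C * (\<Sum>k\<le>(N::nat). SUP t. norm ((vderiv ^^ k) \<phi> t))"
      by (intro exI[of _ "norm k * C"] exI[of _ N]) auto
  next
    fix f g a b assume "f \<in> \<D>" "g \<in> \<D>"
    then show "(\<lambda>\<phi>\<in>\<D>. k * u \<phi>) (\<lambda>t. a * f t + b * g t) = a * (\<lambda>\<phi>\<in>\<D>. k * u \<phi>) f + b * (\<lambda>\<phi>\<in>\<D>. k * u \<phi>) g"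
      by (simp add: test_lincomb distribution_lincomb[OF u(1)] algebra_simps)
  next
    show "supported_in_unit (\<lambda>\<phi>\<in>\<D>. k * u \<phi>)"
      using u(2) by (auto simp: supported_in_unit_def)
  qed auto
  then show ?thesis
    using dilation_operator_cmult[OF u(3)] u(4) by (simp add: represents_def)
qed

lemma vderiv_outside:
  assumes "closed S" "\<And>t. t \<notin> S \<Longrightarrow> f t = 0" "t \<notin> S"
  shows "vderiv f t = 0"
  by (rule vderiv_eqI, rule has_vector_derivative_transform_within_open[of "\<lambda>_. 0" _ _ "- S"])
    (use assms in auto)

lemma closed_tsupport: "closed (tsupport f)"
  by (simp add: tsupport_def)

lemma tsupport_act: "f \<in> \<D> \<Longrightarrow> tsupport (act [:c, 1:] f) \<subseteq> tsupport f"
  unfolding tsupport_def[of "act [:c, 1:] f"]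
proof (rule closure_minimal)
  have "act [:c, 1:] f t = 0" if "t \<notin> tsupport f" for t
  proof -
    have "vderiv f t = 0"
      by (rule vderiv_outside[OF closed_tsupport tsupport_outside that])
    then show ?thesis
      using tsupport_outside[OF that] by (simp add: act_pCons theta_def)
  qed
  then show "{t. act [:c, 1:] f t \<noteq> 0} \<subseteq> tsupport f"
    by blast
qed (rule closed_tsupport)

text \<open>Leibniz rule for \<open>t f'\<close>: derivatives of the factor \<open>t\<close> beyond
  the first vanish. Only one derivative more than \<open>k\<close> is needed, so an estimate of
  order N becomes one of order N + 1.\<close>

lemma funpow_vderiv_act:
  assumes "f \<in> \<D>"
  shows "(vderiv ^^ k) (act [:c, 1:] f) t = of_real t * (vderiv ^^ Suc k) f t + (of_nat k + c) *
      (vderiv ^^ k) f t"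
proof (induction k arbitrary: t)
  case 0
  show ?case
    by (simp add: act_pCons theta_def)
next
  case (Suc k)
  let ?g = "(vderiv ^^ k) f" and ?g1 = "(vderiv ^^ Suc k) f"
  have g: "?g \<in> \<E>" "?g1 \<in> \<E>"
    using assms test_vderiv test_half_smooth by blast+
  have id: "(complex_of_real has_vector_derivative 1) (at t)"
    using has_vector_derivative_of_real[OF DERIV_ident] by force
  have "(vderiv ^^ k) (act [:c, 1:] f) = (\<lambda>t. of_real t * ?g1 t + (of_nat k + c) * ?g t)"
    using Suc.IH by (rule ext)
  then have "(vderiv ^^ Suc k) (act [:c, 1:] f) t = vderiv (\<lambda>t. of_real t * ?g1 t + (of_nat k + c) *
      ?g t) t"
    by (simp only: funpow.simps o_def)
  also have "\<dots> = (of_real t * vderiv ?g1 t + 1 * ?g1 t) + (of_nat k + c) * vderiv ?g t"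
    by (rule vderiv_eqI)
      (intro has_vector_derivative_add has_vector_derivative_mult id
          has_vector_derivative_mult_right half_smooth_vderiv g)
  finally show ?case
    by (simp add: algebra_simps)
qed

text \<open>The operator - d/dt t is the transpose of \<theta>: the sign in \<open>gf_deriv\<close>
  cancels the sign in \<open>euler_op\<close>.\<close>

lemma euler_op_eq:
  assumes "u \<in> distributions" "f \<in> \<D>"
  shows "euler_op c u f = u (act [:c, 1:] f)"
proof -
  have 1: "vderiv f \<in> \<D>"
    using test_vderiv[OF assms(2), of 1] by simp
  have "euler_op c u f = u (theta f) + c * u f"
    using assms(2) 1 by (simp add: euler_op_def gf_deriv_def gf_mult_def theta_def)
  also have "\<dots> = u (\<lambda>t. 1 * theta f t + c * f t)"
    using distribution_lincomb[OF assms(1) test_theta[OF assms(2)] assms(2), of 1 c] by simp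
  also have "(\<lambda>t. 1 * theta f t + c * f t) = act [:c, 1:] f"
    by (simp add: act_pCons add.commute)
  finally show ?thesis .
qed

lemma represents_euler_op:
  assumes "represents R u"
  shows "represents (\<lambda>f. R (act [:c, 1:] f)) (euler_op c u)"
proof -
  have u: "u \<in> distributions" "supported_in_unit u" "dilation_operator R" "\<And>f. f \<in> \<D> \<Longrightarrow> u f = R f 1"
    using assms by (auto simp: represents_def conv_carrier_iff)
  have "euler_op c u \<in> carrier conv_algebra"
    unfolding conv_carrier_iff distributions_def
  proof safe
    fix K :: "real set" assume K: "compact K" "K \<subseteq> {0<..}"
    then obtain C N where C: "\<forall>\<phi>\<in>\<D>. tsupport \<phi> \<subseteq> K \<longrightarrow>
        norm (u \<phi>) \<le> C * (\<Sum>k\<le>(N::nat). SUP t. norm ((vderiv ^^ k) \<phi> t))"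
      using u(1) unfolding distributions_def by blast
    obtain a b where ab: "a > 0" "K \<subseteq> {a..b}"
      using K by (rule compact_pos_bounds)
    \<comment> \<open>\<open>B\<close> dominates both coefficients of
      \<open>funpow_vderiv_act\<close> for \<open>k \<le> N\<close>: the factor \<open>t\<close> on
      \<open>K\<close>, and \<open>k + c\<close>.\<close>
    define B where "B = \<bar>b\<bar> + real N + norm c"
    have "norm (euler_op c u f) \<le> \<bar>C\<bar> * (2 * B) * (\<Sum>k\<le>Suc N. SUP t. norm ((vderiv ^^ k) f t))" 
      if f: "f \<in> \<D>" "tsupport f \<subseteq> K" for f
    proof -
      define S where "S = (\<lambda>k. SUP t. norm ((vderiv ^^ k) f t))"
      have Sge: "norm ((vderiv ^^ k) f t) \<le> S k" for k t
        unfolding S_def by (rule test_le_SUP[OF test_vderiv[OF f(1)]])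
      have S0: "S k \<ge> 0" for k
        using Sge[of k 0] norm_ge_zero order_trans by blast
      have key: "(SUP t. norm ((vderiv ^^ k) (act [:c, 1:] f) t)) \<le> B * (S (Suc k) + S k)" if "k \<le> N" for k
      proof (rule cSUP_least)
        fix t
        show "norm ((vderiv ^^ k) (act [:c, 1:] f) t) \<le> B * (S (Suc k) + S k)"
        proof (cases "t \<in> tsupport f")
          case True
          then have t: "\<bar>t\<bar> \<le> \<bar>b\<bar>"
            using ab f by force
          have B: "\<bar>t\<bar> \<le> B" "0 \<le> B"
            using t norm_ge_zero[of c] unfolding B_def by linarith+
          have "norm ((vderiv ^^ k) (act [:c, 1:] f) t) \<le> 
              \<bar>t\<bar> * norm ((vderiv ^^ Suc k) f t) + norm (of_nat k + c) * norm ((vderiv ^^ k) f t)"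
            unfolding funpow_vderiv_act[OF f(1)]
            by (rule order_trans[OF norm_triangle_ineq]) (simp add: norm_mult)
          also have "\<dots> \<le> B * S (Suc k) + B * S k"
          proof (intro add_mono mult_mono Sge S0)
            have "norm (of_nat k + c) \<le> real k + norm c"
              using norm_triangle_ineq[of "of_nat k :: complex" c] by simp
            then show "norm (of_nat k + c) \<le> B"
              using that by (simp add: B_def)
          qed (use B in auto)
          finally show ?thesis
            by (simp add: algebra_simps)
        next
          case False
          have "(vderiv ^^ j) f s = 0" if "s \<notin> tsupport f" for j s
            using that
          proof (induction j arbitrary: s)
            case 0
            then show ?case
              by (simp add: tsupport_outside)
          next
            case (Suc j)
            have "vderiv ((vderiv ^^ j) f) s = 0"
              by (rule vderiv_outside[OF closed_tsupport Suc.IH Suc.prems])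
            then show ?case
              by simp
          qed
          then have "(vderiv ^^ k) (act [:c, 1:] f) t = 0"
            unfolding funpow_vderiv_act[OF f(1)] using False by (simp del: funpow.simps)
          then show ?thesis
            using S0 by (simp add: B_def)
        qed
      qed simp
      have "norm (euler_op c u f) = norm (u (act [:c, 1:] f))"
        using euler_op_eq[OF u(1) f(1)] by simp
      also have "\<dots> \<le> C * (\<Sum>k\<le>N. SUP t. norm ((vderiv ^^ k) (act [:c, 1:] f) t))"
        using C f tsupport_act[OF f(1)] test_act by (meson order_trans)
      \<comment> \<open>The constant \<open>C\<close> may be negative; its modulus makes the
        following estimates monotone.\<close>
      also have "\<dots> \<le> \<bar>C\<bar> * (\<Sum>k\<le>N. SUP t. norm ((vderiv ^^ k) (act [:c, 1:] f) t))"
      proof (rule mult_right_mono)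
        have "0 \<le> (SUP t. norm ((vderiv ^^ k) (act [:c, 1:] f) t))" for k
          using test_le_SUP[OF test_vderiv[OF test_act[OF f(1)]], of k _ 0] norm_ge_zero order_trans
              by blast
        then show "0 \<le> (\<Sum>k\<le>N. SUP t. norm ((vderiv ^^ k) (act [:c, 1:] f) t))"
          by (intro sum_nonneg)
      qed simp
      also have "\<dots> \<le> \<bar>C\<bar> * (\<Sum>k\<le>N. B * (S (Suc k) + S k))"
        by (intro mult_left_mono sum_mono key) auto
      also have "\<dots> \<le> \<bar>C\<bar> * (B * ((\<Sum>k\<le>Suc N. S k) + (\<Sum>k\<le>Suc N. S k)))"
      proof (rule mult_left_mono)
        have "(\<Sum>k\<le>N. S (Suc k)) \<le> (\<Sum>k\<le>Suc N. S k)" "(\<Sum>k\<le>N. S k) \<le> (\<Sum>k\<le>Suc N. S k)"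
          using sum.atMost_Suc_shift[of S N] sum.atMost_Suc[of S N] S0[of 0] S0[of "Suc N"] by linarith+
        then have "B * ((\<Sum>k\<le>N. S (Suc k)) + (\<Sum>k\<le>N. S k)) \<le> B * ((\<Sum>k\<le>Suc N. S k) + (\<Sum>k\<le>Suc N. S k))"
          by (intro mult_left_mono add_mono) (simp_all add: B_def)
        then show "(\<Sum>k\<le>N. B * (S (Suc k) + S k)) \<le> B * ((\<Sum>k\<le>Suc N. S k) + (\<Sum>k\<le>Suc N. S k))"
          by (simp add: sum.distrib flip: sum_distrib_left)
      qed simp
      also have "\<dots> = \<bar>C\<bar> * (2 * B) * (\<Sum>k\<le>Suc N. S k)"
        by (simp only: mult_2 algebra_simps)
      finally show ?thesis
        by (simp only: S_def)
    qed
    then show "\<exists>C N. \<forall>\<phi>\<in>\<D>. tsupport \<phi> \<subseteq> K \<longrightarrow>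
        norm (euler_op c u \<phi>) \<le> C * (\<Sum>k\<le>(N::nat). SUP t. norm ((vderiv ^^ k) \<phi> t))"
      by blast
  next
    fix f g a b assume fg: "f \<in> \<D>" "g \<in> \<D>"
    then show "euler_op c u (\<lambda>t. a * f t + b * g t) = a * euler_op c u f + b * euler_op c u g"
      by (simp add: test_lincomb test_act euler_op_eq[OF u(1)] act_lincomb test_half_smooth
          distribution_lincomb[OF u(1)])
  next
    show "supported_in_unit (euler_op c u)"
      unfolding supported_in_unit_def
    proof (intro ballI impI)
      fix f assume f: "f \<in> \<D>" "tsupport f \<subseteq> {1<..}"
      then show "euler_op c u f = 0"
        using u(2) tsupport_act[OF f(1), of c] test_act[OF f(1), of "[:c, 1:]"]
        by (simp add: euler_op_eq[OF u(1)] supported_in_unit_def)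
    qed
  qed (simp add: euler_op_def)
  then show ?thesis
    using euler_op_eq[OF u(1)] u(4) test_act dilation_operator_compose[OF u(3) dilation_operator_act]
    by (simp add: represents_def)
qed

lemma represents_cong:
  assumes "represents R u" "\<And>f. f \<in> \<E> \<Longrightarrow> S f = R f"
  shows "represents S u"
proof -
  have "dilation_operator R"
    using assms by (simp add: represents_def)
  note R = dilation_operatorD[OF this]
  have "dilation_operator S"
    unfolding dilation_operator_def
  proof (intro conjI ballI allI impI)
    fix f g x t assume "f \<in> \<E>" "g \<in> \<E>" "\<forall>t<x. f t = g t" "(t::real) < x"
    then show "S f t = S g t"
      using R(3)[of f g x t] assms(2) by simp
  qed (simp_all add: assms(2) R half_smooth_dilate)
  then show ?thesis
    using assms by (simp add: represents_def test_half_smooth)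
qed

text \<open>The operator outermost in the fold acts first on the test function;
  \<open>act_mult\<close> and commutativity of polynomials collect all factors into one
  product.\<close>

lemma represents_foldr_euler_op:
  assumes "represents R u"
  shows "represents (\<lambda>f. R (act (\<Prod>j\<leftarrow>js. [:c j, 1:]) f)) (foldr (\<lambda>j. euler_op (c j)) js u)"
proof (induction js)
  case (Cons j js)
  show ?case
    using represents_cong[OF represents_euler_op[OF Cons, of "c j"],
        of "\<lambda>f. R (act (\<Prod>j\<leftarrow>j # js. [:c j, 1:]) f)"]
    by (simp only: foldr.simps o_def list.map prod_list.Cons mult.commute[of "[:c j, 1:]"] act_mult)
qed (use assms in simp)

lemma set_lebesgue_integral_prim_sum:
  assumes "f \<in> \<E>" "\<And>t. 0 < t \<Longrightarrow> t < 1 \<Longrightarrow> w t = (\<Sum>i<N. r i * of_real t powr (c i - 1)) * f t"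
  shows "(LBINT t:{0<..<1}. w t) = prim_sum N r c f 1"
proof -
  let ?g = "\<lambda>i t. f t * of_real t powr (c i - 1)"
  have int: "continuous_on {0..1} (?g i)" for i
    by (intro half_smooth_continuous half_smooth_powr assms)
  have g: "set_integrable lborel {0<..<1} (?g i)" for i
    using borel_integrable_atLeastAtMost'[OF int] by (rule set_integrable_subset) auto
  have "(LBINT t:{0<..<1}. w t) = (LBINT t:{0<..<1}. \<Sum>i<N. r i * ?g i t)"
    by (rule set_lebesgue_integral_cong) (auto simp: assms(2) sum_distrib_left mult_ac)
  also have "\<dots> = (\<Sum>i<N. LBINT t:{0<..<1}. r i * ?g i t)"
    using g unfolding set_lebesgue_integral_def set_integrable_def
    by (subst Bochner_Integration.integral_sum[symmetric])
      (auto simp: scaleR_sum_right intro!: integrable_mult_right simp flip: mult_scaleR_right)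
  also have "\<dots> = (\<Sum>i<N. r i * integral {0<..<1} (?g i))"
    using set_borel_integral_eq_integral(2)[OF g] by simp
  finally show ?thesis
    by (simp add: prim_sum_def prim_at_1 integral_open_interval_real)
qed

subsection \<open>The generalized functions \<open>plus_power m\<close>\<close>

text \<open>The integral in \<open>plus_power\<close> with the exponent shifted by one: there it is
  \<open>w - 1\<close>.\<close>

definition half_beta :: "complex \<Rightarrow> (real \<Rightarrow> complex) \<Rightarrow> complex" where
  "half_beta w f = (LBINT t:{0<..<1}. of_real (1 - t\<^sup>2) powr w * f t)"

lemma one_minus_sq_pos: "0 < t \<Longrightarrow> t < 1 \<Longrightarrow> 0 < 1 - (t::real)\<^sup>2"
  by (simp add: abs_square_less_1)

text \<open>The only singularity is at 1: the factor \<open>(1 + t) powr Re w\<close> is at most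
  \<open>2 powr |Re w|\<close>, which leaves a Beta integrand with parameters 1 and
  \<open>Re w + 1\<close>.\<close>

lemma half_beta_integrable:
  assumes "f \<in> \<E>" "Re w > - 1"
  shows "set_integrable lborel {0<..<1} (\<lambda>t. of_real (1 - t\<^sup>2) powr w * f t)"
proof -
  let ?s = "Re w"
  have "compact (f ` {0..1})"
    by (intro compact_continuous_image half_smooth_continuous assms) auto
  then obtain C where C: "\<And>t. t \<in> {0..1} \<Longrightarrow> norm (f t) \<le> C"
    using compact_imp_bounded by (metis bounded_iff imageI)
  then have C0: "0 \<le> C"
    using norm_ge_zero order_trans by (metis atLeastAtMost_iff order_refl zero_le_one)
  have fm: "set_borel_measurable lborel {0<..<1} f"
    by (rule borel_measurable_integrable[OF set_integrable_subset[OF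
          borel_integrable_atLeastAtMost'[OF half_smooth_continuous[OF assms(1)], of 0 1],
          unfolded set_integrable_def], unfolded set_borel_measurable_def[symmetric]]) auto
  have "set_integrable lborel {0..1} (\<lambda>t::real. t powr (1 - 1) * (1 - t) powr ((?s + 1) - 1))"
    by (rule integrable_Beta) (use assms in auto)
  then have "set_integrable lborel {0<..<1} (\<lambda>t::real. t powr (1 - 1) * (1 - t) powr ((?s + 1) - 1))"
    by (rule set_integrable_subset) auto
  then have "set_integrable lborel {0<..<1} (\<lambda>t::real. (C * 2 powr \<bar>?s\<bar>) * (t powr (1 - 1) * (1 - t)
      powr ((?s + 1) - 1)))"
    by (rule set_integrable_mult_right[rotated])
  then show ?thesis
  proof (rule set_integrable_bound)
    have "(\<lambda>t::real. complex_of_real (1 - t\<^sup>2) powr w) \<in> borel_measurable lborel"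
      by measurable
    then show "set_borel_measurable lborel {0<..<1} (\<lambda>t. of_real (1 - t\<^sup>2) powr w * f t)"
      using borel_measurable_times[OF _ fm[unfolded set_borel_measurable_def]]
      by (simp add: set_borel_measurable_def)
    show "AE t in lborel. t \<in> {0<..<1} \<longrightarrow> norm (of_real (1 - t\<^sup>2) powr w * f t)
        \<le> norm ((C * 2 powr \<bar>?s\<bar>) * (t powr (1 - 1) * (1 - t) powr ((?s + 1) - 1)))"
    proof (intro AE_I2 impI)
      fix t :: real assume t: "t \<in> {0<..<1}"
      have p: "0 < 1 - t\<^sup>2"
        using t one_minus_sq_pos by simp
      have "norm (complex_of_real (1 - t\<^sup>2) powr w) = ((1 - t) * (1 + t)) powr ?s"
        using p by (subst norm_powr_real_powr) (auto simp: power2_eq_square algebra_simps simp del: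
            of_real_diff of_real_power)
      also have "\<dots> = (1 - t) powr ?s * (1 + t) powr ?s"
        using t by (simp add: powr_mult)
      also have "\<dots> \<le> (1 - t) powr ?s * 2 powr \<bar>?s\<bar>"
      proof (rule mult_left_mono)
        have "(1 + t) powr ?s \<le> (1 + t) powr \<bar>?s\<bar>"
          using t by (intro powr_mono) auto
        also have "\<dots> \<le> 2 powr \<bar>?s\<bar>"
          using t by (intro powr_mono2) auto
        finally show "(1 + t) powr ?s \<le> 2 powr \<bar>?s\<bar>" .
      qed simp
      finally have "norm (complex_of_real (1 - t\<^sup>2) powr w) * norm (f t) \<le> (1 - t) powr ?s * 2 powr
          \<bar>?s\<bar> * C"
        using C[of t] t by (intro mult_mono) auto
      then show "norm (of_real (1 - t\<^sup>2) powr w * f t)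
        \<le> norm ((C * 2 powr \<bar>?s\<bar>) * (t powr (1 - 1) * (1 - t) powr ((?s + 1) - 1)))"
        using t C0 by (simp add: norm_mult mult_ac)
    qed
  qed
qed

text \<open>The derivative of \<open>(1 - t^2) powr w\<close> carries a factor \<open>t\<close>.
  Writing \<open>f\<close> as \<open>t\<close> times \<open>f / t\<close> supplies it, so an
  integration by parts turns \<open>f\<close> into the derivative of \<open>f / t\<close>.\<close>

definition vderiv_quot :: "(real \<Rightarrow> complex) \<Rightarrow> real \<Rightarrow> complex" where
  "vderiv_quot f = vderiv (\<lambda>t. f t * of_real t powr (- 1))"

lemma vderiv_quot_in: "f \<in> \<E> \<Longrightarrow> vderiv_quot f \<in> \<E>"
  unfolding vderiv_quot_def by (intro half_smooth_in_vderiv half_smooth_powr)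

text \<open>Integration by parts raising the exponent by one, the engine of the analytic
  continuation. The boundary terms vanish at 1 because \<open>Re w > 0\<close> and at 0 because
  \<open>f\<close> vanishes near 0.\<close>

lemma half_beta_step:
  assumes f: "f \<in> \<E>" and w: "Re w > 0"
  shows "half_beta w (vderiv_quot f) = 2 * w * half_beta (w - 1) f"
proof -
  define h where "h = (\<lambda>t. f t * complex_of_real t powr (- 1))"
  have h: "h \<in> \<E>"
    unfolding h_def by (rule half_smooth_powr) fact
  define G where "G = (\<lambda>t. complex_of_real (1 - t\<^sup>2) powr w * h t)"
  define A where "A = (\<lambda>t. complex_of_real (1 - t\<^sup>2) powr w * vderiv h t)"
  define B where "B = (\<lambda>t. complex_of_real (1 - t\<^sup>2) powr (w - 1) * f t)"
  have "continuous_on {0..1} G"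
    unfolding G_def
  proof (intro continuous_intros half_smooth_continuous h)
    show "{0..1} \<subseteq> {z. 0 \<le> Re (complex_of_real (1 - z\<^sup>2)) \<or> Im (complex_of_real (1 - z\<^sup>2)) \<noteq> 0}"
      by (auto simp: abs_square_le_1)
  qed (use w in auto)
  moreover have "(G has_vector_derivative (A t - 2 * w * B t)) (at t)" if t: "t \<in> {0<..<1}" for t
  proof -
    have p: "0 < 1 - t\<^sup>2"
      using t one_minus_sq_pos by simp
    have "((\<lambda>z. (1 - z\<^sup>2) powr w) has_field_derivative (- 2 * of_real t * w * (1 - (of_real t)\<^sup>2)
        powr (w - 1)))
        (at (complex_of_real t))"
    proof -
      have "complex_of_real (1 - t\<^sup>2) \<notin> \<real>\<^sub>\<le>\<^sub>0"
        using p by (auto simp: complex_nonpos_Reals_iff simp del: of_real_diff of_real_power)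
      then have "1 - (complex_of_real t)\<^sup>2 \<notin> \<real>\<^sub>\<le>\<^sub>0"
        by simp
      then show ?thesis
        by (auto intro!: derivative_eq_intros simp: mult_ac)
    qed
    from has_vector_derivative_real_field[OF this]
    have d: "((\<lambda>t. complex_of_real (1 - t\<^sup>2) powr w) has_vector_derivative
        (- 2 * of_real t * w * of_real (1 - t\<^sup>2) powr (w - 1))) (at t)"
      by simp
    have "complex_of_real t * h t = f t"
      using t by (simp add: h_def powr_minus)
    then have "of_real (1 - t\<^sup>2) powr w * vderiv h t + - 2 * of_real t * w * of_real (1 - t\<^sup>2) powr
        (w - 1) * h t =
        A t - 2 * w * B t"
      unfolding A_def B_def by (simp only: flip: \<open>_ = f t\<close>) (simp add: algebra_simps)
    then show ?thesis
      using has_vector_derivative_mult[OF d half_smooth_vderiv[OF h]]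
      unfolding G_def by simp
  qed
  ultimately have "((\<lambda>t. A t - 2 * w * B t) has_integral (G 1 - G 0)) {0..1}"
    by (intro fundamental_theorem_of_calculus_interior) auto
  moreover have "G 1 = 0" "G 0 = 0"
    using half_smooth_nonpos[OF h] w by (auto simp: G_def)
  ultimately have "integral {0<..<1} (\<lambda>t. A t - 2 * w * B t) = 0"
    by (simp add: integral_unique flip: integral_open_interval_real)
  moreover have A: "set_integrable lborel {0<..<1} A"
    unfolding A_def by (rule half_beta_integrable) (use half_smooth_in_vderiv[OF h] w in auto)
  moreover have B: "set_integrable lborel {0<..<1} B"
    unfolding B_def by (rule half_beta_integrable) (use f w in auto)
  ultimately have "integral {0<..<1} A = 2 * w * integral {0<..<1} B"
    using set_borel_integral_eq_integral(1)[OF A] set_borel_integral_eq_integral(1)[OF B]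
    by (subst (asm) Henstock_Kurzweil_Integration.integral_diff) (auto intro: integrable_on_mult_right)
  then show ?thesis
    using set_borel_integral_eq_integral(2)[OF A] set_borel_integral_eq_integral(2)[OF B]
    by (simp add: half_beta_def A_def B_def vderiv_quot_def h_def)
qed

text \<open>The borderline exponent of \<open>half_beta_step\<close>: the boundary term at 1
  survives, and it is the source of the delta distribution.\<close>

lemma half_beta_0_vderiv_quot:
  assumes f: "f \<in> \<E>"
  shows "half_beta 0 (vderiv_quot f) = f 1"
proof -
  define h where "h = (\<lambda>t. f t * complex_of_real t powr (- 1))"
  have h: "h \<in> \<E>"
    unfolding h_def by (rule half_smooth_powr) fact
  have int: "set_integrable lborel {0<..<1} (\<lambda>t. of_real (1 - t\<^sup>2) powr 0 * vderiv h t)"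
    by (rule half_beta_integrable) (use half_smooth_in_vderiv[OF h] in auto)
  have "half_beta 0 (vderiv_quot f) = integral {0<..<1} (\<lambda>t. of_real (1 - t\<^sup>2) powr 0 * vderiv h t)"
    using set_borel_integral_eq_integral(2)[OF int] by (simp add: half_beta_def vderiv_quot_def h_def)
  \<comment> \<open>Since \<open>0 powr 0 = 0\<close>, the factor equals 1 only where
    \<open>1 - t^2\<close> is nonzero; the interval stays open for this reason.\<close>
  also have "\<dots> = integral {0<..<1} (vderiv h)"
  proof (rule integral_cong)
    fix t :: real assume "t \<in> {0<..<1}"
    then have "0 < 1 - t\<^sup>2"
      using one_minus_sq_pos[of t] by simp
    then have "complex_of_real (1 - t\<^sup>2) \<noteq> 0"
      by (simp only: of_real_eq_0_iff)
    then show "of_real (1 - t\<^sup>2) powr 0 * vderiv h t = vderiv h t"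
      by (simp only: powr_zero_eq_one mult_1 if_False)
  qed
  also have "\<dots> = integral {0..1} (vderiv h)"
    by (simp add: integral_open_interval_real)
  also have "(vderiv h has_integral h 1 - h 0) {0..1}"
    by (rule fundamental_theorem_of_calculus) (auto intro: has_vector_derivative_at_within
        half_smooth_vderiv[OF h])
  then have "integral {0..1} (vderiv h) = h 1"
    using half_smooth_nonpos[OF h] by (simp add: integral_unique)
  finally show ?thesis
    by (simp add: h_def)
qed

text \<open>On [0, b] with b < 1 the integrand is jointly continuous and the Leibniz rule applies.
  For \<open>Re w > 0\<close> the power has modulus at most 1, so the omitted piece is bounded by
  \<open>C (1 - b)\<close> independently of \<open>w\<close> and the limit is uniform.\<close>

lemma half_beta_holomorphic:
  assumes f: "f \<in> \<E>"
  shows "(\<lambda>w. half_beta w f) holomorphic_on {w. Re w > 0}"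
proof (rule holomorphic_uniform_sequence)
  let ?S = "{w. Re w > 0}"
  have conv: "convex ?S" and "open ?S"
    by (auto simp: convex_halfspace_Re_gt open_halfspace_Re_gt)
  show "open ?S"
    by fact
  define b where "b n = 1 - 1 / (real n + 2)" for n
  have b: "0 < b n" "b n < 1" for n
    by (auto simp: b_def)
  let ?F = "\<lambda>n w. integral (cbox 0 (b n)) (\<lambda>t. exp (w * of_real (ln (1 - t\<^sup>2))) * f t)"
  have pos: "0 < 1 - t\<^sup>2" if "t \<in> cbox 0 (b n)" for t n
  proof -
    have "t = 0 \<or> 0 < t \<and> t < 1"
      using that b[of n] by auto
    then show ?thesis
      using one_minus_sq_pos by auto
  qed
  have cl: "continuous_on (cbox 0 (b n)) (\<lambda>t. complex_of_real (ln (1 - t\<^sup>2)))" for n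
    using pos[of _ n] by (intro continuous_intros) force
  show "?F n holomorphic_on ?S" for n
  proof (rule leibniz_rule_holomorphic[where fx = "\<lambda>w t. of_real (ln (1 - t\<^sup>2)) * exp (w * of_real
      (ln (1 - t\<^sup>2))) * f t"])
    show "((\<lambda>w. exp (w * of_real (ln (1 - t\<^sup>2))) * f t) has_field_derivative
        of_real (ln (1 - t\<^sup>2)) * exp (w * of_real (ln (1 - t\<^sup>2))) * f t) (at w within ?S)" for w t
      by (auto intro!: derivative_eq_intros)
    show "(\<lambda>t. exp (w * of_real (ln (1 - t\<^sup>2))) * f t) integrable_on cbox 0 (b n)" for w
      by (intro integrable_continuous continuous_intros cl half_smooth_continuous f)
    have lnc: "continuous_on (?S \<times> cbox 0 (b n)) (\<lambda>x. complex_of_real (ln (1 - (snd x)\<^sup>2)))"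
      by (rule continuous_on_compose2[OF cl continuous_on_snd[OF continuous_on_id]]) auto
    have fc: "continuous_on (?S \<times> cbox 0 (b n)) (\<lambda>x. f (snd x))"
      by (rule continuous_on_compose2[OF half_smooth_continuous[OF f, of UNIV] continuous_on_snd[OF
          continuous_on_id]]) auto
    show "continuous_on (?S \<times> cbox 0 (b n)) (\<lambda>(w, t). of_real (ln (1 - t\<^sup>2)) * exp (w * of_real (ln
        (1 - t\<^sup>2))) * f t)"
      unfolding case_prod_beta
      by (intro continuous_on_mult continuous_on_exp continuous_on_fst[OF continuous_on_id] lnc fc)
    show "convex ?S"
      by (rule conv)
  qed
  fix w assume w: "w \<in> ?S"
  have "compact (f ` {0..1})"
    by (intro compact_continuous_image half_smooth_continuous assms) auto
  then obtain C where C: "\<And>t. t \<in> {0..1} \<Longrightarrow> norm (f t) \<le> C"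
    using compact_imp_bounded by (metis bounded_iff imageI)
  have dist: "dist (?F n w) (half_beta w f) \<le> C * (1 / (real n + 2))" if "Re w > 0" for n w
  proof -
    define g where "g = (\<lambda>t. complex_of_real (1 - t\<^sup>2) powr w * f t)"
    have g: "continuous_on {0..1} g"
      unfolding g_def
    proof (intro continuous_intros half_smooth_continuous f)
      show "{0..1} \<subseteq> {z. 0 \<le> Re (complex_of_real (1 - z\<^sup>2)) \<or> Im (complex_of_real (1 - z\<^sup>2)) \<noteq> 0}"
        by (auto simp: abs_square_le_1)
    qed (use that in auto)
    have "half_beta w f = integral {0..1} g"
      using set_borel_integral_eq_integral(2)[OF half_beta_integrable[OF f, of w]] that
      by (simp add: half_beta_def g_def integral_open_interval_real)
    also have "\<dots> = integral {0..b n} g + integral {b n..1} g"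
      using b[of n] by (intro Henstock_Kurzweil_Integration.integral_combine[symmetric]
          integrable_continuous_interval g) auto
    also have "integral {0..b n} g = ?F n w"
      unfolding cbox_interval
    proof (rule integral_cong)
      fix t assume "t \<in> {0..b n}"
      then have "0 < 1 - t\<^sup>2"
        using pos[of t n] by simp
      then have "complex_of_real (1 - t\<^sup>2) powr w = exp (w * of_real (ln (1 - t\<^sup>2)))"
        by (simp add: powr_def Ln_of_real del: of_real_diff of_real_power)
      then show "g t = exp (w * of_real (ln (1 - t\<^sup>2))) * f t"
        by (simp add: g_def)
    qed
    finally have "dist (?F n w) (half_beta w f) = norm (integral {b n..1} g)"
      by (simp add: dist_norm)
    also have "\<dots> \<le> C * (1 - b n)"
    proof (rule integral_bound)
      show "continuous_on {b n..1} g"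
        using b[of n] by (intro continuous_on_subset[OF g]) auto
      fix t assume t: "t \<in> {b n..1}"
      have t': "0 \<le> 1 - t\<^sup>2" "1 - t\<^sup>2 \<le> 1" "t \<in> {0..1}"
        using t b[of n] by (auto simp: abs_square_le_1)
      have "norm (complex_of_real (1 - t\<^sup>2) powr w) \<le> 1"
      proof -
        have "norm (complex_of_real (1 - t\<^sup>2) powr w) = (1 - t\<^sup>2) powr Re w"
          using t' by (subst norm_powr_real_powr) (auto simp del: of_real_diff of_real_power)
        then show ?thesis
          using t' that powr_le1 by auto
      qed
      then show "norm (g t) \<le> C"
        using C[OF t'(3)] mult_mono[of "norm (complex_of_real (1 - t\<^sup>2) powr w)" 1 "norm (f t)" C]
        by (simp add: g_def norm_mult)
    qed (use b in \<open>auto intro: less_imp_le\<close>)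
    finally show ?thesis
      by (simp add: b_def)
  qed
  obtain d where d: "d > 0" "cball w d \<subseteq> ?S"
    using \<open>open ?S\<close> w open_contains_cball by blast
  have "uniform_limit (cball w d) ?F (\<lambda>w. half_beta w f) sequentially"
  proof (rule uniform_limitI)
    fix e :: real assume "e > 0"
    have "(\<lambda>n. C * (1 / (real n + 2))) \<longlonglongrightarrow> 0"
      by real_asymp
    then have "eventually (\<lambda>n. C * (1 / (real n + 2)) < e) sequentially"
      using \<open>e > 0\<close> by (rule order_tendstoD)
    then show "\<forall>\<^sub>F n in sequentially. \<forall>v\<in>cball w d. dist (?F n v) (half_beta v f) < e"
    proof (rule eventually_mono, intro ballI)
      fix n v assume n: "C * (1 / (real n + 2)) < e" and v: "v \<in> cball w d"
      have "Re v > 0"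
        using d(2) v by blast
      from dist[OF this, of n] n show "dist (?F n v) (half_beta v f) < e"
        by (rule le_less_trans)
    qed
  qed
  then show "\<exists>d>0. cball w d \<subseteq> ?S \<and> uniform_limit (cball w d) ?F (\<lambda>w. half_beta w f) sequentially"
    using d by blast
qed

lemma plus_power_eq:
  assumes "f \<in> \<D>"
  shows "plus_power 0 f = f 1 / 2"
    and "m > 0 \<Longrightarrow> plus_power m f = half_beta (of_nat m - 1) f / fact (m - 1)"
proof -
  have f: "f \<in> \<E>"
    using assms by (rule test_half_smooth)
  define g where "g = vderiv_quot (vderiv_quot f)"
  have g: "g \<in> \<E>"
    unfolding g_def by (intro vderiv_quot_in f)
  \<comment> \<open>Two integrations by parts raise the exponent from \<open>w - 1\<close> to
    \<open>w + 1\<close>, whose real part is positive on all of \<open>Re w > - 1\<close>. They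
    produce the factor \<open>4 w (w + 1)\<close>: the 4 is divided out, and
    \<open>w (w + 1)\<close> shifts \<open>rGamma (w + 2)\<close> to
    \<open>rGamma w\<close>.\<close>
  define F where "F w = rGamma (w + 2) * half_beta (w + 1) g / 4" for w
  have F1: "F w = half_beta (w - 1) f / Gamma w" if "Re w > 0" for w
  proof -
    have "half_beta (w + 1) g = 2 * (w + 1) * (2 * w * half_beta (w - 1) f)"
      unfolding g_def using that half_beta_step[OF f, of w] half_beta_step[OF vderiv_quot_in[OF f],
          of "w + 1"]
      by simp
    then have "F w = w * ((w + 1) * rGamma (w + 2)) * half_beta (w - 1) f"
      unfolding F_def by simp
    also have "w * ((w + 1) * rGamma (w + 2)) = rGamma w"
      using rGamma_plus1[of w] rGamma_plus1[of "w + 1"] by (simp add: add.assoc)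
    finally show ?thesis
      by (simp only: rGamma_inverse_Gamma divide_inverse mult.commute)
  qed
  \<comment> \<open>At 0 only the outer step may be undone; the inner one meets the boundary
    term.\<close>
  have F0: "F 0 = f 1 / 2"
  proof -
    have "half_beta 1 g = 2 * half_beta 0 (vderiv_quot f)"
      unfolding g_def using half_beta_step[OF vderiv_quot_in[OF f], of 1] by simp
    moreover have "rGamma (2::complex) = 1"
      using rGamma_plus1[of "1::complex"] by simp
    ultimately show ?thesis
      using half_beta_0_vderiv_quot[OF f] by (simp add: F_def)
  qed
  let ?S = "{w. Re w > - 1}"
  have hol: "F holomorphic_on ?S"
  proof -
    have "(\<lambda>w. half_beta (w + 1) g) holomorphic_on ?S"
      by (rule holomorphic_on_compose_gen[OF _ half_beta_holomorphic[OF g], of "\<lambda>w. w + 1", unfolded o_def])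
        (auto intro!: holomorphic_intros)
    then show ?thesis
      unfolding F_def by (intro holomorphic_intros) auto
  qed
  \<comment> \<open>The identity theorem makes the continuation unique, so the description operator
    in \<open>plus_power\<close> returns the value of \<open>F\<close>.\<close>
  have uniq: "H w = F w" if H: "H holomorphic_on ?S" "\<forall>w. Re w > 0 \<longrightarrow>
        H w = half_beta (w - 1) f / Gamma w" and w: "Re w > - 1" for H w
  proof (rule analytic_continuation_open[of "{w. Re w > 0}" ?S H F w])
    show "open {w. Re w > 0}" "open ?S" "connected ?S"
      by (auto simp: open_halfspace_Re_gt convex_connected convex_halfspace_Re_gt)
    show "{w. Re w > 0} \<noteq> {}"
      by (auto intro!: exI[of _ 1])
    show "H z = F z" if "z \<in> {w. Re w > 0}" for z
      using that H F1 by simp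
  qed (use H hol w in auto)
  have "plus_power m f = F (of_nat m)" for m
  proof -
    have "plus_power m f = (THE c. \<exists>F. F holomorphic_on {w. Re w > - 1} \<and>
        (\<forall>w. Re w > 0 \<longrightarrow> F w = half_beta (w - 1) f / Gamma w) \<and> c = F (of_nat m))"
      using assms by (simp add: plus_power_def half_beta_def)
    also have "\<dots> = F (of_nat m)"
    proof (rule the_equality)
      show "\<exists>H. H holomorphic_on ?S \<and> (\<forall>w. Re w > 0 \<longrightarrow> H w = half_beta (w - 1) f / Gamma w) \<and> F
          (of_nat m) = H (of_nat m)"
        using hol F1 by blast
      fix c assume "\<exists>H. H holomorphic_on ?S \<and> (\<forall>w. Re w > 0 \<longrightarrow> H w = half_beta (w - 1) f / Gamma w) \<and>
          c = H (of_nat m)"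
      then obtain H where H: "H holomorphic_on ?S" "\<forall>w. Re w > 0 \<longrightarrow> H w = half_beta (w - 1) f / Gamma
          w" "c = H (of_nat m)"
        by blast
      show "c = F (of_nat m)"
        unfolding H(3) by (rule uniq[OF H(1,2)]) simp
    qed
    finally show ?thesis .
  qed
  from this[of 0] this[of m] show "plus_power 0 f = f 1 / 2"
      "m > 0 \<Longrightarrow> plus_power m f = half_beta (of_nat m - 1) f / fact (m - 1)"
    using F0 F1[of "of_nat m"] Gamma_fact[of "m - 1", where ?'a = complex] by simp_all
qed

text \<open>For m = 0 the factor \<open>t powi k\<close> equals 1 at the point of support. For
  positive m the binomial expansion of (1 - t^2)^(m - 1) gives powers whose exponents differ by
  2.\<close>

lemma represents_plus_power:
  defines "G \<equiv> \<lambda>m k. gf_mult (\<lambda>t. of_real (t powi k)) (plus_power m)"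
  shows "represents (\<lambda>f t. 1 / 2 * f t) (G 0 k)"
    and "m > 0 \<Longrightarrow> represents (prim_sum m (\<lambda>i. (- 1) ^ i * of_nat ((m - 1) choose i) / fact (m - 1))
            (\<lambda>i. of_int (k + 1 + 2 * int i))) (G m k)"
proof -
  have powi: "complex_of_real (t powi k) = of_real t powr of_int k" if "t > 0" for t k
    using that by (simp add: powr_of_int power_int_def power_inverse)
  have eq: "(\<lambda>t. of_real (t powi k) * f t) = (\<lambda>t. f t * of_real t powr of_int k)" if "f \<in> \<D>" for f k
  proof
    fix t
    show "of_real (t powi k) * f t = f t * of_real t powr of_int k"
      using powi[of t k] half_smooth_nonpos[OF test_half_smooth[OF that], of t]
      by (cases "t > 0") (auto simp: mult.commute)
  qed
  have in\<D>: "(\<lambda>t. of_real (t powi k) * f t) \<in> \<D>" if "f \<in> \<D>" for f k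
    unfolding eq[OF that] by (rule test_powr[OF that])
  have "G 0 k = (\<lambda>\<phi>\<in>\<D>. 1 / 2 * \<phi> 1)"
    using plus_power_eq(1)[OF in\<D>] by (auto simp: G_def gf_mult_def fun_eq_iff)
  then show "represents (\<lambda>f t. 1 / 2 * f t) (G 0 k)"
    using represents_delta[of "1 / 2"] by simp
  assume m: "m > 0"
  let ?r = "\<lambda>i. (- 1) ^ i * of_nat ((m - 1) choose i) / fact (m - 1) :: complex"
  let ?c = "\<lambda>i. of_int (k + 1 + 2 * int i) :: complex"
  have "G m k f = prim_sum m ?r ?c f 1" if f: "f \<in> \<D>" for f
  proof -
    have "G m k f = half_beta (of_nat m - 1) (\<lambda>t. of_real (t powi k) * f t) / fact (m - 1)"
      using plus_power_eq(2)[OF in\<D>[OF f] m] f by (simp add: G_def gf_mult_def)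
    also have "\<dots> = (LBINT t:{0<..<1}. 1 / fact (m - 1) * (of_real (1 - t\<^sup>2) powr (of_nat m - 1) *
        (of_real (t powi k) * f t)))"
      by (subst set_integral_mult_right) (simp add: half_beta_def)
    also have "\<dots> = prim_sum m ?r ?c f 1"
    proof (rule set_lebesgue_integral_prim_sum[OF test_half_smooth[OF f]])
      fix t :: real assume t: "0 < t" "t < 1"
      have p: "0 < 1 - t\<^sup>2"
        using t one_minus_sq_pos by simp
      have "complex_of_real (1 - t\<^sup>2) powr (of_nat m - 1) = of_real (1 - t\<^sup>2) ^ (m - 1)"
      proof -
        have "(of_nat m - 1 :: complex) = of_nat (m - 1)"
          using m by (simp add: of_nat_diff)
        then show ?thesis
          using p by (simp add: powr_nat' del: of_real_diff of_real_power)
      qed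
      also have "\<dots> = (- (of_real t)\<^sup>2 + 1) ^ (m - 1)"
        by simp
      also have "\<dots> = (\<Sum>i\<le>m - 1. of_nat ((m - 1) choose i) * (- (of_real t)\<^sup>2) ^ i)"
        by (subst binomial_ring) simp
      also have "\<dots> = (\<Sum>i<m. (- 1) ^ i * of_nat ((m - 1) choose i) * of_real t ^ (2 * i))"
        using m by (intro sum.cong) (auto simp: power_mult power_minus[of "(complex_of_real t)\<^sup>2"])
      finally have 1: "complex_of_real (1 - t\<^sup>2) powr (of_nat m - 1) = (\<Sum>i<m. (- 1) ^ i * of_nat ((m
          - 1) choose i) * of_real t ^ (2 * i))" .
      have 2: "of_real t powr (?c i - 1) = of_real (t powi k) * complex_of_real t ^ (2 * i)" for i
      proof -
        have "?c i - 1 = of_int k + of_nat (2 * i)"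
          by simp
        moreover have "of_real t powr of_nat (2 * i) = complex_of_real t ^ (2 * i)"
          using t by (simp add: powr_nat' del: of_nat_mult)
        ultimately show ?thesis
          using t powi[of t k] by (simp only: powr_add)
      qed
      show "1 / fact (m - 1) * (of_real (1 - t\<^sup>2) powr (of_nat m - 1) * (of_real (t powi k) * f t)) =
        (\<Sum>i<m. ?r i * of_real t powr (?c i - 1)) * f t"
        unfolding 1 2 by (simp add: sum_distrib_left sum_distrib_right mult_ac sum_divide_distrib)
    qed
    finally show ?thesis .
  qed
  moreover have "G m k f = undefined" if "f \<notin> \<D>" for f
    using that by (simp add: G_def gf_mult_def)
  ultimately have "G m k = (\<lambda>\<phi>\<in>\<D>. prim_sum m ?r ?c \<phi> 1)"
    by (intro ext) (simp add: restrict_def)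
  then show "represents (prim_sum m ?r ?c) (G m k)"
    using represents_prim_sum by simp
qed

subsection \<open>Lagrange interpolation and partial fractions\<close>

lemma prod_int_diff:
  assumes "j \<le> M"
  shows "(\<Prod>i\<in>{..M} - {j}. (of_nat i - of_nat j :: complex)) = (- 1) ^ j * fact j * fact (M - j)"
proof -
  have split: "{..M} - {j} = {..<j} \<union> {Suc j..M}"
    using assms by auto
  have "(\<Prod>i<j. (of_nat i - of_nat j :: complex)) = (\<Prod>i<j. - of_nat (Suc i))"
    by (subst prod.nat_diff_reindex[symmetric], rule prod.cong) (auto simp: of_nat_diff)
  also have "\<dots> = (- 1) ^ j * fact j"
    by (simp add: prod.distrib prod_uminus fact_prod_Suc atLeast0LessThan flip: of_nat_Suc)
  finally have 1: "(\<Prod>i<j. (of_nat i - of_nat j :: complex)) = (- 1) ^ j * fact j" .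
  have "(\<Prod>i\<in>{Suc j..M}. (of_nat i - of_nat j :: complex)) = (\<Prod>i\<in>{1..M - j}. of_nat i)"
    by (rule prod.reindex_bij_witness[of _ "\<lambda>i. i + j" "\<lambda>i. i - j"]) (auto simp: of_nat_diff)
  also have "\<dots> = fact (M - j)"
    by (simp add: fact_prod)
  finally show ?thesis
    unfolding split using 1 by (subst prod.union_disjoint) auto
qed

text \<open>Interpolation at the nodes 0, -1, ..., -M. The product of node differences at -j is
  (-1)^j j! (M - j)!, the reciprocal of which is (-1)^j (M choose j) / M!. Both sides have degree at
  most M and agree at M + 1 points.\<close>

lemma lagrange_sum:
  fixes Q :: "complex poly"
  assumes "degree Q \<le> M"
  shows "(\<Sum>j\<le>M. smult ((- 1) ^ j * of_nat (M choose j) * poly Q (- of_nat j)) (\<Prod>i\<in>{..M} - {j}.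
      [:of_nat i, 1:]))
    = smult (fact M) Q" (is "?L = ?R")
proof (rule poly_eqI_degree[of "(\<lambda>j. - of_nat j) ` {..M}"])
  have c: "card ((\<lambda>j. - of_nat j :: complex) ` {..M}) = Suc M"
    by (subst card_image) (auto simp: inj_on_def)
  have "degree (\<Prod>i\<in>{..M} - {j}. [:of_nat i, 1:] :: complex poly) \<le> M" if "j \<le> M" for j
    by (rule order_trans[OF degree_prod_sum_le]) (use that in auto)
  then have "degree ?L \<le> M"
    by (intro degree_sum_le) (auto intro: order_trans[OF degree_smult_le])
  then show "degree ?L < card ((\<lambda>j. - of_nat j :: complex) ` {..M})"
    by (simp add: c)
  show "degree ?R < card ((\<lambda>j. - of_nat j :: complex) ` {..M})"
    using assms by (simp add: c)
  fix x assume "x \<in> (\<lambda>j. - of_nat j :: complex) ` {..M}"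
  then obtain l where l: "l \<le> M" "x = - of_nat l"
    by auto
  have "poly ?L x = (\<Sum>j\<le>M. (- 1) ^ j * of_nat (M choose j) * poly Q (- of_nat j) * (\<Prod>i\<in>{..M} - {j}.
      (of_nat i - of_nat l)))"
    by (simp add: poly_sum poly_prod l)
  also have "\<dots> = (\<Sum>j\<in>{l}. (- 1) ^ j * of_nat (M choose j) * poly Q (- of_nat j) * (\<Prod>i\<in>{..M} - {j}.
      (of_nat i - of_nat l)))"
  proof (rule sum.mono_neutral_right)
    show "\<forall>j\<in>{..M} - {l}. (- 1) ^ j * of_nat (M choose j) * poly Q (- of_nat j) * (\<Prod>i\<in>{..M} - {j}.
        (of_nat i - of_nat l)) = 0"
    proof
      fix j assume "j \<in> {..M} - {l}"
      then have "(\<Prod>i\<in>{..M} - {j}. (of_nat i - of_nat l :: complex)) = 0"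
        using l by (intro prod_zero) auto
      then show "(- 1) ^ j * of_nat (M choose j) * poly Q (- of_nat j) * (\<Prod>i\<in>{..M} - {j}. (of_nat i
          - of_nat l)) = 0"
        by simp
    qed
  qed (use l in auto)
  also have "\<dots> = ((- 1) ^ l * (- 1) ^ l) * (of_nat (fact l * fact (M - l) * (M choose l))) * poly Q x"
    using prod_int_diff[OF l(1)] by (simp add: l)
  also have "\<dots> = poly ?R x"
    by (simp add: binomial_fact_lemma[OF l(1)] flip: power_mult_distrib)
  finally show "poly ?L x = poly ?R x" .
qed

lemma smult_sum_distrib: "smult c (\<Sum>i\<in>A. f i) = (\<Sum>i\<in>A. smult c (f i))"
  by (induction A rule: infinite_finite_induct) (auto simp: smult_add_right)

text \<open>The substitution X -> (X + c) / 2 moves the nodes to -(c + 2 i). Each product has M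
  factors, and every factor contributes 1/2, hence the power of 2.\<close>

lemma lagrange_sum_half:
  fixes Q :: "complex poly"
  assumes "degree Q \<le> M"
  shows "(\<Sum>j<Suc M. smult ((- 1) ^ j * of_nat (M choose j) * poly Q (- of_nat j))
            (\<Prod>i\<in>{..<Suc M} - {j}. [:c + 2 * of_nat i, 1:]))
    = smult (2 ^ M * fact M) (pcompose Q [:c / 2, 1 / 2:])"
proof -
  have L: "pcompose [:of_nat i, 1:] [:c / 2, 1 / 2:] = smult (1 / 2) [:c + 2 * of_nat i, 1:]" for i
    by (simp add: pcompose_pCons field_simps)
  have prod: "(\<Prod>i\<in>{..<Suc M} - {j}. [:c + 2 * of_nat i, 1:]) =
      smult (2 ^ M) (pcompose (\<Prod>i\<in>{..M} - {j}. [:of_nat i, 1:]) [:c / 2, 1 / 2:])" if "j \<le> M" for j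
  proof -
    have "pcompose (\<Prod>i\<in>{..M} - {j}. [:of_nat i, 1:]) [:c / 2, 1 / 2:] = (\<Prod>i\<in>{..M} - {j}. smult (1 /
        2) [:c + 2 * of_nat i, 1:])"
      by (simp only: pcompose_prod L)
    also have "\<dots> = smult ((1 / 2) ^ M) (\<Prod>i\<in>{..M} - {j}. [:c + 2 * of_nat i, 1:])"
      using that by (simp only: prod_smult prod_constant card_Diff_singleton atMost_iff card_atMost) simp
    finally show ?thesis
      by (simp add: lessThan_Suc_atMost power_one_over flip: power_mult_distrib)
  qed
  have "(\<Sum>j<Suc M. smult ((- 1) ^ j * of_nat (M choose j) * poly Q (- of_nat j))
            (\<Prod>i\<in>{..<Suc M} - {j}. [:c + 2 * of_nat i, 1:])) =
     smult (2 ^ M) (pcompose (\<Sum>j\<le>M. smult ((- 1) ^ j * of_nat (M choose j) * poly Q (- of_nat j))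
         (\<Prod>i\<in>{..M} - {j}. [:of_nat i, 1:])) [:c / 2, 1 / 2:])"
    unfolding pcompose_sum smult_sum_distrib pcompose_smult
  proof (rule sum.cong)
    fix j assume "j \<in> {..M}"
    then have j: "j \<le> M"
      by simp
    show "smult ((- 1) ^ j * of_nat (M choose j) * poly Q (- of_nat j)) (\<Prod>i\<in>{..<Suc M} - {j}. [:c +
        2 * of_nat i, 1:]) =
      smult (2 ^ M) (smult ((- 1) ^ j * of_nat (M choose j) * poly Q (- of_nat j))
        (pcompose (\<Prod>i\<in>{..M} - {j}. [:of_nat i, 1:]) [:c / 2, 1 / 2:]))"
      unfolding prod[OF j] smult_smult by (simp only: mult.commute)
  qed auto
  then show ?thesis
    by (simp add: lagrange_sum[OF assms] pcompose_smult)
qed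

text \<open>The partial fraction expansion among operators: the coefficients with values of
  \<open>Q\<close> belong to a fraction in \<theta> with numerator \<open>Q\<close> composed with (X
  + c) / 2.\<close>

lemma act_prim_sum_lagrange:
  assumes "degree Q \<le> M" "f \<in> \<E>"
  shows "act (\<Prod>i<Suc M. [:c + 2 * of_nat i, 1:])
      (prim_sum (Suc M) (\<lambda>j. k * ((- 1) ^ j * of_nat (M choose j) * poly Q (- of_nat j)) / fact M)
          (\<lambda>i. c + 2 * of_nat i) f)
    = (\<lambda>t. k * 2 ^ M * act (pcompose Q [:c / 2, 1 / 2:]) f t)"
proof -
  have "(\<Sum>j<Suc M. smult (k * ((- 1) ^ j * of_nat (M choose j) * poly Q (- of_nat j)) / fact M)
      (\<Prod>i\<in>{..<Suc M} - {j}. [:c + 2 * of_nat i, 1:]))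
     = smult (k / fact M) (\<Sum>j<Suc M. smult ((- 1) ^ j * of_nat (M choose j) * poly Q (- of_nat j))
         (\<Prod>i\<in>{..<Suc M} - {j}. [:c + 2 * of_nat i, 1:]))"
    by (simp add: smult_sum_distrib mult_ac del: sum.lessThan_Suc)
  also have "\<dots> = smult (k * 2 ^ M) (pcompose Q [:c / 2, 1 / 2:])"
    unfolding lagrange_sum_half[OF assms(1)] by simp
  finally show ?thesis
    using act_prim_sum[OF assms(2), where N = "Suc M"] by (simp only: act_smult)
qed

text \<open>The same expansion with the number \<open>s\<close> in place of \<theta>, as the Mellin
  transform requires.\<close>

lemma sum_lagrange_fractions:
  fixes Q :: "complex poly"
  assumes "degree Q \<le> M" "\<And>i. i \<le> M \<Longrightarrow> s + (c + 2 * of_nat i) \<noteq> 0"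
  shows "(\<Sum>j<Suc M. (k * ((- 1) ^ j * of_nat (M choose j) * poly Q (- of_nat j)) / fact M) / (s + (c
      + 2 * of_nat j)))
    = k * 2 ^ M * poly Q ((s + c) / 2) / (\<Prod>i<Suc M. (s + (c + 2 * of_nat i)))"
proof -
  let ?D = "\<Prod>i<Suc M. (s + (c + 2 * of_nat i))"
  have D: "?D \<noteq> 0"
    using assms(2) by (simp add: less_Suc_eq_le del: prod.lessThan_Suc)
  have frac: "1 / (s + (c + 2 * of_nat j)) = (\<Prod>i\<in>{..<Suc M} - {j}. s + (c + 2 * of_nat i)) / ?D" if
      "j < Suc M" for j
  proof -
    have "?D = (s + (c + 2 * of_nat j)) * (\<Prod>i\<in>{..<Suc M} - {j}. s + (c + 2 * of_nat i))"
      using that by (intro prod.remove) auto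
    then show ?thesis
      using D by (simp only: mult_eq_0_iff de_Morgan_disj) (metis div_by_1 mult.commute
          nonzero_divide_mult_cancel_left)
  qed
  let ?r = "\<lambda>j. (- 1) ^ j * of_nat (M choose j) * poly Q (- of_nat j)"
  have "(\<Sum>j<Suc M. ?r j * (\<Prod>i\<in>{..<Suc M} - {j}. s + (c + 2 * of_nat i))) = 2 ^ M * fact M * poly Q
      ((s + c) / 2)"
    using arg_cong[OF lagrange_sum_half[OF assms(1), of c], of "\<lambda>P. poly P s"]
    by (simp add: poly_sum poly_prod poly_pcompose add_divide_distrib add_ac del: sum.lessThan_Suc)
  moreover have "(\<Sum>j<Suc M. (k * ?r j / fact M) / (s + (c + 2 * of_nat j))) =
      (\<Sum>j<Suc M. (k / fact M) / ?D * (?r j * (\<Prod>i\<in>{..<Suc M} - {j}. s + (c + 2 * of_nat i))))"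
  proof (rule sum.cong)
    fix j assume "j \<in> {..<Suc M}"
    then have "(k * ?r j / fact M) * (1 / (s + (c + 2 * of_nat j))) = (k / fact M) / ?D * (?r j *
        (\<Prod>i\<in>{..<Suc M} - {j}. s + (c + 2 * of_nat i)))"
      by (subst frac) simp_all
    then show "(k * ?r j / fact M) / (s + (c + 2 * of_nat j)) = (k / fact M) / ?D * (?r j *
        (\<Prod>i\<in>{..<Suc M} - {j}. s + (c + 2 * of_nat i)))"
      by simp
  qed simp
  moreover have "\<dots> = (k / fact M) / ?D * (\<Sum>j<Suc M. ?r j * (\<Prod>i\<in>{..<Suc M} - {j}. s + (c + 2 * of_nat i)))"
    by (simp only: sum_distrib_left)
  ultimately show ?thesis
    by (simp del: sum.lessThan_Suc prod.lessThan_Suc)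
qed

subsection \<open>Mellin transforms\<close>

text \<open>The cut-offs in \<open>has_mellin\<close> are the profiles with final value 1. Other
  final values arise when \<theta> is applied.\<close>

definition profile :: "complex \<Rightarrow> (real \<Rightarrow> complex) \<Rightarrow> bool" where
  "profile \<kappa> h \<longleftrightarrow> (\<forall>k. cdiff k h) \<and> (\<forall>t\<le>1. h t = 0) \<and> (\<forall>t\<ge>2. h t = \<kappa>)"

definition cut_powr :: "complex \<Rightarrow> real \<Rightarrow> (real \<Rightarrow> complex) \<Rightarrow> real \<Rightarrow> complex" where
  "cut_powr s e h = (\<lambda>t. h (t / e) * of_real t powr s)"

lemma cut_powr_in:
  assumes "e > 0" "h \<in> \<E>" shows "cut_powr s e h \<in> \<E>"
  using half_smooth_powr[OF half_smooth_dilate[OF assms(2), of "1 / e"]] assms(1)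
  by (simp add: cut_powr_def)

text \<open>Conjugation by \<open>t powr s\<close> turns \<theta> into \<open>s + \<theta>\<close>,
  and \<theta> commutes with dilations. The new profile is therefore independent of
  \<open>e\<close>.\<close>

lemma theta_cut_powr:
  assumes "e > 0" "h \<in> \<E>"
  shows "theta (cut_powr s e h) = cut_powr s e (\<lambda>t. s * h t + theta h t)"
proof
  fix t
  obtain a where a: "a > 0" "\<forall>t<a. h t = 0"
    using assms(2) by (rule half_smoothE)
  have h: "(\<lambda>t. h (t / e)) \<in> \<E>"
    using half_smooth_dilate[OF assms(2), of "1 / e"] assms(1) by simp
  have th: "theta (\<lambda>t. h (t / e)) = (\<lambda>t. theta h (t / e))"
    using theta_dilate[OF assms(2), of "1 / e"] by simp
  obtain b where b: "b > 0" "\<forall>t<b. h (t / e) = 0"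
    using h by (rule half_smoothE)
  have "vderiv (cut_powr s e h) t = vderiv (\<lambda>t. h (t / e)) t * of_real t powr s + s * (h (t / e) *
      of_real t powr (s - 1))"
    unfolding cut_powr_def
    by (rule vderiv_eqI, rule has_vector_derivative_vanishing_powr[OF b(2,1) half_smooth_vderiv[OF h]])
  then have "theta (cut_powr s e h) t = theta (\<lambda>t. h (t / e)) t * of_real t powr s + s * h (t / e) *
      (of_real t * of_real t powr (s - 1))"
    by (simp add: theta_def algebra_simps)
  also have "s * h (t / e) * (of_real t * of_real t powr (s - 1)) = s * h (t / e) * of_real t powr s"
  proof (cases "t > 0")
    case True
    then show ?thesis
      using powr_add[of "complex_of_real t" 1 "s - 1"] by simp
  qed (use half_smooth_nonpos[OF h] in simp)
  finally show "theta (cut_powr s e h) t = cut_powr s e (\<lambda>t. s * h t + theta h t) t"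
    unfolding th by (simp add: cut_powr_def algebra_simps)
qed

lemma profile_in: "profile \<kappa> h \<Longrightarrow> h \<in> \<E>"
  by (rule half_smoothI[of h 1]) (auto simp: profile_def)

lemma profile_lincomb: "profile \<kappa> h \<Longrightarrow> profile \<mu> g \<Longrightarrow> profile (a * \<kappa> + b * \<mu>) (\<lambda>t. a * h t + b * g t)"
  by (auto simp: profile_def intro!: cdiff_add cdiff_mult cdiff_const)

lemma profile_theta:
  assumes "profile \<kappa> h" shows "profile 0 (theta h)"
proof -
  have h: "h \<in> \<E>"
    by (rule profile_in) fact
  have "vderiv h t = 0" if "t < 1" for t
    using vderiv_vanishing[of 1 h] assms that by (auto simp: profile_def)
  moreover have "vderiv h t = 0" if "t > 2" for t
    by (rule vderiv_eqI, rule has_vector_derivative_transform_within_open[of "\<lambda>_. \<kappa>" _ _ "{2<..}"])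
      (use assms that in \<open>auto simp: profile_def\<close>)
  moreover have cont: "isCont (vderiv h) t" for t
    using half_smooth_continuous[OF half_smooth_in_vderiv[OF h], of UNIV] by (simp add:
        continuous_on_eq_continuous_at)
  \<comment> \<open>At the end points 1 and 2 the derivative is found as a one-sided limit, by its
    continuity.\<close>
  moreover have "vderiv h 1 = 0"
  proof (rule tendsto_unique)
    show "(vderiv h \<longlongrightarrow> vderiv h 1) (at_left 1)"
      using cont[of 1] by (simp add: isCont_def filterlim_at_split)
    show "(vderiv h \<longlongrightarrow> 0) (at_left 1)"
      by (rule tendsto_eventually) (auto simp: eventually_at_filter calculation(1))
  qed auto
  moreover have "vderiv h 2 = 0"
  proof (rule tendsto_unique)
    show "(vderiv h \<longlongrightarrow> vderiv h 2) (at_right 2)"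
      using cont[of 2] by (simp add: isCont_def filterlim_at_split)
    show "(vderiv h \<longlongrightarrow> 0) (at_right 2)"
      by (rule tendsto_eventually) (auto simp: eventually_at_filter calculation(2))
  qed auto
  ultimately have "vderiv h t = 0" if "t \<le> 1 \<or> t \<ge> 2" for t
    using that by (metis order_less_le)
  then show ?thesis
    using half_smooth_cdiff[OF theta_in[OF h]] by (auto simp: profile_def theta_def)
qed

text \<open>Each \<theta> multiplies the final value of the profile by \<open>s\<close>, because the
  derivative part ends in 0. One profile \<open>g\<close> serves all \<open>e\<close>, so the limit
  can be taken afterwards.\<close>

lemma act_cut_powr:
  assumes "profile \<kappa> h"
  shows "\<exists>g. profile (poly P s * \<kappa>) g \<and> (\<forall>e>0. act P (cut_powr s e h) = cut_powr s e g)"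
  using assms
proof (induction P arbitrary: \<kappa> h)
  case 0
  have "profile 0 (\<lambda>_. 0)"
    by (simp add: profile_def cdiff_const)
  then show ?case
    by (intro exI[of _ "\<lambda>_. 0"]) (auto simp: cut_powr_def)
next
  case (pCons a P)
  have "profile (s * \<kappa> + 1 * 0) (\<lambda>t. s * h t + 1 * theta h t)"
    by (rule profile_lincomb[OF pCons.prems profile_theta[OF pCons.prems]])
  then have "profile (s * \<kappa>) (\<lambda>t. s * h t + theta h t)"
    by simp
  from pCons.IH[OF this] obtain g where g: "profile (poly P s * (s * \<kappa>)) g"
    "\<forall>e>0. act P (cut_powr s e (\<lambda>t. s * h t + theta h t)) = cut_powr s e g"
    by blast
  have "profile (poly (pCons a P) s * \<kappa>) (\<lambda>t. a * h t + 1 * g t)"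
    using profile_lincomb[OF pCons.prems g(1), of a 1] by (simp add: algebra_simps)
  moreover have "act (pCons a P) (cut_powr s e h) = cut_powr s e (\<lambda>t. a * h t + 1 * g t)" if "e > 0" for e
    using g(2) that by (simp add: act_pCons theta_cut_powr profile_in[OF pCons.prems]) (simp add:
        cut_powr_def algebra_simps)
  ultimately show ?case
    by blast
qed

text \<open>The inverse form of the conjugation: \<open>\<theta> + c\<close> acts on the profile as
  \<open>\<theta> + s + c\<close>.\<close>

lemma prim_cut_powr:
  assumes "h \<in> \<E>" "e > 0"
  shows "prim c (cut_powr s e h) = cut_powr s e (prim (s + c) h)"
proof (rule prim_eqI)
  let ?p = "prim (s + c) h"
  have p: "?p \<in> \<E>" "act [:s + c, 1:] ?p = h"
    using prim_in_act assms by auto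
  have "act [:c, 1:] (cut_powr s e ?p) = (\<lambda>t. c * cut_powr s e ?p t + cut_powr s e (\<lambda>t. s * ?p t +
      theta ?p t) t)"
    by (simp add: act_pCons theta_cut_powr assms p)
  also have "\<dots> = cut_powr s e (act [:s + c, 1:] ?p)"
    by (simp add: cut_powr_def act_pCons algebra_simps)
  finally show "act [:c, 1:] (cut_powr s e ?p) = cut_powr s e h"
    using p by simp
qed (use assms in \<open>auto intro: cut_powr_in prim_in_act\<close>)

text \<open>Beyond 2 the profile is constant and the integral is explicit: the value is
  \<open>\<kappa> / w\<close> plus a multiple of \<open>x powr (- w)\<close>, which decays because
  \<open>Re w > 0\<close>.\<close>

lemma prim_profile_limit:
  assumes "profile \<kappa> h" "Re w > 0"
  shows "(prim w h \<longlongrightarrow> \<kappa> / w) at_top"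
proof -
  have h: "h \<in> \<E>"
    by (rule profile_in) fact
  define g where "g = (\<lambda>t. h t * of_real t powr (w - 1))"
  have g: "continuous_on A g" for A
    unfolding g_def by (intro half_smooth_continuous half_smooth_powr h)
  define C where "C = integral {0..2} g - \<kappa> / w * 2 powr w"
  have w0: "w \<noteq> 0"
    using assms by auto
  have eq: "prim w h x = \<kappa> / w + C * of_real x powr (- w)" if x: "x > 2" for x
  proof -
    have "integral {0..x} g = integral {0..2} g + integral {2..x} g"
      using x by (intro Henstock_Kurzweil_Integration.integral_combine[symmetric]
          integrable_continuous_interval g) auto
    also have "(g has_integral \<kappa> / w * of_real x powr w - \<kappa> / w * of_real 2 powr w) {2..x}"
    proof (rule fundamental_theorem_of_calculus)
      fix t assume t: "t \<in> {2..x}"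
      have "((\<lambda>z. \<kappa> / w * z powr w) has_field_derivative \<kappa> / w * (w * of_real t powr (w - 1))) (at
          (of_real t))"
        using t by (intro DERIV_cmult has_field_derivative_powr) auto
      from has_vector_derivative_real_field[OF this]
      have "((\<lambda>t. \<kappa> / w * of_real t powr w) has_vector_derivative g t) (at t)"
        using t assms w0 by (simp add: g_def profile_def)
      then show "((\<lambda>t. \<kappa> / w * of_real t powr w) has_vector_derivative g t) (at t within {2..x})"
        by (rule has_vector_derivative_at_within)
    qed (use x in auto)
    then have "integral {2..x} g = \<kappa> / w * of_real x powr w - \<kappa> / w * 2 powr w"
      by (simp add: integral_unique)
    finally have "integral {0..x} g = C + \<kappa> / w * of_real x powr w"
      by (simp add: C_def)
    moreover have "of_real x powr w * complex_of_real x powr (- w) = 1"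
      using x powr_add[of "complex_of_real x" w "- w"] by simp
    ultimately show ?thesis
      by (simp add: prim_def g_def[symmetric] algebra_simps)
  qed
  have "((\<lambda>x. norm (C * complex_of_real x powr (- w))) \<longlongrightarrow> 0) at_top"
  proof -
    have "((\<lambda>x. norm C * x powr (- Re w)) \<longlongrightarrow> norm C * 0) at_top"
      using assms(2) by (intro tendsto_mult tendsto_const tendsto_neg_powr filterlim_ident) auto
    then have "((\<lambda>x. norm C * x powr (- Re w)) \<longlongrightarrow> 0) at_top"
      by simp
    then show ?thesis
      by (rule Lim_transform_eventually)
        (auto simp: norm_mult norm_powr_real_powr intro!: eventually_mono[OF eventually_gt_at_top[of 0]])
  qed
  then have "((\<lambda>x. C * complex_of_real x powr (- w)) \<longlongrightarrow> 0) at_top"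
    by (rule tendsto_norm_zero_cancel)
  then have "((\<lambda>x. \<kappa> / w + C * complex_of_real x powr (- w)) \<longlongrightarrow> \<kappa> / w + 0) at_top"
    by (intro tendsto_intros)
  then have "((\<lambda>x. \<kappa> / w + C * complex_of_real x powr (- w)) \<longlongrightarrow> \<kappa> / w) at_top"
    by simp
  then show ?thesis
    by (rule Lim_transform_eventually)
      (use eq in \<open>auto intro!: eventually_mono[OF eventually_gt_at_top[of 2]]\<close>)
qed

lemma filterlim_inverse_at_right: "filterlim (\<lambda>e::real. 1 / e) at_top (at_right 0)"
  using filterlim_inverse_at_top_right by (simp add: inverse_eq_divide)

text \<open>At the point 1 the cut-off parameter enters only through the argument
  \<open>1 / e\<close> of the new profile, so letting \<open>e\<close> tend to 0 means going to
  infinity in \<open>prim_profile_limit\<close>.\<close>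

lemma has_mellin_prim_sum:
  assumes "represents R u" "\<And>f. f \<in> \<E> \<Longrightarrow> R f = (\<lambda>t. k * prim_sum N r c (act P f) t)"
    and "\<And>i. i < N \<Longrightarrow> Re (s + c i) > 0"
  shows "has_mellin u s (k * poly P s * (\<Sum>i<N. r i / (s + c i)))"
  unfolding has_mellin_def
proof (intro allI impI)
  fix h assume "smooth h \<and> (\<forall>t\<le>1. h t = 0) \<and> (\<forall>t\<ge>2. h t = 1)"
  then have h: "profile 1 h"
    by (auto simp: profile_def smooth_iff_cdiff)
  obtain g where g: "profile (poly P s) g" "\<forall>e>0. act P (cut_powr s e h) = cut_powr s e g"
    using act_cut_powr[OF h, of P s] by auto
  have eq: "pairing u (\<lambda>t. h (t / e) * of_real t powr s) = k * (\<Sum>i<N. r i * prim (s + c i) g (1 /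
      e))" if "e > 0" for e
  proof -
    have "pairing u (\<lambda>t. h (t / e) * of_real t powr s) = R (cut_powr s e h) 1"
      using pairing_represents[OF assms(1) cut_powr_in[OF that profile_in[OF h]]] by (simp add:
          cut_powr_def)
    also have "\<dots> = k * prim_sum N r c (cut_powr s e g) 1"
      using assms(2)[OF cut_powr_in[OF that profile_in[OF h]]] g(2) that by simp
    also have "\<dots> = k * (\<Sum>i<N. r i * prim (s + c i) g (1 / e))"
      by (simp add: prim_sum_def prim_cut_powr[OF profile_in[OF g(1)] that]) (simp add: cut_powr_def)
    finally show ?thesis .
  qed
  have "((\<lambda>e. k * (\<Sum>i<N. r i * prim (s + c i) g (1 / e))) \<longlongrightarrow> k * (\<Sum>i<N. r i * (poly P s / (s + c
      i)))) (at_right 0)"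
    by (intro tendsto_intros filterlim_compose[OF prim_profile_limit[OF g(1)]
        filterlim_inverse_at_right]) (use assms(3) in auto)
  then have "((\<lambda>e. k * (\<Sum>i<N. r i * prim (s + c i) g (1 / e))) \<longlongrightarrow> k * poly P s * (\<Sum>i<N. r i / (s + c
      i))) (at_right 0)"
    by (simp add: sum_distrib_left mult_ac)
  then show "((\<lambda>e. pairing u (\<lambda>t. h (t / e) * of_real t powr s)) \<longlongrightarrow> k * poly P s * (\<Sum>i<N. r i / (s +
      c i))) (at_right 0)"
    by (rule Lim_transform_eventually) (use eq in \<open>auto simp: eventually_at_filter\<close>)
qed

text \<open>The case of a distribution supported at 1: the cut-off is no longer felt once
  \<open>1 / e \<ge> 2\<close>, so the limit is attained for every \<open>s\<close>.\<close>

lemma has_mellin_act: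
  assumes "represents R u" "\<And>f. f \<in> \<E> \<Longrightarrow> R f = (\<lambda>t. k * act P f t)"
  shows "has_mellin u s (k * poly P s)"
  unfolding has_mellin_def
proof (intro allI impI)
  fix h assume "smooth h \<and> (\<forall>t\<le>1. h t = 0) \<and> (\<forall>t\<ge>2. h t = 1)"
  then have h: "profile 1 h"
    by (auto simp: profile_def smooth_iff_cdiff)
  obtain g where g: "profile (poly P s) g" "\<forall>e>0. act P (cut_powr s e h) = cut_powr s e g"
    using act_cut_powr[OF h, of P s] by auto
  have eq: "pairing u (\<lambda>t. h (t / e) * of_real t powr s) = k * g (1 / e)" if "e > 0" for e
  proof -
    have "pairing u (\<lambda>t. h (t / e) * of_real t powr s) = R (cut_powr s e h) 1"
      using pairing_represents[OF assms(1) cut_powr_in[OF that profile_in[OF h]]] by (simp add: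
          cut_powr_def)
    then show ?thesis
      using assms(2)[OF cut_powr_in[OF that profile_in[OF h]]] g(2) that by (simp add: cut_powr_def)
  qed
  show "((\<lambda>e. pairing u (\<lambda>t. h (t / e) * of_real t powr s)) \<longlongrightarrow> k * poly P s) (at_right 0)"
  proof (rule tendsto_eventually)
    have "eventually (\<lambda>e. e \<in> {0<..<1/2}) (at_right (0::real))"
      by (rule eventually_at_right_real) simp
    then show "\<forall>\<^sub>F e in at_right 0. pairing u (\<lambda>t. h (t / e) * of_real t powr s) = k * poly P s"
    proof eventually_elim
      case (elim e)
      then have "1 / e \<ge> 2"
        by (simp add: field_simps)
      then show ?case
        using eq[of e] g(1) elim by (simp add: profile_def)
    qed
  qed
qed

text \<open>As \<open>has_mellin\<close> quantifies over all cut-offs, uniqueness rests on the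
  existence of one.\<close>

lemma has_mellin_unique:
  assumes "has_mellin u s a" "has_mellin u s b" shows "a = b"
proof -
  obtain h :: "real \<Rightarrow> complex" where h: "smooth h" "\<And>t. t \<le> 2 \<Longrightarrow> h t = 1" "\<And>t. t \<ge> 3 \<Longrightarrow> h t = 0"
    using ex_smooth_cutoff by blast
  \<comment> \<open>The available cut-off falls from 1 to 0 between 2 and 3; shifting it by 1 and
    subtracting it from 1 gives a rise between 1 and 2.\<close>
  define g where "g = (\<lambda>t. 1 + (- 1) * h (1 * t + 1))"
  have "smooth g"
    using h(1) unfolding g_def smooth_iff_cdiff by (intro allI cdiff_add cdiff_mult cdiff_const
        cdiff_affine) auto
  moreover have "\<forall>t\<le>1. g t = 0" "\<forall>t\<ge>2. g t = 1"
    using h(2,3) by (auto simp: g_def)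
  ultimately show ?thesis
    using assms tendsto_unique[OF trivial_limit_at_right_real] unfolding has_mellin_def by blast
qed

text \<open>The identity theorem for the difference gives equality in a punctured neighbourhood of
  every point. The value at the point itself is then forced: the limit if there is one, and 0 at a
  common pole.\<close>

lemma nicely_meromorphic_unique:
  assumes F: "F nicely_meromorphic_on UNIV" and G: "G nicely_meromorphic_on UNIV"
    and eq: "\<And>s. Re s > \<sigma> \<Longrightarrow> F s = G s"
  shows "F = G"
proof
  fix z
  define h where "h = (\<lambda>z. F z - G z)"
  have mero: "F meromorphic_on UNIV" "G meromorphic_on UNIV"
    using F G by (auto simp: nicely_meromorphic_on_def)
  have h: "h meromorphic_on UNIV"
    unfolding h_def by (intro meromorphic_intros mero)
  have nice: "remove_sings h nicely_meromorphic_on UNIV"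
    by (rule remove_sings_nicely_meromorphic[OF h])
  define a where "a = complex_of_real (\<sigma> + 1)"
  have "eventually (\<lambda>s. s \<in> {s. Re s > \<sigma>}) (at a)"
    by (rule eventually_at_in_open') (auto simp: open_halfspace_Re_gt a_def)
  moreover have "eventually (\<lambda>s. remove_sings h s = h s) (at a)"
    by (rule eventually_remove_sings_eq_at) (use h meromorphic_on_isolated_singularity in \<open>blast
        intro: meromorphic_on_subset\<close>)
  ultimately have "eventually (\<lambda>s. remove_sings h s = 0) (at a)"
    by eventually_elim (use eq in \<open>auto simp: h_def\<close>)
  then have fr: "frequently (\<lambda>s. remove_sings h s = 0) (at a)"
    by (intro eventually_frequently) auto
  have zero: "remove_sings h s = 0" for s
    using frequently_eq_meromorphic_imp_constant[OF fr nice open_UNIV connected_UNIV] by simp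
  have "eventually (\<lambda>s. remove_sings h s = h s) (at z)"
    by (rule eventually_remove_sings_eq_at) (use h meromorphic_on_isolated_singularity in \<open>blast
        intro: meromorphic_on_subset\<close>)
  then have ev: "eventually (\<lambda>s. F s = G s) (at z)"
    by eventually_elim (simp only: zero, simp add: h_def)
  have pole: "is_pole F z \<longleftrightarrow> is_pole G z"
    by (rule is_pole_cong) (use ev in auto)
  have lim: "(F \<midarrow>z\<rightarrow> c) \<longleftrightarrow> (G \<midarrow>z\<rightarrow> c)" for c
    by (rule tendsto_cong) (use ev in auto)
  have ex: "\<not> (is_pole f z \<and> f \<midarrow>z\<rightarrow> c)" for f :: "complex \<Rightarrow> complex" and c
    using not_tendsto_and_filterlim_at_infinity[of "at z" f c] by (auto simp: is_pole_def)
  have nF: "is_pole F z \<and> F z = 0 \<or> F \<midarrow>z\<rightarrow> F z" and nG: "is_pole G z \<and> G z = 0 \<or> G \<midarrow>z\<rightarrow> G z"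
    using F G by (auto simp: nicely_meromorphic_on_def)
  show "F z = G z"
  proof (cases "is_pole F z")
    case True
    then show ?thesis
      using nF nG ex[of F "F z"] ex[of G "G z"] pole by auto
  next
    case False
    then have "G \<midarrow>z\<rightarrow> F z" "G \<midarrow>z\<rightarrow> G z"
      using nF nG pole lim by auto
    then show ?thesis
      by (rule LIM_unique)
  qed
qed

lemma mellin_eqI:
  assumes "f meromorphic_on UNIV" "\<And>s. Re s > \<sigma> \<Longrightarrow> f analytic_on {s}" "\<And>s. Re s > \<sigma> \<Longrightarrow> has_mellin u s (f s)"
  shows "mellin u = remove_sings f"
  unfolding mellin_def
proof (rule the_equality)
  have rs: "remove_sings f s = f s" if "Re s > \<sigma>" for s
    using assms(2)[OF that] by simp
  show "remove_sings f nicely_meromorphic_on UNIV \<and> (\<exists>\<sigma>. \<forall>s. \<sigma> < Re s \<longrightarrow> has_mellin u s (remove_sings f s))"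
    using remove_sings_nicely_meromorphic[OF assms(1)] assms(3) rs by (intro conjI exI[of _ \<sigma>]) auto
  fix F assume F: "F nicely_meromorphic_on UNIV \<and> (\<exists>\<sigma>. \<forall>s. \<sigma> < Re s \<longrightarrow> has_mellin u s (F s))"
  then obtain \<tau> where \<tau>: "\<forall>s. \<tau> < Re s \<longrightarrow> has_mellin u s (F s)"
    by blast
  show "F = remove_sings f"
  proof (rule nicely_meromorphic_unique)
    show "F s = remove_sings f s" if "Re s > max \<sigma> \<tau>" for s
    proof -
      have "Re s > \<sigma>" "Re s > \<tau>"
        using that by auto
      then show ?thesis
        using has_mellin_unique[of u s "F s" "f s"] \<tau> assms(3)[of s] rs[of s] by simp
    qed
  qed (use F remove_sings_nicely_meromorphic[OF assms(1)] in auto)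
qed

text \<open>All zeros and poles of the rational functions and Gamma quotients at issue are integers,
  so the integers serve as the exceptional set throughout.\<close>

lemma cosparse_not_Ints: "\<forall>\<^sub>\<approx>s::complex. s \<notin> \<int>"
  unfolding eventually_cosparse
proof (subst sparse_in_open)
  have "\<not> y islimpt (\<int> :: complex set)" for y
  proof (rule discrete_imp_not_islimpt[of 1])
    fix a b :: complex assume "a \<in> \<int>" "b \<in> \<int>" "dist b a < 1"
    then obtain i j where ij: "a = of_int i" "b = of_int j"
      by (auto elim!: Ints_cases)
    have "dist b a = \<bar>real_of_int (j - i)\<bar>"
      unfolding ij dist_norm by (simp flip: of_int_diff)
    then have "\<bar>real_of_int (j - i)\<bar> < 1"
      using \<open>dist b a < 1\<close> by simp
    then show "b = a"
      unfolding ij by (simp flip: of_int_diff)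
  qed simp
  then show "\<forall>y\<in>UNIV. \<not> y islimpt {x::complex. \<not> x \<notin> \<int>}"
    by simp
qed simp

lemma Gamma_shift:
  assumes "z \<notin> \<int>\<^sub>\<le>\<^sub>0"
  shows "Gamma (z + of_nat n) / Gamma z = (pochhammer z n :: complex)"
  using pochhammer_Gamma[OF assms] by simp

subsection \<open>Moments of the sphere\<close>

definition gauss_moment :: "nat \<Rightarrow> real" where
  "gauss_moment k = (\<integral>x. std_normal_density x * x ^ k \<partial>lborel)"

lemma gauss_moment_rec: "gauss_moment (Suc (Suc k)) = real (Suc k) * gauss_moment k"
proof (cases "even k")
  case True
  then obtain j where j: "k = 2 * j"
    by blast
  have "gauss_moment (2 * Suc j) = real (Suc (2 * j)) * gauss_moment (2 * j)"
  proof -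
    have 1: "fact (2 * Suc j) = (2 * (real j + 1)) * (real (Suc (2 * j)) * fact (2 * j))"
      by (simp add: algebra_simps)
    have 2: "2 ^ Suc j * fact (Suc j) = (2 * (real j + 1)) * (2 ^ j * fact j)"
      by (simp add: algebra_simps)
    have "2 * (real j + 1) \<noteq> 0"
      by simp
    then show ?thesis
      unfolding gauss_moment_def integral_std_normal_moment_even 1 2
      by (subst mult_divide_mult_cancel_left) auto
  qed
  then show ?thesis
    by (simp add: j)
next
  case False
  then obtain j where j: "k = 2 * j + 1"
    by (rule oddE)
  have "gauss_moment (2 * Suc j + 1) = real (Suc (2 * j + 1)) * gauss_moment (2 * j + 1)"
    unfolding gauss_moment_def integral_std_normal_moment_odd by simp
  then show ?thesis
    by (simp add: j)
qed

lemma gauss_moment_0 [simp]: "gauss_moment 0 = 1"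
  unfolding gauss_moment_def using integral_std_normal_moment_even[of 0] by simp

lemma gauss_moment_1 [simp]: "gauss_moment (Suc 0) = 0"
  unfolding gauss_moment_def using integral_std_normal_moment_odd[of 0] by simp

text \<open>For \<open>k < 2\<close> the truncated \<open>k - 2\<close> is harmless: the left side
  has a factor 0, and so has the right side, the first moment being 0.\<close>

lemma gauss_moment_two_less:
  "real k * real (k - 1) * gauss_moment (k - 2) = real k * gauss_moment k"
proof (cases k)
  case (Suc j)
  then show ?thesis
    by (cases j) (simp_all add: gauss_moment_rec)
qed simp

text \<open>The radial part of a Gaussian integral, equal to 2^((k - 1) / 2) times Gamma of (k + 1)
  / 2.\<close>

definition half_gauss :: "nat \<Rightarrow> real" where
  "half_gauss k = (LBINT x:{0<..}. x ^ k * exp (- x\<^sup>2 / 2))"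

lemma integrable_half_gauss: "set_integrable lborel {a<..} (\<lambda>x::real. x ^ k * exp (- x\<^sup>2 / 2))"
proof -
  have "integrable lborel (\<lambda>x. sqrt (2 * pi) * (std_normal_density x * x ^ k))"
    by (intro integrable_mult_right integrable_std_normal_moment)
  then have "integrable lborel (\<lambda>x::real. x ^ k * exp (- x\<^sup>2 / 2))"
    by (simp add: std_normal_density_def mult_ac)
  then have "set_integrable lborel UNIV (\<lambda>x::real. x ^ k * exp (- x\<^sup>2 / 2))"
    by (simp add: set_integrable_def)
  then show ?thesis
    by (rule set_integrable_subset) auto
qed

text \<open>Minus the derivative of \<open>x ^ h * exp (- x^2 / 2)\<close>, so that its integral
  over all larger radii returns that function.\<close>

definition radial_density :: "nat \<Rightarrow> real \<Rightarrow> real" where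
  "radial_density h x = x * x ^ h * exp (- x\<^sup>2 / 2) - real h * x ^ (h - 1) * exp (- x\<^sup>2 / 2)"

lemma radial_density_integrable: "set_integrable lborel {a<..} (\<lambda>x. radial_density h x * x ^ d)"
proof -
  have "set_integrable lborel {a<..} (\<lambda>x. x ^ (Suc h + d) * exp (- x\<^sup>2 / 2) - real h * (x ^ (h - 1 +
      d) * exp (- x\<^sup>2 / 2)))"
    by (intro set_integral_diff set_integrable_mult_right integrable_half_gauss)
  then show ?thesis
    by (simp add: radial_density_def power_add algebra_simps)
qed

lemma integral_radial_density:
  assumes "a \<ge> 0"
  shows "(LBINT x:{a<..}. radial_density h x) = a ^ h * exp (- a\<^sup>2 / 2)"
proof -
  define F where "F = (\<lambda>x::real. - (x ^ h * exp (- x\<^sup>2 / 2)))"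
  have "(LBINT x=ereal a..\<infinity>. radial_density h x) = 0 - F a"
  proof (rule interval_integral_FTC_integrable)
    show "(F has_vector_derivative radial_density h x) (at x)" for x
      unfolding F_def radial_density_def has_real_derivative_iff_has_vector_derivative[symmetric]
      by (auto intro!: derivative_eq_intros simp: algebra_simps)
    show "isCont (radial_density h) x" for x
      unfolding radial_density_def by (intro continuous_intros) auto
    show "set_integrable lborel (einterval (ereal a) \<infinity>) (radial_density h)"
      using radial_density_integrable[of a h 0] by simp
    show "((F \<circ> real_of_ereal) \<longlongrightarrow> F a) (at_right (ereal a))"
      unfolding ereal_tendsto_simps F_def by (intro tendsto_intros) auto
    have "((\<lambda>x::real. - (x ^ h * exp (- x\<^sup>2 / 2))) \<longlongrightarrow> 0) at_top"
      by real_asymp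
    then show "((F \<circ> real_of_ereal) \<longlongrightarrow> 0) (at_left \<infinity>)"
      unfolding ereal_tendsto_simps F_def .
  qed auto
  then show ?thesis
    by (simp add: interval_integral_to_infinity_eq F_def)
qed

text \<open>The function \<open>x ^ (k + 1) * exp (- x^2 / 2)\<close> vanishes at 0 and at infinity,
  so its derivative has integral 0.\<close>

lemma half_gauss_rec: "half_gauss (k + 2) = real (k + 1) * half_gauss k"
proof -
  have "0 = (LBINT x:{0<..}. radial_density (Suc k) x)"
    using integral_radial_density[of 0 "Suc k"] by simp
  also have "\<dots> = (LBINT x:{0<..}. x ^ (k + 2) * exp (- x\<^sup>2 / 2) - real (k + 1) * (x ^ k * exp (- x\<^sup>2 / 2)))"
    by (simp add: radial_density_def algebra_simps)
  also have "\<dots> = half_gauss (k + 2) - real (k + 1) * half_gauss k"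
    unfolding half_gauss_def
    by (subst set_integral_diff(2)[OF integrable_half_gauss set_integrable_mult_right[OF
        integrable_half_gauss]]) simp
  finally show ?thesis
    by simp
qed

lemma half_gauss_pos: "half_gauss k > 0"
proof -
  let ?f = "\<lambda>x::real. indicator {0<..} x * (x ^ k * exp (- x\<^sup>2 / 2))"
  have int: "integrable lborel ?f"
    using integrable_half_gauss[of 0 k] by (simp add: set_integrable_def)
  have nn: "AE x in lborel. 0 \<le> ?f x"
    by (auto simp: indicator_def)
  have "half_gauss k \<noteq> 0"
  proof
    assume "half_gauss k = 0"
    then have "AE x in lborel. ?f x = 0"
      using integral_nonneg_eq_0_iff_AE[OF int nn] by (simp add: half_gauss_def set_lebesgue_integral_def)
    then have "AE x::real in lborel. x \<notin> {0<..<1}"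
      by (rule AE_mp) (auto simp: indicator_def)
    then have "emeasure lborel {0<..<1::real} = 0"
      by (subst (asm) AE_iff_measurable[of "{0<..<1}"]) auto
    then show False
      by simp
  qed
  moreover have "half_gauss k \<ge> 0"
    unfolding half_gauss_def set_lebesgue_integral_def using nn by (intro integral_nonneg_AE) simp
  ultimately show ?thesis
    by simp
qed

text \<open>By the recursion the first term contributes the factor \<open>h + d\<close>, from which
  the second subtracts \<open>h\<close>.\<close>

lemma integral_radial_density_power:
  "d > 0 \<Longrightarrow> (LBINT x:{0<..}. radial_density h x * x ^ d) = real d * half_gauss (h + d - 1)"
proof -
  assume d: "d > 0"
  have "(LBINT x:{0<..}. radial_density h x * x ^ d) =
      (LBINT x:{0<..}. x ^ (h + d - 1 + 2) * exp (- x\<^sup>2 / 2) - real h * (x ^ (h + d - 1) * exp (-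
          x\<^sup>2 / 2)))"
  proof (rule set_lebesgue_integral_cong)
    have 1: "x * x ^ h * x ^ d = x ^ (h + d - 1 + 2)" for x :: real
    proof -
      have "h + d - 1 + 2 = Suc (h + d)"
        using d by simp
      then show ?thesis
        by (simp add: power_add)
    qed
    have 2: "real h * x ^ (h - 1) * x ^ d = real h * x ^ (h + d - 1)" for x :: real
      by (cases h) (use d in \<open>auto simp: power_add\<close>)
    have "radial_density h x * x ^ d = (x * x ^ h * x ^ d) * exp (- x\<^sup>2 / 2) - (real h * x ^ (h - 1)
        * x ^ d) * exp (- x\<^sup>2 / 2)" for x
      by (simp add: radial_density_def algebra_simps)
    then show "\<forall>x. x \<in> {0<..} \<longrightarrow> radial_density h x * x ^ d =
        x ^ (h + d - 1 + 2) * exp (- x\<^sup>2 / 2) - real h * (x ^ (h + d - 1) * exp (- x\<^sup>2 / 2))"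
      unfolding 1 2 by simp
  qed simp
  also have "\<dots> = half_gauss (h + d - 1 + 2) - real h * half_gauss (h + d - 1)"
    unfolding half_gauss_def
    by (subst set_integral_diff(2)[OF integrable_half_gauss set_integrable_mult_right[OF
        integrable_half_gauss]]) simp
  also have "\<dots> = real d * half_gauss (h + d - 1)"
    unfolding half_gauss_rec using d by (simp add: of_nat_diff algebra_simps)
  finally show ?thesis .
qed

section \<open>Products of Lebesgue measures: scaling and moments\<close>

abbreviation prod_lborel :: "'a set \<Rightarrow> ('a \<Rightarrow> real) measure" where
  "prod_lborel B \<equiv> \<Pi>\<^sub>M b\<in>B. lborel"

lemma prod_lborel_scale:
  fixes F :: "('a \<Rightarrow> real) \<Rightarrow> 'c::{banach, second_countable_topology}"
  assumes B: "finite B" and \<rho>: "\<rho> > 0" and F: "F \<in> borel_measurable (prod_lborel B)"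
  shows "(\<integral>c. F c \<partial>prod_lborel B) = \<rho> ^ card B *\<^sub>R (\<integral>c. F (\<lambda>b\<in>B. \<rho> * c b) \<partial>prod_lborel B)"
proof -
  interpret product_sigma_finite "\<lambda>_::'a. lborel :: real measure"
    by unfold_locales
  let ?M = "prod_lborel B"
  define T where "T = (\<lambda>c::'a \<Rightarrow> real. \<lambda>b\<in>B. \<rho> * c b)"
  have T[measurable]: "T \<in> ?M \<rightarrow>\<^sub>M ?M"
    unfolding T_def by measurable
  let ?P = "density (distr ?M ?M T) (\<lambda>_. ennreal (\<rho> ^ card B))"
  have "?P = ?M"
  proof (rule PiM_eqI[OF B])
    show "sets ?P = sets ?M"
      by simp
    fix A assume A: "\<And>b. b \<in> B \<Longrightarrow> A b \<in> sets (lborel :: real measure)"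
    have box: "Pi\<^sub>E B A \<in> sets ?M"
      using A B by (intro sets_PiM_I_finite) auto
    have mb: "(*) \<rho> -` A b \<in> sets lborel" if "b \<in> B" for b
      using measurable_sets[of "(*) \<rho>" lborel lborel "A b"] A[OF that] by simp
    have sc: "emeasure lborel (A b) = ennreal \<rho> * emeasure lborel ((*) \<rho> -` A b)" if "b \<in> B" for b
    proof -
      have "emeasure lborel (A b) = emeasure (density (distr lborel borel ((*) \<rho>)) (\<lambda>_. \<bar>\<rho>\<bar>)) (A b)"
        using lborel_distr_mult'[of \<rho>] \<rho> by simp
      also have "\<dots> = ennreal \<rho> * emeasure (distr lborel borel ((*) \<rho>)) (A b)"
        using A[OF that] \<rho> by (subst emeasure_density) (auto simp: nn_integral_cmult)
      also have "\<dots> = ennreal \<rho> * emeasure lborel ((*) \<rho> -` A b)"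
        using A[OF that] by (subst emeasure_distr) auto
      finally show ?thesis .
    qed
    have "emeasure ?P (Pi\<^sub>E B A) = ennreal (\<rho> ^ card B) * emeasure ?M (T -` Pi\<^sub>E B A \<inter> space ?M)"
      using box by (subst emeasure_density) (auto simp: nn_integral_cmult emeasure_distr)
    also have "T -` Pi\<^sub>E B A \<inter> space ?M = (\<Pi>\<^sub>E b\<in>B. (*) \<rho> -` A b)"
      by (auto simp: T_def space_PiM PiE_def Pi_def extensional_def)
    also have "emeasure ?M \<dots> = (\<Prod>b\<in>B. emeasure lborel ((*) \<rho> -` A b))"
      using mb by (intro emeasure_PiM B) auto
    also have "ennreal (\<rho> ^ card B) * \<dots> = (\<Prod>b\<in>B. ennreal \<rho> * emeasure lborel ((*) \<rho> -` A b))"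
      using \<rho> by (simp add: prod.distrib ennreal_power)
    also have "\<dots> = (\<Prod>b\<in>B. emeasure lborel (A b))"
      by (intro prod.cong) (auto simp: sc)
    finally show "emeasure ?P (Pi\<^sub>E B A) = (\<Prod>b\<in>B. emeasure lborel (A b))" .
  qed
  then have "(\<integral>c. F c \<partial>?M) = (\<integral>c. F c \<partial>?P)"
    by simp
  also have "\<dots> = (\<integral>c. \<rho> ^ card B *\<^sub>R F c \<partial>distr ?M ?M T)"
    using F \<rho> by (subst integral_density) auto
  also have "\<dots> = \<rho> ^ card B *\<^sub>R (\<integral>c. F (T c) \<partial>?M)"
    using F by (subst integral_distr) auto
  finally show ?thesis
    by (simp add: T_def)
qed

definition monom_fun :: "'a set \<Rightarrow> ('a \<Rightarrow> nat) \<Rightarrow> ('a \<Rightarrow> real) \<Rightarrow> real" where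
  "monom_fun B e c = (\<Prod>b\<in>B. c b ^ e b)"

text \<open>By the polar-coordinate definition of \<open>sphere_measure\<close>,
  \<open>card B\<close> times this number is the integral of the monomial over the unit sphere of
  the span of an orthonormal \<open>B\<close>.\<close>

definition sphere_moment :: "'a set \<Rightarrow> ('a \<Rightarrow> nat) \<Rightarrow> real" where
  "sphere_moment B e =
     (\<integral>c. indicator {..<1} (L2_set c B) * monom_fun B e (\<lambda>b. c b / L2_set c B) \<partial>prod_lborel B)"

lemma L2_set_measurable [measurable]:
  "finite B \<Longrightarrow> (\<lambda>c. L2_set c B) \<in> borel_measurable (prod_lborel B)"
  unfolding L2_set_def by measurable

lemma monom_fun_measurable [measurable]:
  assumes "finite B" "\<And>b. b \<in> B \<Longrightarrow> (\<lambda>c. f c b) \<in> borel_measurable M"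
  shows "(\<lambda>c. monom_fun B e (f c)) \<in> borel_measurable M"
  unfolding monom_fun_def using assms by measurable

lemma abs_monom_fun_normalised_le: "finite B \<Longrightarrow> \<bar>monom_fun B e (\<lambda>b. c b / L2_set c B)\<bar> \<le> 1"
proof -
  assume B: "finite B"
  have "\<bar>c b / L2_set c B\<bar> \<le> 1" if "b \<in> B" for b
  proof -
    have "\<bar>c b\<bar> \<le> L2_set c B"
      using member_le_L2_set[OF B that, of "\<lambda>b. \<bar>c b\<bar>"] by (simp add: L2_set_def)
    then show ?thesis
      using L2_set_nonneg[of c B] by (cases "L2_set c B = 0") (auto simp: abs_divide divide_le_eq_1)
  qed
  then show ?thesis
    unfolding monom_fun_def abs_prod power_abs by (intro prod_le_1) (auto intro: power_le_one)
qed

lemma emeasure_L2_ball_finite: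
  assumes "finite B" shows "emeasure (prod_lborel B) {c \<in> space (prod_lborel B). L2_set c B < \<rho>} < \<infinity>"
proof -
  interpret product_sigma_finite "\<lambda>_::'a. lborel :: real measure"
    by unfold_locales
  have "{c \<in> space (prod_lborel B). L2_set c B < \<rho>} \<subseteq> (\<Pi>\<^sub>E b\<in>B. {- \<rho>..\<rho>})"
  proof
    fix c assume c: "c \<in> {c \<in> space (prod_lborel B). L2_set c B < \<rho>}"
    have "- \<rho> \<le> c b" "c b \<le> \<rho>" if "b \<in> B" for b
    proof -
      have "\<bar>c b\<bar> \<le> \<rho>"
        using member_le_L2_set[OF assms that, of "\<lambda>b. \<bar>c b\<bar>"] c by (simp add: L2_set_def)
      then show "- \<rho> \<le> c b" "c b \<le> \<rho>"
        by linarith+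
    qed
    then show "c \<in> (\<Pi>\<^sub>E b\<in>B. {- \<rho>..\<rho>})"
      using c by (auto simp: space_PiM PiE_iff)
  qed
  then have "emeasure (prod_lborel B) {c \<in> space (prod_lborel B). L2_set c B < \<rho>} \<le> emeasure
      (prod_lborel B) (\<Pi>\<^sub>E b\<in>B. {- \<rho>..\<rho>})"
    using assms by (intro emeasure_mono sets_PiM_I_finite) auto
  also have "\<dots> = (\<Prod>b\<in>B. emeasure lborel {- \<rho>..\<rho>})"
    using assms by (intro emeasure_PiM) auto
  also have "\<dots> < \<infinity>"
    by (simp add: emeasure_lborel_Icc_eq power_less_top_ennreal)
  finally show ?thesis .
qed

lemma L2_set_scale:
  assumes "\<rho> > 0" shows "L2_set (\<lambda>b\<in>B. \<rho> * c b) B = \<rho> * L2_set c B"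
  using assms by (simp add: L2_set_def power_mult_distrib real_sqrt_mult flip: sum_distrib_left)

lemma monom_fun_scale:
  assumes "\<rho> > 0"
  shows "monom_fun B e (\<lambda>b. (\<lambda>b\<in>B. \<rho> * c b) b / L2_set (\<lambda>b\<in>B. \<rho> * c b) B) = monom_fun B e (\<lambda>b. c b /
      L2_set c B)"
  unfolding L2_set_scale[OF assms] monom_fun_def using assms by (intro prod.cong) auto

text \<open>The normalised monomial is invariant under dilations, so only the volume scales. The
  function \<open>g\<close> stands for the identity and for the absolute value; the latter serves
  the integrability check before Fubini.\<close>

lemma sphere_moment_scale:
  fixes g :: "real \<Rightarrow> real"
  assumes B: "finite B" and \<rho>: "\<rho> > 0" and g[measurable]: "g \<in> borel_measurable borel"
  shows "(\<integral>c. indicator {..<\<rho>} (L2_set c B) * g (monom_fun B e (\<lambda>b. c b / L2_set c B)) \<partial>prod_lborel B) =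
    \<rho> ^ card B * (\<integral>c. indicator {..<1} (L2_set c B) * g (monom_fun B e (\<lambda>b. c b / L2_set c B))
        \<partial>prod_lborel B)"
proof -
  have ind: "indicator {..<\<rho>} (\<rho> * x) = (indicator {..<1} x :: real)" for x
    using \<rho> by (auto simp: indicator_def)
  note [measurable] = L2_set_measurable[OF B]
  have [measurable]: "(\<lambda>c. monom_fun B e (\<lambda>b. c b / L2_set c B)) \<in> borel_measurable (prod_lborel B)"
    using B by (intro monom_fun_measurable) measurable
  have "(\<integral>c. indicator {..<\<rho>} (L2_set c B) * g (monom_fun B e (\<lambda>b. c b / L2_set c B)) \<partial>prod_lborel B) =
    \<rho> ^ card B *\<^sub>R (\<integral>c. indicator {..<\<rho>} (L2_set (\<lambda>b\<in>B. \<rho> * c b) B) *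
       g (monom_fun B e (\<lambda>b. (\<lambda>b\<in>B. \<rho> * c b) b / L2_set (\<lambda>b\<in>B. \<rho> * c b) B)) \<partial>prod_lborel B)"
    by (rule prod_lborel_scale[OF B \<rho>]) measurable
  then show ?thesis
    unfolding monom_fun_scale[OF \<rho>] unfolding L2_set_scale[OF \<rho>] ind by simp
qed

lemma sphere_moment_integrable:
  assumes B: "finite B" and g: "g \<in> borel_measurable borel" "\<And>x. \<bar>x\<bar> \<le> 1 \<Longrightarrow> \<bar>g x\<bar> \<le> (1::real)"
  shows "integrable (prod_lborel B) (\<lambda>c. indicator {..<\<rho>} (L2_set c B) * g (monom_fun B e (\<lambda>b. c b /
      L2_set c B)))"
proof (rule Bochner_Integration.integrable_bound)
  note [measurable] = L2_set_measurable[OF B] g(1)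
  have [measurable]: "(\<lambda>c. monom_fun B e (\<lambda>b. c b / L2_set c B)) \<in> borel_measurable (prod_lborel B)"
    using B by (intro monom_fun_measurable) measurable
  show "(\<lambda>c. indicator {..<\<rho>} (L2_set c B) * g (monom_fun B e (\<lambda>b. c b / L2_set c B))) \<in>
      borel_measurable (prod_lborel B)"
    by measurable
  show "integrable (prod_lborel B) (\<lambda>c. indicator {c \<in> space (prod_lborel B). L2_set c B < \<rho>} c :: real)"
    using emeasure_L2_ball_finite[OF B, of \<rho>] by (intro integrable_real_indicator) auto
  show "AE c in prod_lborel B. norm (indicator {..<\<rho>} (L2_set c B) * g (monom_fun B e (\<lambda>b. c b /
      L2_set c B)))
      \<le> norm (indicator {c \<in> space (prod_lborel B). L2_set c B < \<rho>} c :: real)"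
    using g(2)[OF abs_monom_fun_normalised_le[OF B]] by (intro AE_I2) (auto simp: indicator_def)
qed

text \<open>
  Layer-cake form of polar coordinates: the Gaussian weight times the \<open>h\<close>-th power of the radius is
  the integral of \<open>radial_density h\<close> over all larger radii.
\<close>

lemma gauss_sphere_moment:
  assumes B: "finite B" "card B = d" "d > 0" and h: "(\<Sum>b\<in>B. e b) = h"
  shows "(\<integral>c. monom_fun B e c * exp (- (L2_set c B)\<^sup>2 / 2) \<partial>prod_lborel B) =
    real d * half_gauss (h + d - 1) * sphere_moment B e"
proof -
  interpret product_sigma_finite "\<lambda>_::'a. lborel :: real measure"
    by unfold_locales
  let ?M = "prod_lborel B"
  interpret PB: sigma_finite_measure ?M
    using sigma_finite[OF B(1)] .
  interpret P: pair_sigma_finite "lborel :: real measure" ?M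
    by unfold_locales
  define f where "f = (\<lambda>c. monom_fun B e (\<lambda>b. c b / L2_set c B))"
  note [measurable] = L2_set_measurable[OF B(1)]
  have f[measurable]: "f \<in> borel_measurable ?M"
    unfolding f_def using B(1) by (intro monom_fun_measurable) measurable
  have g[measurable]: "radial_density h \<in> borel_measurable borel"
    unfolding radial_density_def by measurable
  define F where "F = (\<lambda>(\<rho>, c). indicator {0<..} \<rho> * radial_density h \<rho> * (indicator {..<\<rho>} (L2_set
      c B) * f c))"
  have F[measurable]: "F \<in> borel_measurable (lborel \<Otimes>\<^sub>M ?M)"
  proof -
    have "(\<lambda>x. indicator {..<fst x} (L2_set (snd x) B) :: real) = (\<lambda>x. if L2_set (snd x) B < fst x
        then 1 else 0)"
      by (auto simp: indicator_def)
    moreover have "(\<lambda>x. L2_set (snd x) B) \<in> borel_measurable (lborel \<Otimes>\<^sub>M ?M)"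
      by measurable
    ultimately have "(\<lambda>x. indicator {..<fst x} (L2_set (snd x) B) :: real) \<in> borel_measurable
        (lborel \<Otimes>\<^sub>M ?M)"
      by simp
    then show ?thesis
      unfolding F_def case_prod_beta by measurable
  qed
  have inner: "(\<integral>c. indicator {..<\<rho>} (L2_set c B) * f c \<partial>?M) = \<rho> ^ d * sphere_moment B e" if "\<rho> > 0" for \<rho>
    using sphere_moment_scale[OF B(1) that, of "\<lambda>x. x" e] by (simp add: f_def sphere_moment_def B)
  have inner_abs: "(\<integral>c. indicator {..<\<rho>} (L2_set c B) * \<bar>f c\<bar> \<partial>?M) =
      \<rho> ^ d * (\<integral>c. indicator {..<1} (L2_set c B) * \<bar>f c\<bar> \<partial>?M)" if "\<rho> > 0" for \<rho>
    using sphere_moment_scale[OF B(1) that, of "\<lambda>x. \<bar>x\<bar>" e] by (simp add: f_def B)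
  have int: "integrable (lborel \<Otimes>\<^sub>M ?M) F"
  proof (rule P.Fubini_integrable)
    show "F \<in> borel_measurable (lborel \<Otimes>\<^sub>M ?M)"
      by (rule F)
    have "integrable lborel (\<lambda>\<rho>. (\<integral>c. indicator {..<1} (L2_set c B) * \<bar>f c\<bar> \<partial>?M) * \<bar>indicator {0<..}
        \<rho> *\<^sub>R (radial_density h \<rho> * \<rho> ^ d)\<bar>)"
      using radial_density_integrable[of 0 h d] unfolding set_integrable_def by (intro
          integrable_mult_right integrable_abs)
    also have "(\<lambda>\<rho>. (\<integral>c. indicator {..<1} (L2_set c B) * \<bar>f c\<bar> \<partial>?M) * \<bar>indicator {0<..} \<rho> *\<^sub>R
        (radial_density h \<rho> * \<rho> ^ d)\<bar>) =
       (\<lambda>\<rho>. \<integral>c. norm (F (\<rho>, c)) \<partial>?M)"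
    proof
      fix \<rho> :: real
      show "(\<integral>c. indicator {..<1} (L2_set c B) * \<bar>f c\<bar> \<partial>?M) * \<bar>indicator {0<..} \<rho> *\<^sub>R
          (radial_density h \<rho> * \<rho> ^ d)\<bar> =
        (\<integral>c. norm (F (\<rho>, c)) \<partial>?M)"
        using inner_abs[of \<rho>] by (cases "\<rho> > 0") (simp_all add: F_def abs_mult)
    qed
    finally show "integrable lborel (\<lambda>\<rho>. \<integral>c. norm (F (\<rho>, c)) \<partial>?M)" .
    show "AE \<rho> in lborel. integrable ?M (\<lambda>c. F (\<rho>, c))"
      unfolding F_def split_conv f_def
      by (intro AE_I2 integrable_mult_right sphere_moment_integrable[OF B(1), where g = "\<lambda>x. x"]) auto
  qed
  have "(\<integral>\<rho>. (\<integral>c. F (\<rho>, c) \<partial>?M) \<partial>lborel) = (\<integral>\<rho>. sphere_moment B e * (indicator {0<..} \<rho> *\<^sub>R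
      (radial_density h \<rho> * \<rho> ^ d)) \<partial>lborel)"
  proof (rule Bochner_Integration.integral_cong)
    fix \<rho> :: real
    show "(\<integral>c. F (\<rho>, c) \<partial>?M) = sphere_moment B e * (indicator {0<..} \<rho> *\<^sub>R (radial_density h \<rho> * \<rho> ^ d))"
      using inner[of \<rho>] by (cases "\<rho> > 0") (simp_all add: F_def)
  qed simp
  also have "\<dots> = real d * half_gauss (h + d - 1) * sphere_moment B e"
    using integral_radial_density_power[OF B(3), of h] by (simp add: set_lebesgue_integral_def)
  finally have 1: "(\<integral>\<rho>. (\<integral>c. F (\<rho>, c) \<partial>?M) \<partial>lborel) = real d * half_gauss (h + d - 1) * sphere_moment B e" .
  \<comment> \<open>Integrating over \<open>c\<close> first gave the sphere moment; integrating over
    the radius first restores the Gaussian weight.\<close>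
  have "(\<integral>\<rho>. (\<integral>c. F (\<rho>, c) \<partial>?M) \<partial>lborel) = (\<integral>c. (\<integral>\<rho>. F (\<rho>, c) \<partial>lborel) \<partial>?M)"
    using P.Fubini_integral[of "\<lambda>\<rho> c. F (\<rho>, c)"] int by (simp add: case_prod_eta)
  also have "\<dots> = (\<integral>c. monom_fun B e c * exp (- (L2_set c B)\<^sup>2 / 2) \<partial>?M)"
  proof (rule Bochner_Integration.integral_cong)
    fix c
    let ?N = "L2_set c B"
    have "F (\<rho>, c) = f c * (indicator {?N<..} \<rho> *\<^sub>R radial_density h \<rho>)" for \<rho>
      using le_less_trans[OF L2_set_nonneg[of c B], of \<rho>] by (auto simp: F_def indicator_def)
    then have "(\<integral>\<rho>. F (\<rho>, c) \<partial>lborel) = f c * (LBINT \<rho>:{?N<..}. radial_density h \<rho>)"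
      by (simp add: set_lebesgue_integral_def)
    also have "\<dots> = f c * ?N ^ h * exp (- ?N\<^sup>2 / 2)"
      using integral_radial_density[of ?N h] by simp
    also have "f c * ?N ^ h = monom_fun B e c"
    proof -
      \<comment> \<open>This includes the origin: if the norm is 0, then every coordinate is
        0.\<close>
      have "c b / ?N * ?N = c b" if "b \<in> B" for b
        using B(1) that by (cases "?N = 0") (auto simp: L2_set_eq_0_iff)
      then have "monom_fun B e c = (\<Prod>b\<in>B. (c b / ?N * ?N) ^ e b)"
        unfolding monom_fun_def by (intro prod.cong) auto
      also have "\<dots> = f c * (\<Prod>b\<in>B. ?N ^ e b)"
        by (simp only: power_mult_distrib prod.distrib f_def monom_fun_def)
      also have "(\<Prod>b\<in>B. ?N ^ e b) = ?N ^ h"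
        by (simp add: h flip: power_sum)
      finally show ?thesis
        by simp
    qed
    finally show "(\<integral>\<rho>. F (\<rho>, c) \<partial>lborel) = monom_fun B e c * exp (- ?N\<^sup>2 / 2)" .
  qed simp
  finally show ?thesis
    using 1 by simp
qed

lemma integral_gauss_monom:
  assumes B: "finite B"
  shows "(\<integral>c. monom_fun B e c * exp (- (L2_set c B)\<^sup>2 / 2) \<partial>prod_lborel B) =
    sqrt (2 * pi) ^ card B * (\<Prod>b\<in>B. gauss_moment (e b))"
proof -
  interpret product_sigma_finite "\<lambda>_::'a. lborel :: real measure"
    by unfold_locales
  have "monom_fun B e c * exp (- (L2_set c B)\<^sup>2 / 2) =
      (\<Prod>b\<in>B. sqrt (2 * pi) * (std_normal_density (c b) * c b ^ e b))" for c
  proof -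
    have "exp (- (L2_set c B)\<^sup>2 / 2) = (\<Prod>b\<in>B. exp (- (c b)\<^sup>2 / 2))"
      using B by (simp add: L2_set_def sum_nonneg exp_sum sum_negf sum_divide_distrib flip: exp_sum)
    then show ?thesis
      by (simp add: monom_fun_def std_normal_density_def mult_ac flip: prod.distrib)
  qed
  then have "(\<integral>c. monom_fun B e c * exp (- (L2_set c B)\<^sup>2 / 2) \<partial>prod_lborel B) =
     (\<Prod>b\<in>B. \<integral>x. sqrt (2 * pi) * (std_normal_density x * x ^ e b) \<partial>lborel)"
    using product_integral_prod[OF B, of "\<lambda>b x. sqrt (2 * pi) * (std_normal_density x * x ^ e b)"]
    by (simp add: integrable_std_normal_moment)
  then show ?thesis
    by (simp add: gauss_moment_def prod.distrib)
qed

lemma sphere_moment_eq: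
  assumes "finite B" "card B = d" "d > 0" "(\<Sum>b\<in>B. e b) = h"
  shows "real d * half_gauss (h + d - 1) * sphere_moment B e = sqrt (2 * pi) ^ d * (\<Prod>b\<in>B.
      gauss_moment (e b))"
  using gauss_sphere_moment[OF assms] integral_gauss_monom[OF assms(1), of e] assms(2) by simp

lemma sphere_moment_0_pos:
  assumes "finite B" "card B = d" "d > 0"
  shows "sphere_moment B (\<lambda>_. 0) > 0"
proof -
  have "real d * half_gauss (d - 1) * sphere_moment B (\<lambda>_. 0) > 0"
    using sphere_moment_eq[OF assms, of "\<lambda>_. 0" 0] by simp
  moreover have "real d * half_gauss (d - 1) > 0"
    using assms half_gauss_pos by simp
  ultimately show ?thesis
    using zero_less_mult_pos by blast
qed

text \<open>For a homogeneous polynomial of degree h, integrating its Laplacian over the sphere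
  multiplies its integral by h (h + d - 2). The Gaussian moments yield the factor h, and the
  quotient of the radial constants for degrees h and h - 2 yields h + d - 2.\<close>

lemma sphere_moment_laplace:
  assumes B: "finite B" "card B = d" "d > 0" and h: "(\<Sum>b\<in>B. e b) = h"
  shows "real h * (real h + real d - 2) * sphere_moment B e =
    (\<Sum>b\<in>B. real (e b) * real (e b - 1) * sphere_moment B (e(b := e b - 2)))"
proof -
  define C where "C = sqrt (2 * pi) ^ d / real d"
  define G where "G e = (\<Prod>b\<in>B. gauss_moment (e b))" for e
  have sm: "half_gauss (sum e B + d - 1) * sphere_moment B e = C * G e" for e
    using sphere_moment_eq[OF B, of e "sum e B"] B(3) by (simp add: C_def G_def field_simps)
  have G: "real (e b) * real (e b - 1) * G (e(b := e b - 2)) = real (e b) * G e" if "b \<in> B" for b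
  proof -
    have "G e = gauss_moment (e b) * (\<Prod>i\<in>B - {b}. gauss_moment (e i))"
      unfolding G_def by (rule prod.remove) (use that B in auto)
    moreover have "G (e(b := e b - 2)) = gauss_moment (e b - 2) * (\<Prod>i\<in>B - {b}. gauss_moment (e i))"
      unfolding G_def by (subst prod.remove[of _ b]) (use that B in \<open>auto intro!: prod.cong\<close>)
    ultimately show ?thesis
      using gauss_moment_two_less[of "e b"] by (metis mult.assoc)
  qed
  have sumG: "(\<Sum>b\<in>B. real (e b) * real (e b - 1) * G (e(b := e b - 2))) = real h * G e"
  proof -
    have "(\<Sum>b\<in>B. real (e b) * real (e b - 1) * G (e(b := e b - 2))) = (\<Sum>b\<in>B. real (e b) * G e)"
      by (rule sum.cong[OF refl G])
    then show ?thesis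
      by (simp add: h[symmetric] flip: sum_distrib_right)
  qed
  \<comment> \<open>Degrees 0 and 1 are separate because of the truncated \<open>h - 2\<close>; in
    degree 1 the moment itself is 0.\<close>
  consider "h = 0" | "h = 1" | "h \<ge> 2"
    by linarith
  then show ?thesis
  proof cases
    case 1
    then have "\<forall>b\<in>B. e b = 0"
      using h B(1) by simp
    then show ?thesis
      using 1 by simp
  next
    case 2
    have e1: "e b \<le> 1" if "b \<in> B" for b
      using member_le_sum[OF that, of e] h 2 B(1) by simp
    have "(\<Sum>b\<in>B. real (e b) * real (e b - 1) * G (e(b := e b - 2))) = 0"
      by (rule sum.neutral) (use e1 in force)
    then have "G e = 0"
      using sumG 2 by simp
    then have "sphere_moment B e = 0"
      using sm[of e] half_gauss_pos[of "sum e B + d - 1"] by simp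
    moreover have "(\<Sum>b\<in>B. real (e b) * real (e b - 1) * sphere_moment B (e(b := e b - 2))) = 0"
      by (rule sum.neutral) (use e1 in force)
    ultimately show ?thesis
      by simp
  next
    case 3
    let ?g = "half_gauss (h - 2 + d - 1)"
    have "h + d - 1 = h - 2 + d - 1 + 2"
      using 3 B(3) by simp
    then have rec: "half_gauss (h + d - 1) = (real h + real d - 2) * ?g"
      using half_gauss_rec[of "h - 2 + d - 1"] 3 B(3) by (simp add: of_nat_diff)
    have trm: "real (e b) * real (e b - 1) * (?g * sphere_moment B (e(b := e b - 2))) =
        C * (real (e b) * real (e b - 1) * G (e(b := e b - 2)))" if "b \<in> B" for b
    proof (cases "e b \<ge> 2")
      case True
      have "sum (e(b := e b - 2)) B + 2 = h"
        using that B(1) True h by (simp add: sum.remove[of B b] sum.cong[of "B - {b}" "B - {b}" "e(b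
            := e b - 2)" e])
      then have "sum (e(b := e b - 2)) B = h - 2"
        by simp
      then show ?thesis
        using sm[of "e(b := e b - 2)"] by simp
    next
      case False
      then have "e b = 0 \<or> e b = 1"
        by auto
      then show ?thesis
        by auto
    qed
    have "?g * (\<Sum>b\<in>B. real (e b) * real (e b - 1) * sphere_moment B (e(b := e b - 2))) =
        (\<Sum>b\<in>B. real (e b) * real (e b - 1) * (?g * sphere_moment B (e(b := e b - 2))))"
      by (simp add: sum_distrib_left mult_ac)
    also have "\<dots> = C * (\<Sum>b\<in>B. real (e b) * real (e b - 1) * G (e(b := e b - 2)))"
      unfolding sum_distrib_left by (rule sum.cong[OF refl trm])
    also have "\<dots> = real h * (half_gauss (h + d - 1) * sphere_moment B e)"
      using sumG sm[of e] h by simp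
    also have "\<dots> = ?g * (real h * (real h + real d - 2) * sphere_moment B e)"
      unfolding rec by simp
    finally show ?thesis
      using half_gauss_pos[of "h - 2 + d - 1"] by simp
  qed
qed

subsection \<open>Averages of polynomials over spheres\<close>

definition orthonormal :: "'a::euclidean_space set \<Rightarrow> bool" where
  "orthonormal B \<longleftrightarrow> pairwise orthogonal B \<and> (\<forall>b\<in>B. norm b = 1)"

lemma orthonormal_independent: "orthonormal B \<Longrightarrow> independent B"
  unfolding orthonormal_def by (rule pairwise_orthogonal_independent) auto

lemma orthonormal_finite: "orthonormal B \<Longrightarrow> finite B"
  using orthonormal_independent independent_imp_finite by blast

lemma orthonormal_inner:
  assumes "orthonormal B" "b \<in> B" "b' \<in> B"
  shows "b \<bullet> b' = (if b = b' then 1 else 0)"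
  using assms by (auto simp: orthonormal_def pairwise_def orthogonal_def norm_eq_1)

lemma orthonormal_expand:
  assumes B: "orthonormal B" and y: "y \<in> span B"
  shows "y = (\<Sum>b\<in>B. (y \<bullet> b) *\<^sub>R b)"
proof -
  obtain u where u: "y = (\<Sum>b\<in>B. u b *\<^sub>R b)"
    using y span_finite[OF orthonormal_finite[OF B]] by auto
  have "y \<bullet> b = u b" if "b \<in> B" for b
  proof -
    have "y \<bullet> b = (\<Sum>b'\<in>B. u b' * (if b' = b then 1 else 0))"
      unfolding u inner_sum_left inner_scaleR_left
      by (rule sum.cong) (use orthonormal_inner[OF B] that in auto)
    then show ?thesis
      using that orthonormal_finite[OF B] by (simp add: if_distrib cong: if_cong)
  qed
  then show ?thesis
    by (subst (1) u) (intro sum.cong, auto)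
qed

lemma orthonormal_norm_sum:
  assumes B: "orthonormal B"
  shows "norm (\<Sum>b\<in>B. c b *\<^sub>R b) = L2_set c B"
proof -
  have "(norm (\<Sum>b\<in>B. c b *\<^sub>R b))\<^sup>2 = (\<Sum>b\<in>B. (norm (c b *\<^sub>R b))\<^sup>2)"
    by (rule norm_sum_Pythagorean[OF orthonormal_finite[OF B]])
      (use B in \<open>auto simp: orthonormal_def pairwise_def orthogonal_def\<close>)
  also have "\<dots> = (\<Sum>b\<in>B. (c b)\<^sup>2)"
    using B by (intro sum.cong) (auto simp: orthonormal_def)
  finally show ?thesis
    unfolding L2_set_def by (metis norm_ge_zero real_sqrt_unique)
qed

lemma ex_orthonormal_span:
  fixes V :: "'a::euclidean_space set"
  assumes "subspace V"
  shows "\<exists>B. orthonormal B \<and> span B = V"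
  using orthonormal_basis_subspace[OF assms] unfolding orthonormal_def by metis

lemma scale_measure_eq_density: "scale_measure r M = density M (\<lambda>_. r)"
  by (rule measure_eqI) (auto simp: emeasure_density nn_integral_cmult_indicator)

text \<open>The basis is handed out and not prescribed, since \<open>subspace_lborel\<close> fixes
  it by choice. In its coordinates the sphere integral is the integral over the unit ball of the
  function made constant along rays.\<close>

lemma integral_sphere_measure:
  fixes V :: "'a::euclidean_space set"
  assumes V: "subspace V"
  obtains B where "orthonormal B" "span B = V"
    "\<And>f :: 'a \<Rightarrow> complex. f \<in> borel_measurable borel \<Longrightarrow>
      (\<integral>y. f y \<partial>sphere_measure V) = real (dim V) *\<^sub>R
        (\<integral>c. indicator {..<1} (L2_set c B) *\<^sub>R f (\<Sum>b\<in>B. (c b / L2_set c B) *\<^sub>R b) \<partial>prod_lborel B)"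
proof -
  define B where "B = (SOME B. pairwise orthogonal B \<and> (\<forall>b\<in>B. norm b = 1) \<and> span B = V)"
  have "pairwise orthogonal B \<and> (\<forall>b\<in>B. norm b = 1) \<and> span B = V"
    unfolding B_def by (rule someI_ex) (use ex_orthonormal_span[OF V] in \<open>auto simp: orthonormal_def\<close>)
  then have B: "orthonormal B" "span B = V"
    by (auto simp: orthonormal_def)
  note fin = orthonormal_finite[OF B(1)]
  let ?M = "prod_lborel B"
  let ?y = "\<lambda>c. \<Sum>b\<in>B. c b *\<^sub>R b"
  have y[measurable]: "?y \<in> ?M \<rightarrow>\<^sub>M borel"
    by measurable
  have sgn[measurable]: "(sgn :: 'a \<Rightarrow> 'a) \<in> borel_measurable borel"
    unfolding sgn_div_norm[abs_def] by measurable
  have sgn_y: "sgn (?y c) = (\<Sum>b\<in>B. (c b / L2_set c B) *\<^sub>R b)" for c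
    by (simp add: sgn_div_norm orthonormal_norm_sum[OF B(1)] scaleR_sum_right divide_inverse mult.commute)
  show ?thesis
  proof (rule that[OF B])
    fix f :: "'a \<Rightarrow> complex" assume f[measurable]: "f \<in> borel_measurable borel"
    let ?L = "span_lborel B"
    have L: "?L = distr ?M borel ?y"
      by (simp add: span_lborel_def)
    have sl: "subspace_lborel V = ?L"
      by (simp add: subspace_lborel_def B_def)
    have sgn': "sgn \<in> restrict_space ?L (ball 0 1) \<rightarrow>\<^sub>M borel"
      unfolding L by (rule measurable_restrict_space1) simp
    have "(\<integral>y. f y \<partial>sphere_measure V) = real (dim V) *\<^sub>R (\<integral>y. f y \<partial>distr (restrict_space ?L (ball 0
        1)) borel sgn)"
      unfolding sphere_measure_def scale_measure_eq_density sl
      by (subst integral_density) auto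
    also have "(\<integral>y. f y \<partial>distr (restrict_space ?L (ball 0 1)) borel sgn) = (\<integral>y. f (sgn y)
        \<partial>restrict_space ?L (ball 0 1))"
      by (rule integral_distr[OF sgn' f])
    also have "\<dots> = (\<integral>y. indicator (ball 0 1) y *\<^sub>R f (sgn y) \<partial>?L)"
      by (rule integral_restrict_space) (simp add: L)
    also have "\<dots> = (\<integral>c. indicator (ball 0 1) (?y c) *\<^sub>R f (sgn (?y c)) \<partial>?M)"
      unfolding L
      by (rule integral_distr[OF y]) (intro borel_measurable_scaleR borel_measurable_indicator
          measurable_compose[OF sgn f], simp)
    also have "\<dots> = (\<integral>c. indicator {..<1} (L2_set c B) *\<^sub>R f (\<Sum>b\<in>B. (c b / L2_set c B) *\<^sub>R b) \<partial>?M)"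
      by (simp add: sgn_y indicator_def orthonormal_norm_sum[OF B(1)])
    finally show "(\<integral>y. f y \<partial>sphere_measure V) = real (dim V) *\<^sub>R
        (\<integral>c. indicator {..<1} (L2_set c B) *\<^sub>R f (\<Sum>b\<in>B. (c b / L2_set c B) *\<^sub>R b) \<partial>?M)" .
  qed
qed

lemma sphere_average_eq:
  fixes V :: "'a::euclidean_space set"
  assumes V: "subspace V" "dim V > 0"
  obtains B where "orthonormal B" "span B = V"
    "\<And>a r and f :: 'a \<Rightarrow> complex. f \<in> borel_measurable borel \<Longrightarrow> sphere_average V a r f =
        (\<integral>c. indicator {..<1} (L2_set c B) *\<^sub>R f (a + r *\<^sub>R (\<Sum>b\<in>B. (c b / L2_set c B) *\<^sub>R b))
            \<partial>prod_lborel B)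
          / of_real (sphere_moment B (\<lambda>_. 0))"
proof -
  obtain B where B: "orthonormal B" "span B = V" and int: 
    "\<And>f :: 'a \<Rightarrow> complex. f \<in> borel_measurable borel \<Longrightarrow>
      (\<integral>y. f y \<partial>sphere_measure V) = real (dim V) *\<^sub>R
        (\<integral>c. indicator {..<1} (L2_set c B) *\<^sub>R f (\<Sum>b\<in>B. (c b / L2_set c B) *\<^sub>R b) \<partial>prod_lborel B)"
    using integral_sphere_measure[OF V(1)] by blast
  define D where "D = real (dim V)"
  have D: "D \<noteq> 0"
    using V(2) of_nat_0_less_iff[of "dim V"] unfolding D_def by (metis less_irrefl)
  note int = int[folded D_def]
  have "complex_of_real (measure (sphere_measure V) UNIV) = (\<integral>y. (1::complex) \<partial>sphere_measure V)"
  proof -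
    have "space (sphere_measure V) = UNIV"
      by (simp add: sphere_measure_def space_scale_measure)
    then show ?thesis
      by (simp add: scaleR_conv_of_real)
  qed
  also have "\<dots> = D *\<^sub>R complex_of_real (sphere_moment B (\<lambda>_. 0))"
    by (subst int) (simp_all add: sphere_moment_def monom_fun_def scaleR_conv_of_real flip:
        integral_complex_of_real)
  finally have m: "complex_of_real (measure (sphere_measure V) UNIV) = D *\<^sub>R complex_of_real
      (sphere_moment B (\<lambda>_. 0))" .
  show ?thesis
  proof (rule that[OF B])
    fix a r and f :: "'a \<Rightarrow> complex" assume f[measurable]: "f \<in> borel_measurable borel"
    show "sphere_average V a r f =
        (\<integral>c. indicator {..<1} (L2_set c B) *\<^sub>R f (a + r *\<^sub>R (\<Sum>b\<in>B. (c b / L2_set c B) *\<^sub>R b))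
            \<partial>prod_lborel B)
          / of_real (sphere_moment B (\<lambda>_. 0))"
      unfolding sphere_average_def m using D
      by (subst int) (auto simp: scaleR_conv_of_real)
  qed
qed

text \<open>With a list of coefficients and exponents, representations are added by concatenation,
  and repeated exponents do no harm.\<close>

definition monom_comb :: "'a set \<Rightarrow> (('a \<Rightarrow> real) \<Rightarrow> complex) \<Rightarrow> bool" where
  "monom_comb E f \<longleftrightarrow> (\<exists>xs. \<forall>c. f c = (\<Sum>(a, e)\<leftarrow>xs. a * of_real (monom_fun E e c)))"

lemma monom_comb_scaled_monom: "monom_comb E (\<lambda>c. a * of_real (monom_fun E e c))"
  unfolding monom_comb_def by (intro exI[of _ "[(a, e)]"]) simp

lemma monom_comb_add: "monom_comb E f \<Longrightarrow> monom_comb E g \<Longrightarrow> monom_comb E (\<lambda>c. f c + g c)"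
proof -
  assume "monom_comb E f" "monom_comb E g"
  then obtain xs ys where "\<forall>c. f c = (\<Sum>(a, e)\<leftarrow>xs. a * of_real (monom_fun E e c))"
    "\<forall>c. g c = (\<Sum>(a, e)\<leftarrow>ys. a * of_real (monom_fun E e c))"
    unfolding monom_comb_def by blast
  then show ?thesis
    unfolding monom_comb_def by (intro exI[of _ "xs @ ys"]) simp
qed

lemma monom_comb_const: "monom_comb E (\<lambda>c. a)"
  using monom_comb_scaled_monom[of E a "\<lambda>_. 0"] by (simp add: monom_fun_def)

lemma monom_comb_sum: "finite I \<Longrightarrow> (\<And>i. i \<in> I \<Longrightarrow> monom_comb E (f i)) \<Longrightarrow> monom_comb E (\<lambda>c. \<Sum>i\<in>I. f i c)"
  by (induction I rule: finite_induct) (auto intro: monom_comb_add monom_comb_const)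

lemma monom_fun_mult: "monom_fun E e c * monom_fun E e' c = monom_fun E (\<lambda>b. e b + e' b) c"
  by (simp add: monom_fun_def power_add prod.distrib)

lemma monom_comb_sum_list: "(\<And>x. x \<in> set xs \<Longrightarrow> monom_comb E (f x)) \<Longrightarrow> monom_comb E (\<lambda>c. \<Sum>x\<leftarrow>xs. f x c)"
  by (induction xs) (auto intro: monom_comb_add monom_comb_const)

lemma sum_list_product:
  fixes F :: "'x \<Rightarrow> complex"
  shows "(\<Sum>x\<leftarrow>xs. F x) * (\<Sum>y\<leftarrow>ys. G y) = (\<Sum>x\<leftarrow>xs. \<Sum>y\<leftarrow>ys. F x * G y)"
  by (induction xs) (simp_all add: distrib_right sum_list_const_mult)

lemma monom_comb_mult:
  assumes "monom_comb E f" "monom_comb E g"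
  shows "monom_comb E (\<lambda>c. f c * g c)"
proof -
  obtain xs ys where f: "\<And>c. f c = (\<Sum>(a, e)\<leftarrow>xs. a * of_real (monom_fun E e c))"
    and g: "\<And>c. g c = (\<Sum>(a, e)\<leftarrow>ys. a * of_real (monom_fun E e c))"
    using assms unfolding monom_comb_def by blast
  have "monom_comb E (\<lambda>c. \<Sum>x\<leftarrow>xs. \<Sum>y\<leftarrow>ys. (fst x * fst y) * of_real (monom_fun E (\<lambda>b. snd x b + snd y b) c))"
    by (intro monom_comb_sum_list monom_comb_scaled_monom)
  moreover have "f c * g c = (\<Sum>x\<leftarrow>xs. \<Sum>y\<leftarrow>ys. (fst x * fst y) * of_real (monom_fun E (\<lambda>b. snd x b +
      snd y b) c))" for c
    unfolding f g case_prod_beta monom_fun_mult[symmetric] sum_list_product by (simp add: mult_ac)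
  ultimately show ?thesis
    by simp
qed

lemma monom_comb_index:
  assumes "monom_comb E f"
  obtains N :: nat and a e where "\<And>c. f c = (\<Sum>i<N. a i * of_real (monom_fun E (e i) c))"
proof -
  obtain xs where xs: "\<And>c. f c = (\<Sum>(a, e)\<leftarrow>xs. a * of_real (monom_fun E e c))"
    using assms unfolding monom_comb_def by blast
  show ?thesis
    by (rule that[where N = "length xs" and a = "\<lambda>i. fst (xs ! i)" and e = "\<lambda>i. snd (xs ! i)"])
      (simp add: xs sum_list_sum_nth atLeast0LessThan case_prod_beta)
qed

lemma monom_comb_coordinate: "finite E \<Longrightarrow> b \<in> E \<Longrightarrow> monom_comb E (\<lambda>c. of_real (c b))"
proof -
  assume "finite E" "b \<in> E"
  then have "monom_fun E (\<lambda>i. if i = b then 1 else 0) c = c b" for c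
    by (simp add: monom_fun_def if_distrib cong: if_cong)
  then show ?thesis
    using monom_comb_scaled_monom[of E 1 "\<lambda>i. if i = b then 1 else 0"] by simp
qed

lemma monom_comb_real_polynomial:
  fixes E :: "'a::euclidean_space set"
  assumes "real_polynomial_function g" "finite E"
  shows "monom_comb E (\<lambda>c. of_real (g (\<Sum>b\<in>E. c b *\<^sub>R b)))"
  using assms(1)
proof (induction g rule: real_polynomial_function.induct)
  case (linear f)
  then interpret bounded_linear f .
  have "monom_comb E (\<lambda>c. \<Sum>b\<in>E. of_real (f b) * of_real (c b))"
    by (intro monom_comb_sum monom_comb_mult monom_comb_const monom_comb_coordinate assms(2))
  then show ?case
    by (simp add: sum scaleR mult.commute)
qed (auto intro: monom_comb_add monom_comb_mult monom_comb_const)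

lemma monom_comb_polynomial:
  fixes E :: "'a::euclidean_space set" and Y :: "'a \<Rightarrow> complex"
  assumes "polynomial_function Y" "finite E"
  shows "monom_comb E (\<lambda>c. Y (\<Sum>b\<in>E. c b *\<^sub>R b))"
proof -
  have "real_polynomial_function (Re \<circ> Y)" "real_polynomial_function (Im \<circ> Y)"
    using assms(1) bounded_linear_Re bounded_linear_Im unfolding polynomial_function_def by blast+
  from monom_comb_real_polynomial[OF this(1) assms(2)] monom_comb_real_polynomial[OF this(2) assms(2)]
  have "monom_comb E (\<lambda>c. of_real (Re (Y (\<Sum>b\<in>E. c b *\<^sub>R b))) + \<i> * of_real (Im (Y (\<Sum>b\<in>E. c b *\<^sub>R b))))"
    by (intro monom_comb_add monom_comb_mult monom_comb_const) (simp_all add: o_def)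
  then show ?thesis
    by (simp flip: complex_eq)
qed

text \<open>The second-order Taylor expansion along all lines through \<open>z\<close> at once.
  \<open>T v v\<close> is half the second derivative in direction \<open>v\<close>; the product rule
  leaves \<open>T\<close> unsymmetric, but only the diagonal enters the Laplacian.\<close>

lemma quadratic_part:
  fixes g :: "'a::euclidean_space \<Rightarrow> real"
  assumes "real_polynomial_function g"
  shows "\<exists>G T. linear G \<and> bilinear T \<and>
    (\<forall>v. \<exists>P. (\<forall>h. g (z + h *\<^sub>R v) = poly P h) \<and> coeff P 0 = g z \<and> coeff P 1 = G v \<and> coeff P 2 = T v v)"
  using assms
proof (induction g rule: real_polynomial_function.induct)
  case (linear f)
  then interpret bounded_linear f .
  show ?case
  proof (intro exI[of _ f] exI[of _ "\<lambda>_ _. 0"] conjI allI)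
    show "\<exists>P. (\<forall>h. f (z + h *\<^sub>R v) = poly P h) \<and> coeff P 0 = f z \<and> coeff P 1 = f v \<and> coeff P 2 = 0" for v
      by (intro exI[of _ "[:f z, f v:]"]) (auto simp: add scaleR coeff_pCons numeral_2_eq_2)
  qed (auto simp: bilinear_def linear_axioms intro: linearI)
next
  case (const c)
  show ?case
  proof (intro exI[of _ "\<lambda>_. 0"] exI[of _ "\<lambda>_ _. 0"] conjI allI)
    show "\<exists>P. (\<forall>h. c = poly P h) \<and> coeff P 0 = c \<and> coeff P 1 = 0 \<and> coeff P 2 = 0" 
      by (intro exI[of _ "[:c:]"]) (auto simp: coeff_pCons numeral_2_eq_2)
  qed (auto simp: bilinear_def intro: linearI)
next
  case (add f g)
  obtain F S where F: "linear F" "bilinear S"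
    "\<And>v. \<exists>P. (\<forall>h. f (z + h *\<^sub>R v) = poly P h) \<and> coeff P 0 = f z \<and> coeff P 1 = F v \<and> coeff P 2 = S v v"
    using add.IH(1) by blast
  obtain G T where G: "linear G" "bilinear T"
    "\<And>v. \<exists>P. (\<forall>h. g (z + h *\<^sub>R v) = poly P h) \<and> coeff P 0 = g z \<and> coeff P 1 = G v \<and> coeff P 2 = T v v"
    using add.IH(2) by blast
  show ?case
  proof (intro exI[of _ "\<lambda>v. F v + G v"] exI[of _ "\<lambda>v w. S v w + T v w"] conjI allI)
    fix v
    obtain P Q where "(\<forall>h. f (z + h *\<^sub>R v) = poly P h) \<and> coeff P 0 = f z \<and> coeff P 1 = F v \<and> coeff P
        2 = S v v"
      "(\<forall>h. g (z + h *\<^sub>R v) = poly Q h) \<and> coeff Q 0 = g z \<and> coeff Q 1 = G v \<and> coeff Q 2 = T v v"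
      using F(3) G(3) by meson
    then show "\<exists>P. (\<forall>h. f (z + h *\<^sub>R v) + g (z + h *\<^sub>R v) = poly P h) \<and> coeff P 0 = f z + g z \<and>
        coeff P 1 = F v + G v \<and> coeff P 2 = S v v + T v v"
      by (intro exI[of _ "P + Q"]) simp
  next
    show "linear (\<lambda>v. F v + G v)"
      by (rule linear_compose_add[OF F(1) G(1)])
    show "bilinear (\<lambda>v w. S v w + T v w)"
      using F(2) G(2) by (auto simp: bilinear_def intro: linear_compose_add)
  qed
next
  case (mult f g)
  obtain F S where F: "linear F" "bilinear S"
    "\<And>v. \<exists>P. (\<forall>h. f (z + h *\<^sub>R v) = poly P h) \<and> coeff P 0 = f z \<and> coeff P 1 = F v \<and> coeff P 2 = S v v"
    using mult.IH(1) by blast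
  obtain G T where G: "linear G" "bilinear T"
    "\<And>v. \<exists>P. (\<forall>h. g (z + h *\<^sub>R v) = poly P h) \<and> coeff P 0 = g z \<and> coeff P 1 = G v \<and> coeff P 2 = T v v"
    using mult.IH(2) by blast
  have lm: "linear (\<lambda>v. L v * k)" "linear (\<lambda>v. k * L v)" if "linear L" for L :: "'a \<Rightarrow> real" and k
    using that linear_compose_scale_right[OF that, of k] by (auto simp: mult.commute)
  show ?case
  proof (intro exI[of _ "\<lambda>v. f z * G v + F v * g z"] exI[of _ "\<lambda>v w. f z * T v w + (F v * G w + S v
      w * g z)"] conjI allI)
    fix v
    obtain P Q where PQ: "(\<forall>h. f (z + h *\<^sub>R v) = poly P h) \<and> coeff P 0 = f z \<and> coeff P 1 = F v \<and>
        coeff P 2 = S v v"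
      "(\<forall>h. g (z + h *\<^sub>R v) = poly Q h) \<and> coeff Q 0 = g z \<and> coeff Q 1 = G v \<and> coeff Q 2 = T v v"
      using F(3) G(3) by meson
    then show "\<exists>P. (\<forall>h. f (z + h *\<^sub>R v) * g (z + h *\<^sub>R v) = poly P h) \<and> coeff P 0 = f z * g z \<and>
        coeff P 1 = f z * G v + F v * g z \<and> coeff P 2 = f z * T v v + (F v * G v + S v v * g z)"
      by (intro exI[of _ "P * Q"]) (auto simp: coeff_mult numeral_2_eq_2)
  next
    show "linear (\<lambda>v. f z * G v + F v * g z)"
      by (intro linear_compose_add lm F G)
    show "bilinear (\<lambda>v w. f z * T v w + (F v * G w + S v w * g z))"
      using F(2) G(2) unfolding bilinear_def by (auto intro!: linear_compose_add lm F(1) G(1))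
  qed
qed

text \<open>The trace does not depend on the orthonormal basis: expand in \<open>Basis\<close> and
  apply Parseval to the coefficients.\<close>

lemma bilinear_trace:
  fixes T :: "'a::euclidean_space \<Rightarrow> 'a \<Rightarrow> real"
  assumes E: "orthonormal E" "span E = UNIV" and T: "bilinear T"
  shows "(\<Sum>b\<in>E. T b b) = (\<Sum>b\<in>Basis. T b b)"
proof -
  have exp: "T b b = (\<Sum>(i, j)\<in>Basis \<times> Basis. (b \<bullet> i) * (b \<bullet> j) * T i j)" for b
  proof -
    have "T b b = T (\<Sum>i\<in>Basis. (b \<bullet> i) *\<^sub>R i) (\<Sum>j\<in>Basis. (b \<bullet> j) *\<^sub>R j)"
      by (simp add: euclidean_representation)
    also have "\<dots> = (\<Sum>(i, j)\<in>Basis \<times> Basis. T ((b \<bullet> i) *\<^sub>R i) ((b \<bullet> j) *\<^sub>R j))"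
      by (rule bilinear_sum[OF T])
    also have "\<dots> = (\<Sum>(i, j)\<in>Basis \<times> Basis. (b \<bullet> i) * (b \<bullet> j) * T i j)"
      by (simp add: bilinear_lmul[OF T] bilinear_rmul[OF T] mult_ac)
    finally show ?thesis .
  qed
  have parseval: "(\<Sum>b\<in>E. (b \<bullet> i) * (b \<bullet> j)) = i \<bullet> j" for i j
  proof -
    have "i = (\<Sum>b\<in>E. (i \<bullet> b) *\<^sub>R b)"
      by (rule orthonormal_expand) (use E in auto)
    then have "i \<bullet> j = (\<Sum>b\<in>E. (i \<bullet> b) *\<^sub>R b) \<bullet> j"
      by simp
    also have "\<dots> = (\<Sum>b\<in>E. (i \<bullet> b) * (b \<bullet> j))"
      by (simp add: inner_sum_left)
    finally show ?thesis
      by (simp add: inner_commute[of i])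
  qed
  have "(\<Sum>b\<in>E. T b b) = (\<Sum>(i, j)\<in>Basis \<times> Basis. (\<Sum>b\<in>E. (b \<bullet> i) * (b \<bullet> j)) * T i j)"
    unfolding exp by (subst sum.swap) (simp add: case_prod_beta sum_distrib_right)
  also have "\<dots> = (\<Sum>i\<in>Basis. \<Sum>j\<in>Basis. (if i = j then 1 else 0) * T i j)"
    unfolding parseval by (simp add: sum.cartesian_product[symmetric] inner_Basis)
  also have "\<dots> = (\<Sum>b\<in>Basis. T b b)"
    by (intro sum.cong refl) (simp add: if_distrib[of "\<lambda>x. x * _"] cong: if_cong)
  finally show ?thesis .
qed

lemma vderiv2_poly:
  assumes "\<And>h. f h = of_real (poly P h) + \<i> * of_real (poly Q h)"
  shows "(vderiv ^^ 2) f 0 = 2 * (of_real (coeff P 2) + \<i> * of_real (coeff Q 2))"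
proof -
  have vd: "vderiv (\<lambda>h. of_real (poly P h) + \<i> * of_real (poly Q h)) =
      (\<lambda>h. of_real (poly (pderiv P) h) + \<i> * of_real (poly (pderiv Q) h))" for P Q :: "real poly"
    by (intro ext vderiv_eqI has_vector_derivative_add has_vector_derivative_mult_right
        has_vector_derivative_of_real poly_DERIV)
  have "f = (\<lambda>h. of_real (poly P h) + \<i> * of_real (poly Q h))"
    using assms by auto
  then have "(vderiv ^^ 2) f = (\<lambda>h. of_real (poly (pderiv (pderiv P)) h) + \<i> * of_real (poly (pderiv
      (pderiv Q)) h))"
    by (simp add: numeral_2_eq_2 vd)
  then show ?thesis
    by (simp add: poly_0_coeff_0 coeff_pderiv numeral_2_eq_2 algebra_simps)
qed

text \<open>Permits replacing the standard basis by one that contains \<open>x\<close> and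
  \<open>\<i> *s x\<close> and is otherwise orthogonal to their span.\<close>

lemma laplacian_orthonormal:
  fixes Y :: "'a::euclidean_space \<Rightarrow> complex"
  assumes Y: "polynomial_function Y" and E: "orthonormal E" "span E = UNIV"
  shows "laplacian Y z = (\<Sum>b\<in>E. (vderiv ^^ 2) (\<lambda>h. Y (z + h *\<^sub>R b)) 0)"
proof -
  have "real_polynomial_function (Re \<circ> Y)" "real_polynomial_function (Im \<circ> Y)"
    using Y bounded_linear_Re bounded_linear_Im unfolding polynomial_function_def by blast+
  from quadratic_part[OF this(1), of z] quadratic_part[OF this(2), of z]
  obtain S T where S: "bilinear S" 
      "\<And>v. \<exists>P. (\<forall>h. Re (Y (z + h *\<^sub>R v)) = poly P h) \<and> coeff P 2 = S v v"
    and T: "bilinear T" "\<And>v. \<exists>P. (\<forall>h. Im (Y (z + h *\<^sub>R v)) = poly P h) \<and> coeff P 2 = T v v"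
    by (auto simp: o_def) (meson+)
  have "(vderiv ^^ 2) (\<lambda>h. Y (z + h *\<^sub>R v)) 0 = 2 * (of_real (S v v) + \<i> * of_real (T v v))" for v
  proof -
    obtain P Q where "\<forall>h. Re (Y (z + h *\<^sub>R v)) = poly P h" "coeff P 2 = S v v"
      "\<forall>h. Im (Y (z + h *\<^sub>R v)) = poly Q h" "coeff Q 2 = T v v"
      using S(2) T(2) by meson
    then show ?thesis
      using vderiv2_poly[of "\<lambda>h. Y (z + h *\<^sub>R v)" P Q] by (simp add: complex_eq_iff)
  qed
  then have "(\<Sum>b\<in>B. (vderiv ^^ 2) (\<lambda>h. Y (z + h *\<^sub>R b)) 0) = 2 * (of_real (\<Sum>b\<in>B. S b b) + \<i> *
      of_real (\<Sum>b\<in>B. T b b))" for B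
    by (simp add: sum.distrib flip: sum_distrib_left)
  then show ?thesis
    unfolding laplacian_def by (simp only: bilinear_trace[OF E S(1)] bilinear_trace[OF E T(1)])
qed

lemma sphere_moment_comb:
  assumes B: "finite B" and A: "finite A"
  shows "(\<integral>c. indicator {..<1} (L2_set c B) *\<^sub>R (\<Sum>i\<in>A. \<alpha> i * of_real (monom_fun B (f i) (\<lambda>b. c b /
      L2_set c B))) \<partial>prod_lborel B)
    = (\<Sum>i\<in>A. \<alpha> i * complex_of_real (sphere_moment B (f i)))"
proof -
  let ?g = "\<lambda>i c. indicator {..<1} (L2_set c B) * monom_fun B (f i) (\<lambda>b. c b / L2_set c B)"
  have int: "integrable (prod_lborel B) (?g i)" for i
    using sphere_moment_integrable[OF B, of "\<lambda>x. x" 1 "f i"] by simp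
  have "(\<integral>c. indicator {..<1} (L2_set c B) *\<^sub>R (\<Sum>i\<in>A. \<alpha> i * of_real (monom_fun B (f i) (\<lambda>b. c b /
      L2_set c B))) \<partial>prod_lborel B)
    = (\<integral>c. (\<Sum>i\<in>A. \<alpha> i * complex_of_real (?g i c)) \<partial>prod_lborel B)"
    by (simp add: scaleR_conv_of_real sum_distrib_left mult_ac)
  also have "\<dots> = (\<Sum>i\<in>A. \<integral>c. \<alpha> i * complex_of_real (?g i c) \<partial>prod_lborel B)"
    by (intro Bochner_Integration.integral_sum integrable_mult_right integrable_of_real int)
  also have "\<dots> = (\<Sum>i\<in>A. \<alpha> i * complex_of_real (sphere_moment B (f i)))"
    unfolding sphere_moment_def by (simp only: integral_mult_right_zero integral_complex_of_real)
  finally show ?thesis .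
qed

lemma sphere_moment_cong: "(\<And>b. b \<in> B \<Longrightarrow> e b = e' b) \<Longrightarrow> sphere_moment B e = sphere_moment B e'"
  unfolding sphere_moment_def monom_fun_def by (simp cong: prod.cong)

subsection \<open>Averages of harmonic polynomials\<close>

definition join :: "'a \<Rightarrow> 'a \<Rightarrow> real \<Rightarrow> real \<Rightarrow> real \<Rightarrow> ('a \<Rightarrow> real) \<Rightarrow> 'a \<Rightarrow> real" where
  "join u v s t r c = (\<lambda>b. if b = u then s else if b = v then t else r * c b)"

lemma monom_fun_join:
  assumes "finite B" "u \<noteq> v" "u \<notin> B" "v \<notin> B"
  shows "monom_fun (insert u (insert v B)) e (join u v s t r c) = s ^ e u * t ^ e v * r ^ sum e B *
      monom_fun B e c"
proof -
  have "monom_fun B e (join u v s t r c) = (\<Prod>b\<in>B. r ^ e b * c b ^ e b)"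
    unfolding monom_fun_def by (intro prod.cong) (use assms in \<open>auto simp: join_def power_mult_distrib\<close>)
  also have "\<dots> = r ^ sum e B * monom_fun B e c"
    by (simp add: prod.distrib monom_fun_def power_sum)
  finally have "monom_fun B e (join u v s t r c) = r ^ sum e B * monom_fun B e c" .
  then show ?thesis
    using assms by (simp add: monom_fun_def join_def)
qed

text \<open>In coordinates \<open>z, w\<close> along \<open>u, v\<close>: the spherical mean over the directions \<open>B\<close> of the part of degree
  \<open>k\<close> in \<open>B\<close> of the polynomial \<open>\<Sum>i<N. a i * monom_fun _ (e i)\<close>, and its Laplacian in \<open>z, w\<close>.\<close>

definition mean_part :: "nat \<Rightarrow> (nat \<Rightarrow> complex) \<Rightarrow> (nat \<Rightarrow> 'a \<Rightarrow> nat) \<Rightarrow> 'a set \<Rightarrow> 'a \<Rightarrow> 'a \<Rightarrow> nat \<Rightarrow> complex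
    \<Rightarrow> complex \<Rightarrow> complex" where
  "mean_part N a e B u v k z w =
     (\<Sum>i<N. (if sum (e i) B = k then a i * of_real (sphere_moment B (e i)) else 0) * (z ^ e i u * w
         ^ e i v))"

definition lap_part :: "nat \<Rightarrow> (nat \<Rightarrow> complex) \<Rightarrow> (nat \<Rightarrow> 'a \<Rightarrow> nat) \<Rightarrow> 'a set \<Rightarrow> 'a \<Rightarrow> 'a \<Rightarrow> nat \<Rightarrow> complex
    \<Rightarrow> complex \<Rightarrow> complex" where
  "lap_part N a e B u v k z w =
     (\<Sum>i<N. (if sum (e i) B = k then a i * of_real (sphere_moment B (e i)) else 0) *
        (of_nat (e i u) * (of_nat (e i u - 1) * z ^ (e i u - 2)) * w ^ e i v +
         z ^ e i u * (of_nat (e i v) * (of_nat (e i v - 1) * w ^ (e i v - 2)))))"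

text \<open>
  Averaging the Laplace equation over spheres of radius \<open>r\<close> in the span of \<open>B\<close> and comparing the
  coefficients of the powers of \<open>r\<close>.
\<close>

lemma lap_mean_part:
  fixes a :: "nat \<Rightarrow> complex"
  assumes B: "finite B" "card B = d" "d > 0" and uv: "u \<noteq> v" "u \<notin> B" "v \<notin> B"
    and lap: "\<And>c. (\<Sum>b\<in>insert u (insert v B). \<Sum>i<N. a i * of_real (real (e i b) * real (e i b - 1) *
        monom_fun (insert u (insert v B)) ((e i)(b := e i b - 2)) c)) = 0"
  shows "lap_part N a e B u v k (of_real s) (of_real t) +
    of_nat (k + 2) * of_nat (k + d) * mean_part N a e B u v (k + 2) (of_real s) (of_real t) = 0"
proof -
  let ?E = "insert u (insert v B)"
  define f where "f = (\<lambda>(b, i). (e i)(b := e i b - 2))"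
  define m where "m = (\<lambda>(b, i). a i * of_real (real (e i b) * real (e i b - 1)))"
  \<comment> \<open>The Laplace equation at the point with coordinates \<open>s\<close>,
    \<open>t\<close> and \<open>r c\<close>, averaged over the directions \<open>c\<close> in the
    span of \<open>B\<close>.\<close>
  have zero: "(\<Sum>x\<in>?E \<times> {..<N}. m x * of_real (s ^ f x u * t ^ f x v * r ^ sum (f x) B) * of_real
      (sphere_moment B (f x))) = 0" for r
  proof -
    have "(\<Sum>x\<in>?E \<times> {..<N}. m x * of_real (s ^ f x u * t ^ f x v * r ^ sum (f x) B) * complex_of_real
        (monom_fun B (f x) c)) = 0" for c
    proof -
      have "(\<Sum>x\<in>?E \<times> {..<N}. m x * of_real (monom_fun ?E (f x) (join u v s t r c))) = 0"
        using lap[of "join u v s t r c"] unfolding sum.cartesian_product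
        by (simp add: case_prod_beta m_def f_def mult.assoc)
      then show ?thesis
        by (simp add: monom_fun_join[OF B(1) uv] mult.assoc)
    qed
    then have "(\<integral>c. indicator {..<1} (L2_set c B) *\<^sub>R (\<Sum>x\<in>?E \<times> {..<N}.
        m x * of_real (s ^ f x u * t ^ f x v * r ^ sum (f x) B) * complex_of_real (monom_fun B (f x)
            (\<lambda>b. c b / L2_set c B))) \<partial>prod_lborel B) = 0"
      by simp
    then show ?thesis
      by (subst (asm) sphere_moment_comb) (use B in auto)
  qed
  define I where "I i = complex_of_real (sphere_moment B (e i))" for i
  define h where "h i = sum (e i) B" for i
  define W where "W i = (\<Sum>b\<in>B. real (e i b) * real (e i b - 1) * sphere_moment B ((e i)(b := e i b -
      2)))" for i
  define Z where "Z i = complex_of_real s ^ e i u * of_real t ^ e i v" for i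
  define LZ where "LZ i = of_nat (e i u) * (of_nat (e i u - 1) * complex_of_real s ^ (e i u - 2)) *
      of_real t ^ e i v +
         of_real s ^ e i u * (of_nat (e i v) * (of_nat (e i v - 1) * of_real t ^ (e i v - 2)))" for i
  have W: "W i = real (h i) * (real (h i) + real d - 2) * sphere_moment B (e i)" for i
    unfolding W_def using sphere_moment_laplace[OF B, of "e i" "h i"] by (simp add: h_def)
  \<comment> \<open>For k = 0 the condition \<open>h i - 2 = k\<close> also admits degrees below 2;
    their terms drop out here.\<close>
  have W0: "W i = 0" if "h i < 2" for i
  proof -
    have "e i b \<le> 1" if "b \<in> B" for b
      using member_le_sum[OF that, of "e i"] \<open>h i < 2\<close> B(1) by (simp add: h_def)
    then show ?thesis
      unfolding W_def by (intro sum.neutral) force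
  qed
  \<comment> \<open>The averaged equation as a polynomial in \<open>r\<close>. Derivatives along
    \<open>u\<close> and \<open>v\<close> keep the degree in \<open>B\<close>, derivatives in
    \<open>B\<close> lower it by 2, so the coefficient of r^k links the parts of degree k and k + 2.
    The factor is h (h + d - 2) at h = k + 2.\<close>
  define P where "P = (\<Sum>i<N. Polynomial.monom (a i * I i * LZ i) (h i)) + (\<Sum>i<N. Polynomial.monom (a
      i * Z i * of_real (W i)) (h i - 2))"
  have "poly P (of_real r) = 0" for r
  proof -
    have tu: "m (u, i) * of_real (s ^ f (u, i) u * t ^ f (u, i) v * r ^ sum (f (u, i)) B) * of_real
        (sphere_moment B (f (u, i))) =
        a i * I i * (of_nat (e i u) * (of_nat (e i u - 1) * of_real s ^ (e i u - 2)) * of_real t ^ e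
            i v) * of_real r ^ h i" for i
    proof -
      have "sphere_moment B (f (u, i)) = sphere_moment B (e i)" "sum (f (u, i)) B = sum (e i) B"
        by (intro sphere_moment_cong sum.cong; use uv in \<open>auto simp: f_def\<close>)+
      then show ?thesis
        using uv by (simp add: m_def f_def I_def h_def mult_ac)
    qed
    have tv: "m (v, i) * of_real (s ^ f (v, i) u * t ^ f (v, i) v * r ^ sum (f (v, i)) B) * of_real
        (sphere_moment B (f (v, i))) =
        a i * I i * (of_real s ^ e i u * (of_nat (e i v) * (of_nat (e i v - 1) * of_real t ^ (e i v
            - 2)))) * of_real r ^ h i" for i
    proof -
      have "sphere_moment B (f (v, i)) = sphere_moment B (e i)" "sum (f (v, i)) B = sum (e i) B"
        by (intro sphere_moment_cong sum.cong; use uv in \<open>auto simp: f_def\<close>)+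
      then show ?thesis
        using uv by (simp add: m_def f_def I_def h_def mult_ac)
    qed
    have tb: "m (b, i) * of_real (s ^ f (b, i) u * t ^ f (b, i) v * r ^ sum (f (b, i)) B) * of_real
        (sphere_moment B (f (b, i))) =
        a i * Z i * of_real r ^ (h i - 2) * of_real (real (e i b) * real (e i b - 1) * sphere_moment
            B ((e i)(b := e i b - 2)))"
      if b: "b \<in> B" for b i
    proof (cases "e i b \<ge> 2")
      case True
      have "h i = e i b + sum (e i) (B - {b})"
        unfolding h_def using b B(1) by (rule sum.remove[rotated])
      moreover have "sum (f (b, i)) B = f (b, i) b + sum (f (b, i)) (B - {b})"
        using b B(1) by (rule sum.remove[rotated])
      moreover have "sum (f (b, i)) (B - {b}) = sum (e i) (B - {b})"
        by (rule sum.cong) (auto simp: f_def)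
      ultimately have "sum (f (b, i)) B = h i - 2"
        using True by (simp add: f_def)
      moreover have "f (b, i) u = e i u" "f (b, i) v = e i v"
        using uv b by (auto simp: f_def)
      ultimately show ?thesis
        by (simp add: m_def Z_def f_def mult_ac)
    next
      case False
      then have "e i b = 0 \<or> e i b = 1"
        by auto
      then show ?thesis
        by (auto simp: m_def)
    qed
    have "0 = (\<Sum>b\<in>?E. \<Sum>i<N. m (b, i) * of_real (s ^ f (b, i) u * t ^ f (b, i) v * r ^ sum (f (b, i))
        B) * of_real (sphere_moment B (f (b, i))))"
      using zero[of r] by (simp only: sum.cartesian_product) (simp add: case_prod_beta)
    also have "\<dots> = (\<Sum>i<N. a i * I i * (of_nat (e i u) * (of_nat (e i u - 1) * of_real s ^ (e i u -
        2)) * of_real t ^ e i v) * of_real r ^ h i)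
      + ((\<Sum>i<N. a i * I i * (of_real s ^ e i u * (of_nat (e i v) * (of_nat (e i v - 1) * of_real t ^
          (e i v - 2)))) * of_real r ^ h i)
      + (\<Sum>b\<in>B. \<Sum>i<N. a i * Z i * of_real r ^ (h i - 2) * of_real (real (e i b) * real (e i b - 1) *
          sphere_moment B ((e i)(b := e i b - 2)))))"
      using B(1) uv by (simp only: sum.insert finite_insert insert_iff simp_thms tu tv) (intro
          arg_cong2[of _ _ _ _ "(+)"] refl sum.cong tb)
    also have "(\<Sum>b\<in>B. \<Sum>i<N. a i * Z i * of_real r ^ (h i - 2) * complex_of_real (real (e i b) * real
        (e i b - 1) * sphere_moment B ((e i)(b := e i b - 2)))) =
        (\<Sum>i<N. a i * Z i * of_real (W i) * of_real r ^ (h i - 2))"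
      by (subst sum.swap) (simp add: W_def sum_distrib_left sum_distrib_right mult_ac)
    finally show ?thesis
      by (simp add: P_def poly_sum poly_monom LZ_def algebra_simps sum.distrib)
  qed
  then have "range complex_of_real \<subseteq> {z. poly P z = 0}"
    by auto
  then have "infinite {z. poly P z = 0}"
    using infinite_UNIV_char_0[where ?'a = real] finite_imageD[of complex_of_real UNIV]
        finite_subset inj_of_real by blast
  then have "P = 0"
    using poly_roots_finite by blast
  then have "coeff P k = 0"
    by simp
  then have "(\<Sum>i<N. if h i = k then a i * I i * LZ i else 0) + (\<Sum>i<N. if h i - 2 = k then a i * Z i
      * of_real (W i) else 0) = 0"
    by (simp add: P_def coeff_sum)
  moreover have "(\<Sum>i<N. if h i = k then a i * I i * LZ i else 0) = lap_part N a e B u v k (of_real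
      s) (of_real t)"
    unfolding lap_part_def by (intro sum.cong) (auto simp: h_def I_def LZ_def)
  moreover have "(\<Sum>i<N. if h i - 2 = k then a i * Z i * of_real (W i) else 0) =
      of_nat (k + 2) * of_nat (k + d) * mean_part N a e B u v (k + 2) (of_real s) (of_real t)"
    unfolding mean_part_def sum_distrib_left
  proof (rule sum.cong)
    fix i
    show "(if h i - 2 = k then a i * Z i * complex_of_real (W i) else 0) = of_nat (k + 2) * of_nat (k + d) *
       ((if sum (e i) B = k + 2 then a i * of_real (sphere_moment B (e i)) else 0) * (of_real s ^ e
           i u * of_real t ^ e i v))"
    proof (cases "h i = k + 2")
      case True
      have "complex_of_real (W i) = of_nat (k + 2) * of_nat (k + d) * of_real (sphere_moment B (e i))"
        unfolding W True by simp
      then show ?thesis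
        using True by (simp add: Z_def flip: h_def)
    next
      case False
      then show ?thesis
        using W0[of i] by (auto simp flip: h_def)
    qed
  qed simp
  ultimately show ?thesis
    by simp
qed

text \<open>The closed formulas are known at real coordinates only. Since the derivative of an
  entire function on the real line is determined by its values there, they may be differentiated in
  each coordinate.\<close>

lemma real_deriv_unique:
  assumes "\<And>z. (F has_field_derivative F' z) (at z)" "\<And>z. (G has_field_derivative G' z) (at z)"
    and "\<And>x. F (complex_of_real x) = G (of_real x)"
  shows "F' (of_real x) = G' (of_real x)"
proof (rule vector_derivative_unique_at)
  show "((\<lambda>x. F (of_real x)) has_vector_derivative F' (of_real x)) (at x)"
    by (rule has_vector_derivative_real_field[OF assms(1)])
  show "((\<lambda>x. F (of_real x)) has_vector_derivative G' (of_real x)) (at x)"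
    unfolding assms(3) by (rule has_vector_derivative_real_field[OF assms(2)])
qed

text \<open>In the variable \<zeta> = s + i t the Laplacian is 4 times the mixed derivative in
  \<zeta> and its conjugate: the pure second derivatives of the two directions cancel and the mixed
  ones add up.\<close>

lemma lap_part_eq:
  assumes eq: "\<And>s t. mean_part N a e B u v k (of_real s) (of_real t) =
      C * (of_real s + \<i> * of_real t) ^ p * (of_real s - \<i> * of_real t) ^ q"
  shows "lap_part N a e B u v k (of_real s) (of_real t) =
      4 * C * of_nat p * of_nat q * (of_real s + \<i> * of_real t) ^ (p - 1) * (of_real s - \<i> * of_real
          t) ^ (q - 1)"
proof -
  define \<mu> where "\<mu> i = (if sum (e i) B = k then a i * of_real (sphere_moment B (e i)) else 0)" for i
  let ?T = "complex_of_real t" and ?S = "complex_of_real s"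
  have u1: "(\<Sum>i<N. \<mu> i * (of_nat (e i u) * (of_real s ^ (e i u - 1) * ?T ^ e i v))) =
    C * (of_nat p * (of_real s + \<i> * ?T) ^ (p - 1) * (of_real s - \<i> * ?T) ^ q + of_nat q * (of_real
        s + \<i> * ?T) ^ p * (of_real s - \<i> * ?T) ^ (q - 1))" for s
    by (rule real_deriv_unique[where F = "\<lambda>z. \<Sum>i<N. \<mu> i * (z ^ e i u * ?T ^ e i v)" and G = "\<lambda>z. C *
        (z + \<i> * ?T) ^ p * (z - \<i> * ?T) ^ q"
        and F' = "\<lambda>z. \<Sum>i<N. \<mu> i * (of_nat (e i u) * (z ^ (e i u - 1) * ?T ^ e i v))"
        and G' = "\<lambda>z. C * (of_nat p * (z + \<i> * ?T) ^ (p - 1) * (z - \<i> * ?T) ^ q + of_nat q * (z + \<i>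
            * ?T) ^ p * (z - \<i> * ?T) ^ (q - 1))"])
      (use eq[of _ t] in \<open>auto intro!: derivative_eq_intros sum.cong simp: mean_part_def
          \<mu>_def[symmetric] algebra_simps\<close>)
  have u2: "(\<Sum>i<N. \<mu> i * (of_nat (e i u) * (of_nat (e i u - 1) * ?S ^ (e i u - 2) * ?T ^ e i v))) =
    C * (of_nat p * of_nat (p - 1) * (?S + \<i> * ?T) ^ (p - 2) * (?S - \<i> * ?T) ^ q
       + 2 * of_nat p * of_nat q * (?S + \<i> * ?T) ^ (p - 1) * (?S - \<i> * ?T) ^ (q - 1)
       + of_nat q * of_nat (q - 1) * (?S + \<i> * ?T) ^ p * (?S - \<i> * ?T) ^ (q - 2))"
    by (rule real_deriv_unique[where F = "\<lambda>z. \<Sum>i<N. \<mu> i * (of_nat (e i u) * (z ^ (e i u - 1) * ?T ^ e i v))"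
        and G = "\<lambda>z. C * (of_nat p * (z + \<i> * ?T) ^ (p - 1) * (z - \<i> * ?T) ^ q + of_nat q * (z + \<i> *
            ?T) ^ p * (z - \<i> * ?T) ^ (q - 1))"
        and F' = "\<lambda>z. \<Sum>i<N. \<mu> i * (of_nat (e i u) * (of_nat (e i u - 1) * z ^ (e i u - 2) * ?T ^ e i v))"
        and G' = "\<lambda>z. C * (of_nat p * of_nat (p - 1) * (z + \<i> * ?T) ^ (p - 2) * (z - \<i> * ?T) ^ q
           + 2 * of_nat p * of_nat q * (z + \<i> * ?T) ^ (p - 1) * (z - \<i> * ?T) ^ (q - 1)
           + of_nat q * of_nat (q - 1) * (z + \<i> * ?T) ^ p * (z - \<i> * ?T) ^ (q - 2))"])
      (use u1 in \<open>auto intro!: derivative_eq_intros sum.cong simp: algebra_simps numeral_2_eq_2\<close>)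
  have v1: "(\<Sum>i<N. \<mu> i * (of_nat (e i v) * (?S ^ e i u * of_real t ^ (e i v - 1)))) =
    C * \<i> * (of_nat p * (?S + \<i> * of_real t) ^ (p - 1) * (?S - \<i> * of_real t) ^ q - of_nat q * (?S +
        \<i> * of_real t) ^ p * (?S - \<i> * of_real t) ^ (q - 1))" for t
    by (rule real_deriv_unique[where F = "\<lambda>z. \<Sum>i<N. \<mu> i * (?S ^ e i u * z ^ e i v)" and G = "\<lambda>z. C *
        (?S + \<i> * z) ^ p * (?S - \<i> * z) ^ q"
        and F' = "\<lambda>z. \<Sum>i<N. \<mu> i * (of_nat (e i v) * (?S ^ e i u * z ^ (e i v - 1)))"
        and G' = "\<lambda>z. C * \<i> * (of_nat p * (?S + \<i> * z) ^ (p - 1) * (?S - \<i> * z) ^ q - of_nat q * (?S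
            + \<i> * z) ^ p * (?S - \<i> * z) ^ (q - 1))"])
      (use eq[of s] in \<open>auto intro!: derivative_eq_intros sum.cong simp: mean_part_def
          \<mu>_def[symmetric] algebra_simps\<close>)
  have v2: "(\<Sum>i<N. \<mu> i * (of_nat (e i v) * (?S ^ e i u * (of_nat (e i v - 1) * ?T ^ (e i v - 2))))) =
    C * (- (of_nat p * of_nat (p - 1) * (?S + \<i> * ?T) ^ (p - 2) * (?S - \<i> * ?T) ^ q)
       + 2 * of_nat p * of_nat q * (?S + \<i> * ?T) ^ (p - 1) * (?S - \<i> * ?T) ^ (q - 1)
       - of_nat q * of_nat (q - 1) * (?S + \<i> * ?T) ^ p * (?S - \<i> * ?T) ^ (q - 2))"
    by (rule real_deriv_unique[where F = "\<lambda>z. \<Sum>i<N. \<mu> i * (of_nat (e i v) * (?S ^ e i u * z ^ (e i v - 1)))"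
        and G = "\<lambda>z. C * \<i> * (of_nat p * (?S + \<i> * z) ^ (p - 1) * (?S - \<i> * z) ^ q - of_nat q * (?S
            + \<i> * z) ^ p * (?S - \<i> * z) ^ (q - 1))"
        and F' = "\<lambda>z. \<Sum>i<N. \<mu> i * (of_nat (e i v) * (?S ^ e i u * (of_nat (e i v - 1) * z ^ (e i v - 2))))"
        and G' = "\<lambda>z. C * (- (of_nat p * of_nat (p - 1) * (?S + \<i> * z) ^ (p - 2) * (?S - \<i> * z) ^ q)
           + 2 * of_nat p * of_nat q * (?S + \<i> * z) ^ (p - 1) * (?S - \<i> * z) ^ (q - 1)
           - of_nat q * of_nat (q - 1) * (?S + \<i> * z) ^ p * (?S - \<i> * z) ^ (q - 2))"])
      (use v1 in \<open>auto intro!: derivative_eq_intros sum.cong simp: algebra_simps numeral_2_eq_2\<close>)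
  have "lap_part N a e B u v k ?S ?T =
      (\<Sum>i<N. \<mu> i * (of_nat (e i u) * (of_nat (e i u - 1) * ?S ^ (e i u - 2) * ?T ^ e i v))) +
      (\<Sum>i<N. \<mu> i * (of_nat (e i v) * (?S ^ e i u * (of_nat (e i v - 1) * ?T ^ (e i v - 2)))))"
    unfolding lap_part_def \<mu>_def[symmetric] by (simp add: algebra_simps flip: sum.distrib)
  then show ?thesis
    unfolding u2 v2 by (simp add: algebra_simps)
qed

text \<open>One factor for each step from degree 2 j to 2 j + 2: the Laplacian contributes 4 (p - j)
  (q - j), and the averaged equation divides by (2 j + 2) (2 j + d) = 4 (j + 1) (n - 1 + j), where d
  = 2 n - 2.\<close>

definition mean_coeff :: "nat \<Rightarrow> nat \<Rightarrow> nat \<Rightarrow> nat \<Rightarrow> real" where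
  "mean_coeff n p q k = (\<Prod>j<k. - (real (p - j) * real (q - j) / (real (j + 1) * real (n - 1 + j))))"

lemma mean_part_closed:
  fixes a :: "nat \<Rightarrow> complex"
  assumes n: "n \<ge> 2" and d: "d = 2 * n - 2"
    and rec: "\<And>k s t. lap_part N a e B u v k (of_real s) (of_real t) +
      of_nat (k + 2) * of_nat (k + d) * mean_part N a e B u v (k + 2) (of_real s) (of_real t) = 0"
    and zero: "\<And>s t. mean_part N a e B u v 0 (of_real s) (of_real t) = C * (of_real s + \<i> * of_real
        t) ^ p * (of_real s - \<i> * of_real t) ^ q"
    and one: "\<And>s t. mean_part N a e B u v 1 (of_real s) (of_real t) = 0"
  shows "mean_part N a e B u v (2 * k) (of_real s) (of_real t) =
      C * of_real (mean_coeff n p q k) * (of_real s + \<i> * of_real t) ^ (p - k) * (of_real s - \<i> *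
          of_real t) ^ (q - k)"
    and "mean_part N a e B u v (2 * k + 1) (of_real s) (of_real t) = 0"
proof -
  show "mean_part N a e B u v (2 * k) (of_real s) (of_real t) =
      C * of_real (mean_coeff n p q k) * (of_real s + \<i> * of_real t) ^ (p - k) * (of_real s - \<i> *
          of_real t) ^ (q - k)"
  proof (induction k arbitrary: s t)
    case 0
    then show ?case
      using zero by (simp add: mean_coeff_def)
  next
    case (Suc k)
    define X where "X = (complex_of_real s + \<i> * of_real t) ^ (p - Suc k) * (complex_of_real s - \<i> *
        of_real t) ^ (q - Suc k)"
    define D where "D = 4 * (of_nat (k + 1) * of_nat (n - 1 + k) :: complex)"
    have D: "D \<noteq> 0"
      using n by (auto simp: D_def simp flip: of_nat_add of_nat_Suc)
    have "lap_part N a e B u v (2 * k) (of_real s) (of_real t) =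
        4 * (C * of_real (mean_coeff n p q k)) * of_nat (p - k) * of_nat (q - k) * X"
      using lap_part_eq[OF Suc.IH, of s t] by (simp add: X_def)
    moreover have "of_nat (2 * k + 2) * of_nat (2 * k + d) = D"
    proof -
      have "2 * k + d = 2 * (n - 1 + k)"
        using n d by simp
      then show ?thesis
        unfolding D_def by (simp only: of_nat_mult of_nat_add of_nat_numeral of_nat_1) (simp add:
            algebra_simps)
    qed
    ultimately have "D * mean_part N a e B u v (2 * Suc k) (of_real s) (of_real t) =
        - (4 * (C * of_real (mean_coeff n p q k)) * of_nat (p - k) * of_nat (q - k) * X)"
      using rec[of "2 * k" s t] by (simp add: add_eq_0_iff)
    moreover have "D * (C * of_real (mean_coeff n p q (Suc k)) * X) =
        - (4 * (C * of_real (mean_coeff n p q k)) * of_nat (p - k) * of_nat (q - k) * X)"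
    proof -
      have "of_real (real (k + 1) * real (n - 1 + k)) \<noteq> (0 :: complex)"
        using n by (simp flip: of_nat_add of_nat_Suc of_nat_mult)
      then have "complex_of_real (mean_coeff n p q (Suc k)) * of_real (real (k + 1) * real (n - 1 + k)) =
          - (of_real (mean_coeff n p q k) * of_nat (p - k) * of_nat (q - k))"
        by (simp add: mean_coeff_def divide_simps del: of_real_mult of_nat_add of_nat_Suc) (simp
            add: mult_ac)
      then have "4 * C * X * (complex_of_real (mean_coeff n p q (Suc k)) * of_real (real (k + 1) *
          real (n - 1 + k))) =
          4 * C * X * (- (of_real (mean_coeff n p q k) * of_nat (p - k) * of_nat (q - k)))"
        by simp
      then show ?thesis
        by (simp add: D_def mult_ac)
    qed
    ultimately have "D * mean_part N a e B u v (2 * Suc k) (of_real s) (of_real t) = D * (C *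
        of_real (mean_coeff n p q (Suc k)) * X)"
      by simp
    then show ?case
      using D by (simp add: X_def mult.assoc)
  qed
  show "mean_part N a e B u v (2 * k + 1) (of_real s) (of_real t) = 0"
  proof (induction k arbitrary: s t)
    case (Suc k)
    \<comment> \<open>\<open>lap_part_eq\<close> with the constant 0: the vanishing of one odd part
      propagates to the next.\<close>
    have "lap_part N a e B u v (2 * k + 1) (of_real s) (of_real t) = 0"
      using lap_part_eq[of N a e B u v "2 * k + 1" 0 0 0 s t] Suc.IH by simp
    then have "of_nat (2 * k + 1 + 2) * of_nat (2 * k + 1 + d) * mean_part N a e B u v (2 * Suc k +
        1) (of_real s) (of_real t) = 0"
      using rec[of "2 * k + 1" s t] by simp
    moreover have "of_nat (2 * k + 1 + 2) \<noteq> (0::complex)" "of_nat (2 * k + 1 + d) \<noteq> (0::complex)"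
      by (simp_all only: of_nat_eq_0_iff)
    ultimately show ?case
      by (simp only: mult_eq_0_iff) auto
  qed (use one in simp)
qed

lemma vderiv2_monom_shift:
  fixes E :: "'a::euclidean_space set"
  assumes E: "finite E" "b \<in> E"
    and Y: "\<And>c. Y (\<Sum>b\<in>E. c b *\<^sub>R b) = (\<Sum>i<N. a i * complex_of_real (monom_fun E (e i) c))"
  shows "(vderiv ^^ 2) (\<lambda>h. Y ((\<Sum>b\<in>E. c b *\<^sub>R b) + h *\<^sub>R b)) 0 =
    (\<Sum>i<N. a i * of_real (real (e i b) * real (e i b - 1) * monom_fun E ((e i)(b := e i b - 2)) c))"
proof -
  define R where "R i = (\<Prod>b'\<in>E - {b}. c b' ^ e i b')" for i
  have split: "monom_fun E f (c(b := x)) = x ^ f b * (\<Prod>b'\<in>E - {b}. c b' ^ f b')" for f x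
    unfolding monom_fun_def by (subst prod.remove[OF E]) (auto intro!: prod.cong)
  have "Y ((\<Sum>b\<in>E. c b *\<^sub>R b) + h *\<^sub>R b) = (\<Sum>i<N. a i * (of_real (R i) * (of_real h + of_real (c b))
      ^ e i b))" for h
  proof -
    have "(\<Sum>b\<in>E. c b *\<^sub>R b) + h *\<^sub>R b = (\<Sum>b'\<in>E. (c(b := h + c b)) b' *\<^sub>R b')"
      by (subst (1 2) sum.remove[OF E]) (auto simp: algebra_simps intro!: sum.cong)
    then show ?thesis
      by (simp only: Y split) (simp add: R_def mult_ac)
  qed
  then have f0: "(\<lambda>h. Y ((\<Sum>b\<in>E. c b *\<^sub>R b) + h *\<^sub>R b)) = (\<lambda>h. \<Sum>i<N. a i * (of_real (R i) * (of_real
      h + of_real (c b)) ^ e i b))"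
    by (rule ext)
  have "vderiv (\<lambda>h. \<Sum>i<N. a i * (of_real (R i) * (of_real h + of_real (c b)) ^ e i b)) =
      (\<lambda>h. \<Sum>i<N. a i * (of_real (R i) * (of_nat (e i b) * (of_real h + of_real (c b)) ^ (e i b - 1))))"
    by (intro ext vderiv_eqI has_vector_derivative_real_field) (auto intro!: derivative_eq_intros sum.cong)
  moreover have "vderiv (\<lambda>h. \<Sum>i<N. a i * (of_real (R i) * (of_nat (e i b) * (of_real h + of_real (c
      b)) ^ (e i b - 1)))) =
      (\<lambda>h. \<Sum>i<N. a i * (of_real (R i) * (of_nat (e i b) * (of_nat (e i b - 1) * (of_real h + of_real
          (c b)) ^ (e i b - 1 - 1)))))"
    by (intro ext vderiv_eqI has_vector_derivative_real_field) (auto intro!: derivative_eq_intros sum.cong)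
  ultimately have "(vderiv ^^ 2) (\<lambda>h. Y ((\<Sum>b\<in>E. c b *\<^sub>R b) + h *\<^sub>R b)) 0 =
      (\<Sum>i<N. a i * (of_real (R i) * (of_nat (e i b) * (of_nat (e i b - 1) * (of_real (c b)) ^ (e i b
          - 1 - 1)))))"
    unfolding f0 by (simp add: numeral_2_eq_2)
  also have "\<dots> = (\<Sum>i<N. a i * of_real (real (e i b) * real (e i b - 1) * monom_fun E ((e i)(b := e i
      b - 2)) c))"
  proof (rule sum.cong)
    fix i
    have "(\<Prod>b'\<in>E - {b}. c b' ^ ((e i)(b := e i b - 2)) b') = R i"
      unfolding R_def by (rule prod.cong) auto
    then have "monom_fun E ((e i)(b := e i b - 2)) c = c b ^ (e i b - 2) * R i"
      using split[of "(e i)(b := e i b - 2)" "c b"] by (simp only: fun_upd_triv) simp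
    then show "a i * (of_real (R i) * (of_nat (e i b) * (of_nat (e i b - 1) * (of_real (c b)) ^ (e i
        b - 1 - 1)))) =
        a i * of_real (real (e i b) * real (e i b - 1) * monom_fun E ((e i)(b := e i b - 2)) c)"
      by (simp add: mult_ac numeral_2_eq_2)
  qed simp
  finally show ?thesis .
qed

lemma inner_eq_cdot: "inner y x = Re (cdot y (x :: complex ^ 'n::finite))"
  by (simp add: inner_vec_def cdot_def inner_complex_def)

text \<open>Together with \<open>inner_eq_cdot\<close>: orthogonality to \<open>x\<close> in the
  hermitian sense is real orthogonality to both \<open>x\<close> and
  \<open>\<i> *s x\<close>.\<close>

lemma inner_i_eq_cdot: "inner y (\<i> *s x) = Im (cdot y (x :: complex ^ 'n::finite))"
  by (simp add: inner_vec_def cdot_def inner_complex_def algebra_simps)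

lemma subspace_cdot: "subspace {y. cdot y (x :: complex ^ 'n::finite) = 0}"
  unfolding subspace_def by (auto simp: cdot_add_left cdot_scaleR_left) (simp add: cdot_def)

lemma orthonormal_extend:
  fixes x :: "complex ^ 'n::finite"
  assumes x: "norm x = 1" and B: "orthonormal B" "span B = {y. cdot y x = 0}"
  shows "orthonormal (insert x (insert (\<i> *s x) B))" "span (insert x (insert (\<i> *s x) B)) = UNIV"
    and "x \<noteq> \<i> *s x" "x \<notin> B" "\<i> *s x \<notin> B" "card B = 2 * CARD('n) - 2"
proof -
  let ?v = "\<i> *s x"
  let ?E = "insert x (insert ?v B)"
  have xx: "cdot x x = 1"
    using norm_sq_cdot[of x] x by simp
  have vx: "cdot ?v x = \<i>"
    using xx by (simp add: cdot_def mult.assoc flip: sum_distrib_left)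
  have 1: "inner x x = 1" "inner x ?v = 0" "inner ?v x = 0" "inner ?v ?v = 1"
    by (simp_all add: inner_eq_cdot[of _ x] inner_i_eq_cdot xx vx)
  have B0: "cdot b x = 0" if "b \<in> B" for b
    using span_base[OF that] B(2) by auto
  have 2: "inner b x = 0" "inner b ?v = 0" "inner x b = 0" "inner ?v b = 0" if "b \<in> B" for b
    using B0[OF that] by (simp_all add: inner_eq_cdot[of _ x] inner_i_eq_cdot inner_commute[of x b]
        inner_commute[of ?v b])
  show "x \<noteq> ?v" "x \<notin> B" "?v \<notin> B"
    using 1 2 by force+
  note neq = this
  show E: "orthonormal ?E"
    using B(1) 1 2 unfolding orthonormal_def pairwise_insert by (auto simp: orthogonal_def norm_eq_1)
  show sp: "span ?E = UNIV"
  proof -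
    have "y \<in> span ?E" for y
    proof -
      define w where "w = y - (inner y x *\<^sub>R x + inner y ?v *\<^sub>R ?v)"
      have "inner w x = 0" "inner w ?v = 0"
        by (simp_all add: w_def inner_diff_left inner_add_left 1)
      then have "cdot w x = 0"
        by (simp add: complex_eq_iff inner_eq_cdot[of _ x] inner_i_eq_cdot)
      then have "w \<in> span ?E"
        using B(2) span_mono[of B ?E] by auto
      moreover have "inner y x *\<^sub>R x + inner y ?v *\<^sub>R ?v \<in> span ?E"
        by (intro span_add span_scale span_base) auto
      ultimately have "w + (inner y x *\<^sub>R x + inner y ?v *\<^sub>R ?v) \<in> span ?E"
        by (rule span_add)
      then show ?thesis
        by (simp add: w_def)
    qed
    then show ?thesis
      by auto
  qed
  have "card ?E = 2 * CARD('n)"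
    using dim_span_eq_card_independent[OF orthonormal_independent[OF E]] sp by (simp add: dim_UNIV)
  then show "card B = 2 * CARD('n) - 2"
    using neq orthonormal_finite[OF B(1)] by simp
qed

lemma polynomial_function_measurable:
  fixes Y :: "'a::euclidean_space \<Rightarrow> complex"
  assumes "polynomial_function Y" shows "Y \<in> borel_measurable borel"
  using continuous_on_polymonial_function[OF assms, of UNIV] by (rule borel_measurable_continuous_onI)

text \<open>The restriction of \<open>Y\<close> to the complex line through \<open>x\<close> starts
  the recursion, and the result is a multiple of \<open>Y x\<close> with a factor independent of
  \<open>Y\<close> and \<open>x\<close>. The mean operator corresponds to the coordinates
  \<open>t\<close> and 0 on the line and the radius \<open>sqrt (1 - t^2)\<close>.\<close>

lemma mean_op_harmonic:
  fixes x :: "complex ^ 'n::finite"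
  assumes n: "n = CARD('n)" "n \<ge> 2" and Y: "Y \<in> harmonics p q" and x: "norm x = 1" and t: "\<bar>t\<bar> < 1" "t \<noteq> 0"
  shows "mean_op t Y x = of_real (\<Sum>k\<le>min p q. mean_coeff n p q k * (1 - t\<^sup>2) ^ k * t ^ (p + q - 2 *
      k)) * Y x"
proof -
  have poly: "polynomial_function Y" and lap: "\<And>z. laplacian Y z = 0"
    and hom: "\<And>l z. Y (l *s z) = l ^ p * cnj l ^ q * Y z"
    using Y by (auto simp: harmonics_def)
  let ?V = "{y. cdot y x = 0}"
  let ?v = "\<i> *s x"
  define d where "d = 2 * n - 2"
  have dim: "dim ?V = d"
  proof -
    obtain B where B: "orthonormal B" "span B = ?V"
      using ex_orthonormal_span[OF subspace_cdot[of x]] by blast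
    have "dim (span B) = card B"
      using B(1) by (intro dim_span_eq_card_independent orthonormal_independent)
    then show ?thesis
      using orthonormal_extend(6)[OF x B] B(2) n by (simp add: d_def)
  qed
  have d: "d > 0"
    using n by (simp add: d_def)
  obtain B where B: "orthonormal B" "span B = ?V" and avg:
    "\<And>a r and f :: _ \<Rightarrow> complex. f \<in> borel_measurable borel \<Longrightarrow> sphere_average ?V a r f =
        (\<integral>c. indicator {..<1} (L2_set c B) *\<^sub>R f (a + r *\<^sub>R (\<Sum>b\<in>B. (c b / L2_set c B) *\<^sub>R b))
            \<partial>prod_lborel B)
          / of_real (sphere_moment B (\<lambda>_. 0))"
    using sphere_average_eq[OF subspace_cdot[of x]] dim d by blast
  let ?E = "insert x (insert ?v B)"
  note E = orthonormal_extend[OF x B]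
  note finB = orthonormal_finite[OF B(1)] and finE = orthonormal_finite[OF E(1)]
  have cardB: "card B = d"
    using E(6) n by (simp add: d_def)
  define I0 where "I0 = complex_of_real (sphere_moment B (\<lambda>_. 0))"
  have I0: "I0 \<noteq> 0"
    using sphere_moment_0_pos[OF finB cardB d] by (simp add: I0_def)
  obtain N :: nat and a e where rep: "\<And>c. Y (\<Sum>b\<in>?E. c b *\<^sub>R b) = (\<Sum>i<N. a i * complex_of_real
      (monom_fun ?E (e i) c))"
    using monom_comb_index[OF monom_comb_polynomial[OF poly finE]] by blast
  let ?J = "\<lambda>r c. join x ?v (0::real) (0::real) r c"
  have pt: "(\<Sum>b\<in>?E. join x ?v s s' r c b *\<^sub>R b) = s *\<^sub>R x + s' *\<^sub>R ?v + r *\<^sub>R (\<Sum>b\<in>B. c b *\<^sub>R b)" for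
      s s' r c
  proof -
    have "(\<Sum>b\<in>B. join x ?v s s' r c b *\<^sub>R b) = (\<Sum>b\<in>B. r *\<^sub>R c b *\<^sub>R b)"
      using E(4,5) by (intro sum.cong) (auto simp: join_def)
    then show ?thesis
      using finB E(3-5) by (simp add: join_def scaleR_sum_right)
  qed
  have mean: "sphere_average ?V (s *\<^sub>R x + s' *\<^sub>R ?v) r Y =
      (\<Sum>i<N. a i * of_real (s ^ e i x * s' ^ e i ?v * r ^ sum (e i) B) * of_real (sphere_moment B (e
          i))) / I0" for s s' r
  proof -
    have "Y (s *\<^sub>R x + s' *\<^sub>R ?v + r *\<^sub>R (\<Sum>b\<in>B. c b *\<^sub>R b)) =
        (\<Sum>i<N. a i * of_real (s ^ e i x * s' ^ e i ?v * r ^ sum (e i) B) * of_real (monom_fun B (e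
            i) c))" for c
      using rep[of "join x ?v s s' r c"] unfolding pt by (simp add: monom_fun_join[OF finB E(3-5)]
          mult.assoc)
    then show ?thesis
      unfolding avg[OF polynomial_function_measurable[OF poly]] I0_def
      by (simp only: sphere_moment_comb[OF finB finite_lessThan])
  qed
  let ?m = "mean_part N a e B x ?v"
  have rec: "lap_part N a e B x ?v k (of_real s) (of_real s') +
      of_nat (k + 2) * of_nat (k + d) * ?m (k + 2) (of_real s) (of_real s') = 0" for k s s'
  proof (rule lap_mean_part[OF finB cardB d E(3-5)])
    fix c
    have "0 = laplacian Y (\<Sum>b\<in>?E. c b *\<^sub>R b)"
      using lap by simp
    also have "\<dots> = (\<Sum>b\<in>?E. (vderiv ^^ 2) (\<lambda>h. Y ((\<Sum>b\<in>?E. c b *\<^sub>R b) + h *\<^sub>R b)) 0)"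
      by (rule laplacian_orthonormal[OF poly E(1,2)])
    also have "\<dots> = (\<Sum>b\<in>?E. \<Sum>i<N. a i * of_real (real (e i b) * real (e i b - 1) * monom_fun ?E ((e
        i)(b := e i b - 2)) c))"
      by (intro sum.cong refl vderiv2_monom_shift[OF finE _ rep])
    finally show "(\<Sum>b\<in>?E. \<Sum>i<N. a i * of_real (real (e i b) * real (e i b - 1) * monom_fun ?E ((e
        i)(b := e i b - 2)) c)) = 0"
      by simp
  qed
  have zero: "?m 0 (of_real s) (of_real s') = (I0 * Y x) * (of_real s + \<i> * of_real s') ^ p *
      (of_real s - \<i> * of_real s') ^ q" for s s'
  proof -
    have "s *\<^sub>R x + s' *\<^sub>R ?v = (of_real s + \<i> * of_real s') *s x"
      by (simp only: vec_eq_iff vector_add_component vector_scaleR_component vector_smult_component)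
        (simp add: scaleR_conv_of_real algebra_simps)
    then have Yz: "Y (s *\<^sub>R x + s' *\<^sub>R ?v) = (of_real s + \<i> * of_real s') ^ p * (of_real s - \<i> *
        of_real s') ^ q * Y x"
      using hom[of "of_real s + \<i> * of_real s'" x] by simp
    \<comment> \<open>An average of radius 0 isolates the part of degree 0 in \<open>B\<close>,
      because \<open>0 ^ 0 = 1\<close>; it is also the value of \<open>Y\<close> at the
      centre.\<close>
    have "?m 0 (of_real s) (of_real s') = I0 * sphere_average ?V (s *\<^sub>R x + s' *\<^sub>R ?v) 0 Y"
      unfolding mean mean_part_def using I0
      by (auto intro!: sum.cong simp: power_0_left)
    also have "sphere_average ?V (s *\<^sub>R x + s' *\<^sub>R ?v) 0 Y = Y (s *\<^sub>R x + s' *\<^sub>R ?v)"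
    proof -
      have "(\<integral>c. indicator {..<1} (L2_set c B) *\<^sub>R Y (s *\<^sub>R x + s' *\<^sub>R ?v) \<partial>prod_lborel B) = Y (s
          *\<^sub>R x + s' *\<^sub>R ?v) * I0"
        using sphere_moment_comb[OF finB, of "{()}" "\<lambda>_. Y (s *\<^sub>R x + s' *\<^sub>R ?v)" "\<lambda>_ _. 0"]
        by (simp add: monom_fun_def I0_def)
      then show ?thesis
        unfolding avg[OF polynomial_function_measurable[OF poly]] using I0 by (simp add: I0_def)
    qed
    finally show ?thesis
      by (simp add: Yz mult_ac)
  qed
  have one: "?m 1 (of_real s) (of_real s') = 0" for s s'
  proof -
    have "sphere_moment B (e i) = 0" if h: "sum (e i) B = 1" for i
    proof -
      have "e i b \<le> 1" if "b \<in> B" for b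
        using member_le_sum[OF that, of "e i"] h finB by simp
      then have "(\<Sum>b\<in>B. real (e i b) * real (e i b - 1) * sphere_moment B ((e i)(b := e i b - 2))) = 0"
        by (intro sum.neutral) force
      then have "real 1 * (real 1 + real d - 2) * sphere_moment B (e i) = 0"
        using sphere_moment_laplace[OF finB cardB d h] by simp
      moreover have "real d \<ge> 2"
        using n by (simp add: d_def of_nat_diff)
      ultimately show ?thesis
        by simp
    qed
    then show ?thesis
      unfolding mean_part_def by (intro sum.neutral) auto
  qed
  note closed = mean_part_closed[OF n(2) d_def rec zero one]
  define r where "r = sqrt (1 - t\<^sup>2)"
  have r2: "r\<^sup>2 = 1 - t\<^sup>2"
    using t by (simp add: r_def abs_square_le_1)
  \<comment> \<open>Large enough to cover every degree occurring in \<open>Y\<close>, and the range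
    of the final sum.\<close>
  define K where "K = min p q + (\<Sum>i<N. sum (e i) B)"
  have hK: "sum (e i) B \<le> 2 * K + 1" if "i < N" for i
    using member_le_sum[of i "{..<N}" "\<lambda>i. sum (e i) B"] that by (simp add: K_def)
  have "I0 * mean_op t Y x = (\<Sum>i<N. a i * of_real (t ^ e i x * 0 ^ e i ?v * r ^ sum (e i) B) *
      of_real (sphere_moment B (e i)))"
    using mean[of t 0 r] I0 by (simp add: mean_op_def r_def)
  also have "\<dots> = (\<Sum>i<N. \<Sum>j<2 * K + 2. of_real r ^ j * ((if sum (e i) B = j then a i * of_real
      (sphere_moment B (e i)) else 0) * (of_real t ^ e i x * 0 ^ e i ?v)))"
  proof (rule sum.cong)
    fix i assume "i \<in> {..<N}"
    then have i: "sum (e i) B < 2 * K + 2"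
      using hK[of i] by simp
    have "(\<Sum>j<2 * K + 2. of_real r ^ j * ((if sum (e i) B = j then a i * of_real (sphere_moment B (e
        i)) else 0) * (of_real t ^ e i x * 0 ^ e i ?v))) =
      (\<Sum>j\<in>{sum (e i) B}. of_real r ^ j * ((if sum (e i) B = j then a i * of_real (sphere_moment B (e
          i)) else 0) * (of_real t ^ e i x * 0 ^ e i ?v)))"
      by (rule sum.mono_neutral_right) (use i in auto)
    then show "a i * of_real (t ^ e i x * 0 ^ e i ?v * r ^ sum (e i) B) * of_real (sphere_moment B (e i)) =
      (\<Sum>j<2 * K + 2. of_real r ^ j * ((if sum (e i) B = j then a i * of_real (sphere_moment B (e i))
          else 0) * (of_real t ^ e i x * 0 ^ e i ?v)))"
      by (simp add: mult_ac)
  qed simp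
  also have "\<dots> = (\<Sum>j<2 * K + 2. of_real r ^ j * ?m j (of_real t) (of_real 0))"
    by (subst sum.swap) (simp add: mean_part_def sum_distrib_left)
  also have "\<dots> = (\<Sum>j<2 * Suc K. of_real r ^ j * ?m j (of_real t) (of_real 0))"
    by simp
  also have "\<dots> = (\<Sum>k<Suc K. of_real r ^ (2 * k) * ?m (2 * k) (of_real t) (of_real 0) + of_real r ^
      (2 * k + 1) * ?m (2 * k + 1) (of_real t) (of_real 0))"
    by (induction K) (simp_all add: algebra_simps)
  also have "\<dots> = (\<Sum>k<Suc K. I0 * Y x * of_real (mean_coeff n p q k * (1 - t\<^sup>2) ^ k * (t ^ (p - k) *
      t ^ (q - k))))"
  proof (rule sum.cong)
    fix k
    have "of_real r ^ (2 * k) = complex_of_real ((1 - t\<^sup>2) ^ k)"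
      by (simp add: power_mult flip: r2 of_real_power)
    then show "of_real r ^ (2 * k) * ?m (2 * k) (of_real t) (of_real 0) + of_real r ^ (2 * k + 1) *
        ?m (2 * k + 1) (of_real t) (of_real 0) =
        I0 * Y x * of_real (mean_coeff n p q k * (1 - t\<^sup>2) ^ k * (t ^ (p - k) * t ^ (q - k)))"
      unfolding closed by (simp add: mult_ac)
  qed simp
  also have "\<dots> = (\<Sum>k\<le>min p q. I0 * Y x * of_real (mean_coeff n p q k * (1 - t\<^sup>2) ^ k * (t ^ (p - k)
      * t ^ (q - k))))"
  proof (rule sum.mono_neutral_right)
    show "\<forall>k\<in>{..<Suc K} - {..min p q}. I0 * Y x * of_real (mean_coeff n p q k * (1 - t\<^sup>2) ^ k * (t ^
        (p - k) * t ^ (q - k))) = 0"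
    proof
      fix k assume "k \<in> {..<Suc K} - {..min p q}"
      then have "min p q < k"
        by auto
      \<comment> \<open>Terms beyond \<open>min p q\<close> contain the factor with
        \<open>j = min p q\<close>, which is 0.\<close>
      moreover have "real (p - min p q) * real (q - min p q) = 0"
        by (simp add: min_def)
      ultimately have "mean_coeff n p q k = 0"
        unfolding mean_coeff_def by (intro prod_zero) (auto intro!: bexI[of _ "min p q"])
      then show "I0 * Y x * of_real (mean_coeff n p q k * (1 - t\<^sup>2) ^ k * (t ^ (p - k) * t ^ (q - k))) = 0"
        by simp
    qed
  qed (auto simp: K_def)
  also have "\<dots> = (\<Sum>k\<le>min p q. I0 * Y x * of_real (mean_coeff n p q k * (1 - t\<^sup>2) ^ k * t ^ (p + q -
      2 * k)))"
  proof (rule sum.cong)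
    fix k assume "k \<in> {..min p q}"
    then have "p + q - 2 * k = (p - k) + (q - k)"
      by auto
    then show "I0 * Y x * of_real (mean_coeff n p q k * (1 - t\<^sup>2) ^ k * (t ^ (p - k) * t ^ (q - k))) =
        I0 * Y x * of_real (mean_coeff n p q k * (1 - t\<^sup>2) ^ k * t ^ (p + q - 2 * k))"
      by (simp add: power_add)
  qed simp
  also have "\<dots> = I0 * (of_real (\<Sum>k\<le>min p q. mean_coeff n p q k * (1 - t\<^sup>2) ^ k * t ^ (p + q - 2 *
      k)) * Y x)"
    by (simp add: sum_distrib_left mult_ac)
  finally show ?thesis
    using I0 by simp
qed

subsection \<open>The multipliers\<close>

lemma polynomial_function_complex_iff:
  "polynomial_function (f :: 'a::real_normed_vector \<Rightarrow> complex) \<longleftrightarrow>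
    real_polynomial_function (\<lambda>x. Re (f x)) \<and> real_polynomial_function (\<lambda>x. Im (f x))"
  by (simp add: polynomial_function_iff_Basis_inner Basis_complex_def inner_complex_def)

lemma polynomial_function_complex_mult:
  fixes f g :: "'a::real_normed_vector \<Rightarrow> complex"
  assumes "polynomial_function f" "polynomial_function g"
  shows "polynomial_function (\<lambda>x. f x * g x)"
  using assms unfolding polynomial_function_complex_iff by auto

lemma polynomial_function_complex_power:
  fixes f :: "'a::real_normed_vector \<Rightarrow> complex"
  assumes "polynomial_function f"
  shows "polynomial_function (\<lambda>x. f x ^ k)"
  by (induction k) (auto intro: polynomial_function_complex_mult assms)

lemma sum_Basis_complex_vec:
  fixes g :: "complex ^ 'n::finite \<Rightarrow> complex"
  shows "(\<Sum>b\<in>Basis. g b) = (\<Sum>i\<in>UNIV. g (axis i 1) + g (axis i \<i>))"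
proof -
  have inj: "inj_on (\<lambda>(i, u). axis i u) (UNIV \<times> {1, \<i>})"
    by (auto simp: inj_on_def axis_eq_axis)
  have "(Basis :: (complex ^ 'n) set) = (\<lambda>(i, u). axis i u) ` (UNIV \<times> {1, \<i>})"
    by (auto simp: Basis_vec_def Basis_complex_def)
  then have "(\<Sum>b\<in>Basis. g b) = (\<Sum>x\<in>UNIV \<times> {1, \<i>}. g (case x of (i, u) \<Rightarrow> axis i u))"
    using sum.reindex[OF inj, of g] by (simp add: o_def)
  also have "\<dots> = (\<Sum>i\<in>UNIV. \<Sum>u\<in>{1, \<i>}. g (axis i u))"
    by (subst sum.cartesian_product) (simp add: case_prod_beta)
  finally show ?thesis
    by simp
qed

lemma vderiv2_power_mult:
  "(vderiv ^^ 2) (\<lambda>h. (a + of_real h * b) ^ p * (c + of_real h * d) ^ q) 0 =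
    of_nat p * of_nat (p - 1) * b\<^sup>2 * a ^ (p - 2) * c ^ q + 2 * (b * d) * (of_nat p * of_nat q * a ^
        (p - 1) * c ^ (q - 1))
      + of_nat q * of_nat (q - 1) * d\<^sup>2 * a ^ p * c ^ (q - 2)"
proof -
  have "vderiv (\<lambda>h. (a + of_real h * b) ^ p * (c + of_real h * d) ^ q) =
      (\<lambda>h. of_nat p * b * (a + of_real h * b) ^ (p - 1) * (c + of_real h * d) ^ q +
        of_nat q * d * (a + of_real h * b) ^ p * (c + of_real h * d) ^ (q - 1))"
    by (intro ext vderiv_eqI has_vector_derivative_real_field[where f = "\<lambda>z. (a + z * b) ^ p * (c +
        z * d) ^ q"])
      (auto intro!: derivative_eq_intros simp: algebra_simps)
  moreover have "vderiv (\<lambda>h. of_nat p * b * (a + of_real h * b) ^ (p - 1) * (c + of_real h * d) ^ q +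
        of_nat q * d * (a + of_real h * b) ^ p * (c + of_real h * d) ^ (q - 1)) 0 =
      of_nat p * of_nat (p - 1) * b\<^sup>2 * a ^ (p - 2) * c ^ q + 2 * (b * d) * (of_nat p * of_nat q * a
          ^ (p - 1) * c ^ (q - 1))
      + of_nat q * of_nat (q - 1) * d\<^sup>2 * a ^ p * c ^ (q - 2)"
    by (rule vderiv_eqI, rule has_vector_derivative_real_field[where f = "\<lambda>z. of_nat p * b * (a + z
        * b) ^ (p - 1) * (c + z * d) ^ q +
        of_nat q * d * (a + z * b) ^ p * (c + z * d) ^ (q - 1)"])
      (auto intro!: derivative_eq_intros simp: algebra_simps power2_eq_square numeral_2_eq_2)
  ultimately show ?thesis
    by (simp add: numeral_2_eq_2)
qed

text \<open>A nonzero value \<open>Y x\<close> makes the scalar in \<open>multiplier\<close> unique.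
  In the monomial built from \<open>z $ i\<close> and the conjugate of \<open>z $ j\<close> with
  distinct \<open>i\<close>, \<open>j\<close>, the second derivatives along \<open>axis k 1\<close>
  and \<open>axis k \<i>\<close> cancel as 1 and -1, and no coordinate direction meets both
  factors.\<close>

lemma ex_harmonic:
  assumes "CARD('n::finite) \<ge> 2"
  shows "\<exists>Y\<in>harmonics p q. \<exists>x :: complex ^ 'n. norm x = 1 \<and> Y x \<noteq> 0"
proof -
  obtain i j :: 'n where ij: "i \<noteq> j"
  proof -
    have "\<not> (\<forall>i j :: 'n. i = j)"
    proof
      assume "\<forall>i j :: 'n. i = j"
      then have "card (UNIV :: 'n set) \<le> Suc 0"
        by (subst card_le_Suc0_iff_eq) auto
      then show False
        using assms by simp
    qed
    then show ?thesis
      using that by blast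
  qed
  define Y where "Y = (\<lambda>z :: complex ^ 'n. (z $ i) ^ p * (cnj (z $ j)) ^ q)"
  have "polynomial_function Y"
    unfolding Y_def
    by (intro polynomial_function_complex_mult polynomial_function_complex_power
        polynomial_function_bounded_linear
        bounded_linear_vec_nth bounded_linear_compose[OF bounded_linear_cnj bounded_linear_vec_nth])
  moreover have "\<forall>r z. Y (r *\<^sub>R z) = of_real r ^ (p + q) * Y z"
    unfolding Y_def by (simp only: vector_scaleR_component) (simp add: scaleR_conv_of_real
        power_mult_distrib power_add mult_ac)
  moreover have "\<forall>l z. Y (l *s z) = l ^ p * cnj l ^ q * Y z"
    by (simp add: Y_def power_mult_distrib mult_ac)
  moreover have "laplacian Y z = 0" for z
  proof -
    have f: "(vderiv ^^ 2) (\<lambda>h. Y (z + h *\<^sub>R b)) 0 =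
        of_nat p * of_nat (p - 1) * (b $ i)\<^sup>2 * (z $ i) ^ (p - 2) * (cnj (z $ j)) ^ q
        + 2 * ((b $ i) * cnj (b $ j)) * (of_nat p * of_nat q * (z $ i) ^ (p - 1) * (cnj (z $ j)) ^ (q - 1))
        + of_nat q * of_nat (q - 1) * (cnj (b $ j))\<^sup>2 * (z $ i) ^ p * (cnj (z $ j)) ^ (q - 2)" for b
    proof -
      have "(\<lambda>h. Y (z + h *\<^sub>R b)) = (\<lambda>h. (z $ i + of_real h * b $ i) ^ p * (cnj (z $ j) + of_real h
          * cnj (b $ j)) ^ q)"
        unfolding Y_def by (simp only: vector_add_component vector_scaleR_component) (simp add:
            scaleR_conv_of_real)
      then show ?thesis
        by (simp only: vderiv2_power_mult)
    qed
    show ?thesis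
      unfolding laplacian_def f sum_Basis_complex_vec
      by (rule sum.neutral) (use ij in \<open>auto simp: axis_def\<close>)
  qed
  ultimately have Y: "Y \<in> harmonics p q"
    by (simp add: harmonics_def)
  define z :: "complex ^ 'n" where "z = (\<chi> k. 1)"
  define x where "x = (1 / norm z) *\<^sub>R z"
  have "z \<noteq> 0"
    by (simp add: z_def vec_eq_iff)
  then have "norm x = 1"
    by (simp add: x_def)
  moreover have "x $ k \<noteq> 0" for k
  proof -
    have "x $ k = (1 / norm z) *\<^sub>R (1 :: complex)"
      unfolding x_def by (simp only: vector_scaleR_component) (simp add: z_def)
    then show ?thesis
      using \<open>z \<noteq> 0\<close> by simp
  qed
  then have "Y x \<noteq> 0"
    by (simp add: Y_def)
  ultimately show ?thesis
    using Y by blast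
qed

lemma multiplier_eq:
  assumes n: "n = CARD('n::finite)" "n \<ge> 2" and t: "0 < t" "t < 1"
  shows "multiplier TYPE('n) p q t =
    of_real (\<Sum>k\<le>min p q. mean_coeff n p q k * (1 - t\<^sup>2) ^ k * t ^ (p + q - 2 * k))" (is "_ = ?a")
  unfolding multiplier_def
proof (rule the_equality)
  have m: "mean_op t Y x = ?a * Y x" if "Y \<in> harmonics p q" "norm x = 1" for Y and x :: "complex ^ 'n"
    by (rule mean_op_harmonic[OF n that]) (use t in auto)
  then show "\<forall>Y\<in>harmonics p q. \<forall>x :: complex ^ 'n \<in> sphere 0 1. mean_op t Y x = ?a * Y x"
    by simp
  fix b assume b: "\<forall>Y\<in>harmonics p q. \<forall>x :: complex ^ 'n \<in> sphere 0 1. mean_op t Y x = b * Y x"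
  obtain Y and x :: "complex ^ 'n" where Y: "Y \<in> harmonics p q" "norm x = 1" "Y x \<noteq> 0"
    using ex_harmonic[where ?'n = 'n] n by blast
  then have "b * Y x = ?a * Y x"
    using b m[of Y x] by simp
  then show "b = ?a"
    using Y(3) by simp
qed

section \<open>A Rodrigues formula for the density of \<open>alpha\<close>\<close>

lemma higher_deriv_shifted_power:
  assumes "i \<le> k"
  shows "(deriv ^^ i) (\<lambda>w. (w - a) ^ k) z = fact k / fact (k - i) * (z - a :: complex) ^ (k - i)"
  using assms
proof (induction i arbitrary: z)
  case (Suc i)
  have "(deriv ^^ i) (\<lambda>w. (w - a) ^ k) = (\<lambda>z. fact k / fact (k - i) * (z - a) ^ (k - i))"
    using Suc by auto
  then have "(deriv ^^ Suc i) (\<lambda>w. (w - a) ^ k) z = deriv (\<lambda>z. fact k / fact (k - i) * (z - a) ^ (k - i)) z"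
    by simp
  also have "\<dots> = fact k / fact (k - i) * (of_nat (k - i) * (z - a) ^ (k - i - 1))"
    by (rule DERIV_imp_deriv) (auto intro!: derivative_eq_intros)
  also have "fact (k - i) = of_nat (k - i) * (fact (k - Suc i) :: complex)"
  proof -
    have "k - i = Suc (k - Suc i)"
      using Suc.prems by simp
    then show ?thesis
      by (simp only: fact_Suc of_nat_mult of_nat_fact)
  qed
  finally show ?case
    using Suc.prems by simp
qed simp

lemma higher_deriv_finite_sum:
  assumes "finite A" "\<And>j. j \<in> A \<Longrightarrow> f j holomorphic_on UNIV"
  shows "(deriv ^^ m) (\<lambda>w. \<Sum>j\<in>A. f j w) u = (\<Sum>j\<in>A. (deriv ^^ m) (f j) u)"
  using assms
proof (induction A rule: finite_induct)
  case empty
  show ?case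
    by (induction m) (simp_all add: higher_deriv_const)
next
  case (insert j A)
  have "(deriv ^^ m) (\<lambda>w. f j w + (\<Sum>j\<in>A. f j w)) u = (deriv ^^ m) (f j) u + (deriv ^^ m) (\<lambda>w. \<Sum>j\<in>A.
      f j w) u"
    by (rule higher_deriv_add[of _ UNIV]) (use insert.prems in \<open>auto intro!: holomorphic_intros\<close>)
  then show ?case
    using insert by simp
qed

text \<open>Both sides are the m-th derivative of u^(K + m) (u - 1)^(N + m): once by the Leibniz
  rule, once after expanding the second factor binomially.\<close>

lemma rodrigues:
  "(\<Sum>k\<le>m. of_nat (m choose k) * (fact (K + m) / fact (K + m - k)) * (fact (N + m) / fact (N + k)) *
      u ^ (K + m - k) * (u - 1 :: complex) ^ (N + k))
    = (\<Sum>j\<le>N + m. of_nat (N + m choose j) * (- 1) ^ (N + m - j) * (fact (K + m + j) / fact (K + j)) *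
        u ^ (K + j))"
proof -
  have "(deriv ^^ m) (\<lambda>w. (w - 0) ^ (K + m) * (w - 1) ^ (N + m)) u =
      (\<Sum>k = 0..m. of_nat (m choose k) * (deriv ^^ k) (\<lambda>w. (w - 0) ^ (K + m)) u * (deriv ^^ (m - k))
          (\<lambda>w. (w - 1) ^ (N + m)) u)"
    by (rule higher_deriv_mult[of _ UNIV]) (auto intro!: holomorphic_intros)
  also have "\<dots> = (\<Sum>k\<le>m. of_nat (m choose k) * (fact (K + m) / fact (K + m - k)) * (fact (N + m) /
      fact (N + k)) * u ^ (K + m - k) * (u - 1) ^ (N + k))"
    unfolding atLeast0AtMost
  proof (rule sum.cong)
    fix k assume "k \<in> {..m}"
    then have "N + m - (m - k) = N + k"
      by simp
    then show "of_nat (m choose k) * (deriv ^^ k) (\<lambda>w. (w - 0) ^ (K + m)) u * (deriv ^^ (m - k))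
        (\<lambda>w. (w - 1) ^ (N + m)) u =
        of_nat (m choose k) * (fact (K + m) / fact (K + m - k)) * (fact (N + m) / fact (N + k)) * u
            ^ (K + m - k) * (u - 1) ^ (N + k)"
      using \<open>k \<in> {..m}\<close> by (subst (1 2) higher_deriv_shifted_power) auto
  qed simp
  finally have 1: "(deriv ^^ m) (\<lambda>w. (w - 0) ^ (K + m) * (w - 1) ^ (N + m)) u = \<dots>" .
  have "(\<lambda>w. (w - 0) ^ (K + m) * (w - 1) ^ (N + m)) =
      (\<lambda>w::complex. \<Sum>j\<le>N + m. (of_nat (N + m choose j) * (- 1) ^ (N + m - j)) * (w - 0) ^ (K + m + j))"
  proof
    fix w :: complex
    have "(w - 1) ^ (N + m) = (\<Sum>j\<le>N + m. of_nat (N + m choose j) * w ^ j * (- 1) ^ (N + m - j))"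
      using binomial_ring[of w "- 1" "N + m"] by simp
    then show "(w - 0) ^ (K + m) * (w - 1) ^ (N + m) = (\<Sum>j\<le>N + m. (of_nat (N + m choose j) * (- 1) ^
        (N + m - j)) * (w - 0) ^ (K + m + j))"
      by (simp add: sum_distrib_left power_add mult_ac)
  qed
  then have "(deriv ^^ m) (\<lambda>w. (w - 0) ^ (K + m) * (w - 1) ^ (N + m)) u =
      (deriv ^^ m) (\<lambda>w::complex. \<Sum>j\<le>N + m. (of_nat (N + m choose j) * (- 1) ^ (N + m - j)) * (w - 0)
          ^ (K + m + j)) u"
    by simp
  also have "\<dots> = (\<Sum>j\<le>N + m. (deriv ^^ m) (\<lambda>w. (of_nat (N + m choose j) * (- 1) ^ (N + m - j)) * (w -
      0) ^ (K + m + j)) u)"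
    by (rule higher_deriv_finite_sum) (auto intro!: holomorphic_intros)
  also have "\<dots> = (\<Sum>j\<le>N + m. of_nat (N + m choose j) * (- 1) ^ (N + m - j) * (fact (K + m + j) / fact
      (K + j)) * u ^ (K + j))"
  proof (rule sum.cong)
    fix j
    have "(deriv ^^ m) (\<lambda>w. (of_nat (N + m choose j) * (- 1) ^ (N + m - j)) * (w - 0) ^ (K + m + j)) u =
        (of_nat (N + m choose j) * (- 1) ^ (N + m - j)) * (deriv ^^ m) (\<lambda>w. (w - 0) ^ (K + m + j)) u"
      by (rule higher_deriv_cmult[of _ UNIV]) (auto intro!: holomorphic_intros)
    also have "(deriv ^^ m) (\<lambda>w. (w - 0) ^ (K + m + j)) u = fact (K + m + j) / fact (K + j) * u ^ (K + j)"
      by (subst higher_deriv_shifted_power) auto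
    finally show "(deriv ^^ m) (\<lambda>w. (of_nat (N + m choose j) * (- 1) ^ (N + m - j)) * (w - 0) ^ (K +
        m + j)) u =
        of_nat (N + m choose j) * (- 1) ^ (N + m - j) * (fact (K + m + j) / fact (K + j)) * u ^ (K + j)"
      by simp
  qed simp
  finally show ?thesis
    using 1 by simp
qed

text \<open>With \<open>m\<close> the smaller of \<open>p\<close>, \<open>q\<close> and
  \<open>K\<close> their difference, (p - j) (q - j) = (m - j) (K + m - j). The product then
  collapses to factorials, the form in which the Leibniz terms of \<open>rodrigues\<close>
  appear.\<close>

lemma mean_coeff_eq:
  assumes n: "n \<ge> 2" and k: "k \<le> m" and pq: "m = min p q" "K = max p q - min p q"
  shows "mean_coeff n p q k = (- 1) ^ k * real (m choose k) * (fact (K + m) / fact (K + m - k)) *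
      (fact (n - 2) / fact (n - 2 + k))"
  using k
proof (induction k)
  case (Suc k)
  have pk: "real (p - k) * real (q - k) = real (m - k) * real (K + m - k)"
    using pq by (cases "p \<le> q") (auto simp: min_def max_def mult.commute)
  have c1: "real (m choose Suc k) = real (m choose k) * real (m - k) / real (k + 1)"
  proof -
    have "Suc k * (m choose Suc k) = (m choose k) * (m - k)"
      using Suc.prems binomial_absorption[of k m] binomial_absorb_comp[of m k] by (simp add: mult.commute)
    then have "real (Suc k) * real (m choose Suc k) = real (m choose k) * real (m - k)"
      by (metis of_nat_mult)
    then show ?thesis
      by (simp add: field_simps)
  qed
  have c2: "fact (K + m) / fact (K + m - Suc k) = fact (K + m) / fact (K + m - k) * real (K + m - k)"
  proof -
    have f: "fact (K + m - k) = real (K + m - k) * fact (K + m - Suc k)"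
    proof -
      have "K + m - k = Suc (K + m - Suc k)"
        using Suc.prems by simp
      then show ?thesis
        by (simp only: fact_Suc of_nat_mult of_nat_fact)
    qed
    have "real (K + m - k) \<noteq> 0"
      using Suc.prems by simp
    then show ?thesis
      unfolding f by (simp del: of_nat_diff of_nat_add)
  qed
  have c3: "fact (n - 2) / fact (n - 2 + Suc k) = fact (n - 2) / fact (n - 2 + k) / real (n - 1 + k)"
  proof -
    have "n - 2 + Suc k = Suc (n - 2 + k)" "n - 1 + k = Suc (n - 2 + k)"
      using n by auto
    then show ?thesis
      by (simp add: mult.commute)
  qed
  have c4: "mean_coeff n p q (Suc k) = mean_coeff n p q k * - (real (m - k) * real (K + m - k) /
      (real (k + 1) * real (n - 1 + k)))"
    by (simp add: mean_coeff_def pk)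
  have IH: "mean_coeff n p q k = (- 1) ^ k * real (m choose k) * (fact (K + m) / fact (K + m - k)) *
      (fact (n - 2) / fact (n - 2 + k))"
    using Suc by simp
  have alg: "((- 1) ^ k * C * F * G) * - (a * b / (c * d)) = (- 1) ^ Suc k * (C * a / c) * (F * b) *
      (G / d)" for C F G a b c d :: real
    by simp
  show ?case
    unfolding c1 c2 c3 c4 IH by (rule alg)
qed (simp add: mean_coeff_def)

text \<open>\<open>rodrigues\<close> at u = t^2 and N = n - 2. A preliminary factor t^K makes all
  exponents even, since K + p + q - 2 k = 2 (K + m - k); it is cancelled at the end.\<close>

lemma mean_coeff_sum:
  assumes n: "n \<ge> 2" and pq: "m = min p q" "K = max p q - min p q" and t: "t \<noteq> 0"
  shows "complex_of_real ((\<Sum>k\<le>m. mean_coeff n p q k * (1 - t\<^sup>2) ^ k * t ^ (p + q - 2 * k)) * (1 -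
      t\<^sup>2) ^ (n - 2)) =
    (\<Sum>j\<le>n - 2 + m. (- 1) ^ m * fact (n - 2) / fact (n - 2 + m) * ((- 1) ^ j * of_nat (n - 2 + m
        choose j) * (fact (j + K + m) / fact (j + K)))
      * of_real t ^ (K + 2 * j))" (is "?L = ?R")
proof -
  define u where "u = (complex_of_real t)\<^sup>2"
  define N where "N = n - 2"
  define c where "c = ((- 1) ^ N * fact N / fact (N + m) :: complex)"
  have pq': "p + q = K + 2 * m"
    using pq by (auto simp: min_def max_def)
  have "of_real t ^ K * ?L = (\<Sum>k\<le>m. complex_of_real (mean_coeff n p q k) * (1 - u) ^ (N + k) * u ^
      (K + m - k))"
    unfolding of_real_mult of_real_sum sum_distrib_right sum_distrib_left
  proof (rule sum.cong)
    fix k assume "k \<in> {..m}"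
    then have "K + (p + q - 2 * k) = 2 * (K + m - k)"
      using pq' by simp
    then have "complex_of_real t ^ K * of_real t ^ (p + q - 2 * k) = u ^ (K + m - k)"
      unfolding u_def power_mult[symmetric] power_add[symmetric] by simp
    moreover have "complex_of_real ((1 - t\<^sup>2) ^ k) * of_real ((1 - t\<^sup>2) ^ (n - 2)) = (1 - u) ^ (N + k)"
      by (simp add: u_def N_def power_add)
    moreover have "of_real t ^ K * (complex_of_real (mean_coeff n p q k) * of_real ((1 - t\<^sup>2) ^ k) *
        of_real (t ^ (p + q - 2 * k)) * of_real ((1 - t\<^sup>2) ^ (n - 2))) =
        of_real (mean_coeff n p q k) * (complex_of_real ((1 - t\<^sup>2) ^ k) * of_real ((1 - t\<^sup>2) ^ (n -
            2))) * (of_real t ^ K * of_real t ^ (p + q - 2 * k))"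
      by (simp add: mult_ac)
    ultimately show "of_real t ^ K * (complex_of_real (mean_coeff n p q k) * of_real ((1 - t\<^sup>2) ^ k)
        * of_real (t ^ (p + q - 2 * k)) * of_real ((1 - t\<^sup>2) ^ (n - 2))) =
        of_real (mean_coeff n p q k) * (1 - u) ^ (N + k) * u ^ (K + m - k)"
      by simp
  qed simp
  also have "\<dots> = c * (\<Sum>k\<le>m. of_nat (m choose k) * (fact (K + m) / fact (K + m - k)) * (fact (N + m)
      / fact (N + k)) * u ^ (K + m - k) * (u - 1) ^ (N + k))"
    unfolding sum_distrib_left
  proof (rule sum.cong)
    fix k assume "k \<in> {..m}"
    then have mc: "complex_of_real (mean_coeff n p q k) = (- 1) ^ k * of_nat (m choose k) * (fact (K
        + m) / fact (K + m - k)) * (fact N / fact (N + k))"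
      using mean_coeff_eq[OF n _ pq, of k] by (simp add: N_def)
    have "(1 - u) ^ (N + k) = (- 1) ^ (N + k) * (u - 1) ^ (N + k)"
      by (simp flip: power_mult_distrib)
    moreover have "(- 1) ^ k * (- 1) ^ (N + k) = ((- 1) ^ N :: complex)"
      by (simp add: power_add flip: power_mult_distrib)
    ultimately show "of_real (mean_coeff n p q k) * (1 - u) ^ (N + k) * u ^ (K + m - k) =
        c * (of_nat (m choose k) * (fact (K + m) / fact (K + m - k)) * (fact (N + m) / fact (N + k))
            * u ^ (K + m - k) * (u - 1) ^ (N + k))"
      unfolding mc c_def by (simp add: divide_simps) (simp add: mult_ac)?
  qed simp
  also have "\<dots> = c * (\<Sum>j\<le>N + m. of_nat (N + m choose j) * (- 1) ^ (N + m - j) * (fact (K + m + j) /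
      fact (K + j)) * u ^ (K + j))"
    unfolding rodrigues ..
  also have "\<dots> = of_real t ^ K * ?R"
    unfolding sum_distrib_left N_def[symmetric]
  proof (rule sum.cong)
    fix j assume j: "j \<in> {..N + m}"
    have e1: "(- 1) ^ N * (- 1) ^ (N + m - j) = ((- 1) ^ m * (- 1) ^ j :: complex)"
    proof -
      have "even (N + (N + m - j) + (m + j))"
        using j by auto
      then have "even (N + (N + m - j)) = even (m + j)"
        by simp
      then show ?thesis
        unfolding power_add[symmetric] by (simp add: minus_one_power_iff)
    qed
    have e2: "u ^ (K + j) = of_real t ^ K * of_real t ^ (K + 2 * j)"
      unfolding u_def power_mult[symmetric] power_add[symmetric] by (simp add: algebra_simps)
    have e3: "K + m + j = j + K + m" "K + j = j + K"
      by auto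
    have "c * (of_nat (N + m choose j) * (- 1) ^ (N + m - j) * (fact (K + m + j) / fact (K + j)) * u
        ^ (K + j)) =
      ((- 1) ^ N * (- 1) ^ (N + m - j)) * (fact N / fact (N + m) * of_nat (N + m choose j) * (fact
          (K + m + j) / fact (K + j))) * u ^ (K + j)"
      unfolding c_def by simp
    also have "\<dots> = of_real t ^ K * ((- 1) ^ m * fact N / fact (N + m) * ((- 1) ^ j * of_nat (N + m
        choose j) * (fact (j + K + m) / fact (j + K))) * of_real t ^ (K + 2 * j))"
      unfolding e1 e2 unfolding e3 by simp
    finally show "c * (of_nat (N + m choose j) * (- 1) ^ (N + m - j) * (fact (K + m + j) / fact (K +
        j)) * u ^ (K + j)) =
       of_real t ^ K * ((- 1) ^ m * fact N / fact (N + m) * ((- 1) ^ j * of_nat (N + m choose j) *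
           (fact (j + K + m) / fact (j + K))) * of_real t ^ (K + 2 * j))" .
  qed simp
  finally have "complex_of_real t ^ K * ?L = of_real t ^ K * ?R" .
  then show ?thesis
    using t by simp
qed

text \<open>Exhibits the quotient of factorials from \<open>rodrigues\<close> as a value at -j of a
  polynomial of degree m with the roots K + 1, ..., K + m, as interpolation demands.\<close>

lemma poly_prod_neg_nat:
  "poly (\<Prod>i<m. [:- of_nat (K + 1 + i), 1:]) (- of_nat j :: complex) = (- 1) ^ m * (fact (j + K + m)
      / fact (j + K))"
proof -
  have "fact (j + K + m) = (fact (j + K) * pochhammer (1 + of_nat (j + K)) m :: complex)"
    unfolding pochhammer_fact by (rule pochhammer_product')
  then have "fact (j + K + m) / fact (j + K) = (pochhammer (1 + of_nat (j + K)) m :: complex)"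
    by simp
  also have "\<dots> = (\<Prod>i<m. of_nat (j + (K + 1 + i)))"
    unfolding pochhammer_prod atLeast0LessThan by (intro prod.cong) (auto simp: algebra_simps)
  finally have "(- 1) ^ m * (fact (j + K + m) / fact (j + K)) = (\<Prod>i<m. (- 1) * (of_nat (j + (K + 1 +
      i)) :: complex))"
    by (simp only: prod.distrib prod_constant card_lessThan)
  then show ?thesis
    by (simp add: poly_prod algebra_simps)
qed

lemma sphere_area_odd:
  assumes "n \<ge> 2" shows "sphere_area (2 * n - 3) = 2 * pi ^ (n - 1) / fact (n - 2)"
proof -
  have "2 * n - 3 + 1 = 2 * (n - 1)" "n - 1 = Suc (n - 2)"
    using assms by auto
  then have "sphere_area (2 * n - 3) = real (2 * (n - 1)) * unit_ball_vol (real (2 * (n - 1)))"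
    by (simp only: sphere_area_def)
  also have "\<dots> = real (2 * (n - 1)) * (pi ^ (n - 1) / fact (n - 1))"
    by (subst unit_ball_vol_even) simp
  also have "\<dots> = 2 * pi ^ (n - 1) / fact (n - 2)"
  proof -
    have "real (2 * l) * (P / (real l * F)) = 2 * P / F" if "l > 0" for l and P F :: real
      using that by simp
    from this[of "n - 1" "pi ^ (n - 1)" "fact (n - 2)"] show ?thesis
      using \<open>n - 1 = Suc (n - 2)\<close> assms by (simp only: fact_Suc of_nat_mult)
  qed
  finally show ?thesis .
qed

text \<open>The sphere area cancels the (n - 2)! of the Rodrigues form, and its sign (-1)^m is
  absorbed by the interpolating polynomial. The exponents 1 - 2 n + K + 2 j are one less than the
  constants in \<open>prim_sum\<close>.\<close>

lemma alpha_eq: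
  assumes n: "n = CARD('n::finite)" "n \<ge> 2" and pq: "m = min p q" "K = max p q - min p q"
  defines "M \<equiv> n - 2 + m"
  shows "alpha TYPE('n) p q = (\<lambda>\<phi>\<in>\<D>. prim_sum (Suc M)
    (\<lambda>j. 2 * of_real pi ^ (n - 1) * ((- 1) ^ j * of_nat (M choose j) * poly (\<Prod>i<m. [:- of_nat (K + 1
        + i), 1:]) (- of_nat j)) / fact M)
    (\<lambda>j. of_int (int K - 2 * int n + 2) + 2 * of_nat j) \<phi> 1)"
proof
  let ?r = "\<lambda>j. 2 * of_real pi ^ (n - 1) * ((- 1) ^ j * of_nat (M choose j) * poly (\<Prod>i<m. [:- of_nat
      (K + 1 + i), 1:]) (- of_nat j)) / fact M :: complex"
  let ?c = "\<lambda>j. of_int (int K - 2 * int n + 2) + 2 * of_nat j :: complex"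
  fix \<phi>
  show "alpha TYPE('n) p q \<phi> = (\<lambda>\<phi>\<in>\<D>. prim_sum (Suc M) ?r ?c \<phi> 1) \<phi>"
  proof (cases "\<phi> \<in> \<D>")
    case True
    have "alpha TYPE('n) p q \<phi> = (LBINT t:{0<..<1}. of_real (sphere_area (2 * n - 3)) * (of_real (t
        powi (1 - 2 * int n)) * multiplier TYPE('n) p q t *
                          of_real ((1 - t\<^sup>2) ^ (n - 2)) * \<phi> t))"
      using True by (simp add: alpha_def n(1)[symmetric] Let_def)
    also have "\<dots> = prim_sum (Suc M) ?r ?c \<phi> 1"
    proof (rule set_lebesgue_integral_prim_sum[OF test_half_smooth[OF True]])
      fix t :: real assume t: "0 < t" "t < 1"
      have powi: "complex_of_real t powr of_int k = of_real t powi k" for k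
        using t by (simp add: powr_of_int power_int_def power_inverse)
      have mult: "multiplier TYPE('n) p q t * of_real ((1 - t\<^sup>2) ^ (n - 2)) =
        (\<Sum>j\<le>M. (- 1) ^ m * fact (n - 2) / fact M * ((- 1) ^ j * of_nat (M choose j) * (fact (j + K +
            m) / fact (j + K)))
          * of_real t ^ (K + 2 * j))"
        unfolding multiplier_eq[OF n t] of_real_mult[symmetric] pq(1)[symmetric] M_def
        by (rule mean_coeff_sum[OF n(2) pq]) (use t in simp)
      have "of_real (sphere_area (2 * n - 3)) * (of_real (t powi (1 - 2 * int n)) * multiplier
          TYPE('n) p q t * of_real ((1 - t\<^sup>2) ^ (n - 2)) * \<phi> t)
        = of_real (sphere_area (2 * n - 3)) * of_real (t powi (1 - 2 * int n)) * (multiplier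
            TYPE('n) p q t * of_real ((1 - t\<^sup>2) ^ (n - 2))) * \<phi> t"
        by (simp only: mult_ac)
      also have "\<dots> = (\<Sum>j\<le>M. of_real (sphere_area (2 * n - 3)) * ((- 1) ^ m * fact (n - 2) / fact M *
          ((- 1) ^ j * of_nat (M choose j) * (fact (j + K + m) / fact (j + K))))
          * (of_real (t powi (1 - 2 * int n)) * of_real t ^ (K + 2 * j))) * \<phi> t"
        unfolding mult by (simp add: sum_distrib_left sum_distrib_right mult_ac)
      also have "\<dots> = (\<Sum>j<Suc M. ?r j * of_real t powr (?c j - 1)) * \<phi> t"
        unfolding lessThan_Suc_atMost
      proof (intro arg_cong2[of _ _ _ _ "(*)"] sum.cong refl)
        fix j
        have "complex_of_real (sphere_area (2 * n - 3)) = 2 * of_real pi ^ (n - 1) / fact (n - 2)"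
          using sphere_area_odd[OF n(2)] by simp
        then show "of_real (sphere_area (2 * n - 3)) * ((- 1) ^ m * fact (n - 2) / fact M * ((- 1) ^
            j * of_nat (M choose j) * (fact (j + K + m) / fact (j + K)))) = ?r j"
          unfolding poly_prod_neg_nat by (simp add: mult_ac)
        have e: "?c j - 1 = of_int ((1 - 2 * int n) + int (K + 2 * j))"
          by simp
        have "of_real t powr (?c j - 1) = of_real t powi ((1 - 2 * int n) + int (K + 2 * j))"
          unfolding e by (rule powi)
        also have "\<dots> = of_real t powi (1 - 2 * int n) * of_real t powi int (K + 2 * j)"
          by (rule power_int_add) (use t in simp)
        finally show "of_real (t powi (1 - 2 * int n)) * of_real t ^ (K + 2 * j) = complex_of_real t
            powr (?c j - 1)"
          by (simp only: power_int_of_nat of_real_power_int)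
      qed
      finally show "of_real (sphere_area (2 * n - 3)) * (of_real (t powi (1 - 2 * int n)) *
          multiplier TYPE('n) p q t * of_real ((1 - t\<^sup>2) ^ (n - 2)) * \<phi> t)
        = (\<Sum>j<Suc M. ?r j * of_real t powr (?c j - 1)) * \<phi> t" .
    qed
    finally show ?thesis
      using True by simp
  next
    case False
    then show ?thesis
      by (simp add: alpha_def Let_def)
  qed
qed

subsection \<open>The inverse and the Mellin transforms\<close>

definition linear_prod :: "nat \<Rightarrow> complex \<Rightarrow> complex poly" where
  "linear_prod N c = (\<Prod>i<N. [:c + 2 * of_nat i, 1:])"

lemma poly_linear_prod: "poly (linear_prod N c) s = (\<Prod>i<N. s + (c + 2 * of_nat i))"
  by (simp add: linear_prod_def poly_prod algebra_simps)

lemma poly_linear_prod_pochhammer: "poly (linear_prod N c) s = 2 ^ N * pochhammer ((s + c) / 2) N"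
proof -
  have "poly (linear_prod N c) s = (\<Prod>i<N. 2 * ((s + c) / 2 + of_nat i))"
    unfolding poly_linear_prod by (intro prod.cong) (auto simp: field_simps)
  then show ?thesis
    by (simp only: prod.distrib prod_constant card_lessThan pochhammer_prod atLeast0LessThan)
qed

lemma poly_linear_prod_nonzero:
  assumes "\<And>i. i < N \<Longrightarrow> s + (c + 2 * of_nat i) \<noteq> 0" shows "poly (linear_prod N c) s \<noteq> 0"
  using assms by (auto simp: poly_linear_prod)

text \<open>Read backwards, the constants e - 2 j for j = 1, ..., N ascend in steps of 2 from e - 2
  N.\<close>

lemma linear_prod_foldr:
  "(\<Prod>j\<leftarrow>[1..<Suc N]. [:e - 2 * of_nat j, 1:]) = linear_prod N (e - 2 * of_nat N)"
proof -
  have "(\<Prod>j\<leftarrow>[1..<Suc N]. [:e - 2 * of_nat j, 1:]) = (\<Prod>j\<in>{1..<Suc N}. [:e - 2 * of_nat j, 1:])"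
    by (subst prod.distinct_set_conv_list[symmetric]) (auto simp del: upt_Suc)
  also have "\<dots> = (\<Prod>j<N. [:e - 2 * of_nat (Suc j), 1:])"
    using prod.shift_bounds_Suc_ivl[of "\<lambda>j. [:e - 2 * of_nat j, 1:]" 0 N] by (simp add: atLeast0LessThan)
  also have "\<dots> = (\<Prod>i<N. [:e - 2 * of_nat (Suc (N - Suc i)), 1:])"
    by (rule prod.nat_diff_reindex[symmetric])
  also have "\<dots> = linear_prod N (e - 2 * of_nat N)"
    unfolding linear_prod_def by (intro prod.cong) (auto simp: of_nat_diff Suc_diff_Suc
        algebra_simps simp del: of_nat_Suc)
  finally show ?thesis .
qed

text \<open>The factor (X + c) / 2 - (K + 1 + i) equals (X + d + 2 (m - 1 - i)) / 2; reversing the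
  order of the factors gives \<open>linear_prod m d\<close>.\<close>

lemma pcompose_linear_prod:
  assumes "c = d + 2 * of_nat (K + m)"
  shows "pcompose (\<Prod>i<m. [:- of_nat (K + 1 + i), 1:]) [:c / 2, 1 / 2:] = smult ((1 / 2) ^ m)
      (linear_prod m d)"
proof -
  have "pcompose (\<Prod>i<m. [:- of_nat (K + 1 + i), 1:]) [:c / 2, 1 / 2:] =
      (\<Prod>i<m. smult (1 / 2) [:d + 2 * of_nat (m - Suc i), 1:])"
    unfolding pcompose_prod
    by (intro prod.cong) (auto simp: pcompose_pCons assms of_nat_diff field_simps)
  also have "\<dots> = (\<Prod>i<m. smult (1 / 2) [:d + 2 * of_nat i, 1:])"
    by (rule prod.nat_diff_reindex)
  finally show ?thesis
    by (simp only: linear_prod_def prod_smult prod_constant card_lessThan)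
qed

lemma act_const: "act [:a:] f = (\<lambda>t. a * f t)"
  by (simp add: act_pCons)

lemma act_const_commute: "f \<in> \<E> \<Longrightarrow> act P (\<lambda>t. a * f t) = (\<lambda>t. a * act P f t)"
  using act_mult[of f P "[:a:]"] act_mult[of f "[:a:]" P] by (simp add: act_const mult.commute)

lemma degree_prod_neg_nat: "degree (\<Prod>i<m. [:- of_nat (K + 1 + i), 1:] :: complex poly) \<le> m"
  by (rule order_trans[OF degree_prod_sum_le]) auto

text \<open>Hides the distinction between m = 0 and m > 0. For m = 0 the product is empty and 2^m /
  2 = 1/2; for m = M + 1 interpolation of the constant 1 gives 2^M. The last conclusion allows a
  scalar and a polynomial in \<theta>, since \<open>beta\<close> arises by applying both.\<close>

lemma plus_power_operator:
  fixes k :: int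
  defines "d \<equiv> of_int (k + 1)"
  obtains R where "represents R (gf_mult (\<lambda>t. of_real (t powi k)) (plus_power m))"
    "\<forall>f\<in>\<E>. act (linear_prod m d) (R f) = (\<lambda>t. 2 ^ m / 2 * f t)"
    "\<forall>f\<in>\<E>. \<forall>P. R (act P f) = act P (R f)"
    "\<forall>u a P s. represents (\<lambda>f t. a * R (act P f) t) u \<longrightarrow> Re (s + d) > 0 \<longrightarrow>
       has_mellin u s (a * (2 ^ m / 2) * poly P s / poly (linear_prod m d) s)"
proof (cases "m = 0")
  case True
  show ?thesis
  proof (rule that[of "\<lambda>f t. 1 / 2 * f t"])
    show "\<forall>u a P s. represents (\<lambda>f t. a * (1 / 2 * act P f t)) u \<longrightarrow> Re (s + d) > 0 \<longrightarrow>
       has_mellin u s (a * (2 ^ m / 2) * poly P s / poly (linear_prod m d) s)"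
    proof (intro allI impI)
      fix u a P s assume "represents (\<lambda>f t. a * (1 / 2 * act P f t)) u"
      from has_mellin_act[OF this, of "a / 2" P s]
      show "has_mellin u s (a * (2 ^ m / 2) * poly P s / poly (linear_prod m d) s)"
        using True by (simp add: linear_prod_def)
    qed
  qed (use True represents_plus_power(1)[of k] act_const_commute[of _ _ "1 / 2"] in \<open>auto simp:
      linear_prod_def\<close>)
next
  case False
  then obtain M where M: "m = Suc M"
    by (cases m) auto
  define r :: "nat \<Rightarrow> complex" where "r = (\<lambda>j. 1 * ((- 1) ^ j * of_nat (M choose j) * poly 1 (-
      of_nat j)) / fact M)"
  define c where "c = (\<lambda>i. d + 2 * of_nat i :: complex)"
  have c: "(\<lambda>i. of_int (k + 1 + 2 * int i)) = c"
    by (simp add: c_def d_def fun_eq_iff)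
  show ?thesis
  proof (rule that[of "prim_sum m r c"])
    show "represents (prim_sum m r c) (gf_mult (\<lambda>t. of_real (t powi k)) (plus_power m))"
      using represents_plus_power(2)[of m k] False unfolding c by (simp add: r_def M)
    show "\<forall>f\<in>\<E>. act (linear_prod m d) (prim_sum m r c f) = (\<lambda>t. 2 ^ m / 2 * f t)"
    proof
      fix f assume "f \<in> \<E>"
      then show "act (linear_prod m d) (prim_sum m r c f) = (\<lambda>t. 2 ^ m / 2 * f t)"
        unfolding M linear_prod_def r_def c_def by (subst act_prim_sum_lagrange) (auto simp:
            one_pCons act_const)
    qed
    show "\<forall>f\<in>\<E>. \<forall>P. prim_sum m r c (act P f) = act P (prim_sum m r c f)"
      by (simp add: prim_sum_act)
    show "\<forall>u a P s. represents (\<lambda>f t. a * prim_sum m r c (act P f) t) u \<longrightarrow> Re (s + d) > 0 \<longrightarrow>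
       has_mellin u s (a * (2 ^ m / 2) * poly P s / poly (linear_prod m d) s)"
    proof (intro allI impI)
      fix u a P s assume u: "represents (\<lambda>f t. a * prim_sum m r c (act P f) t) u" and s: "Re (s + d) > 0"
      have pos: "Re (s + c i) > 0" for i
        using s by (simp add: c_def)
      have "(\<Sum>i<m. r i / (s + c i)) = 1 * 2 ^ M * poly 1 ((s + d) / 2) / (\<Prod>i<Suc M. s + (d + 2 * of_nat i))"
        unfolding M r_def c_def
      proof (rule sum_lagrange_fractions)
        show "s + (d + 2 * of_nat i) \<noteq> 0" for i
          using pos[of i] unfolding c_def by (metis less_irrefl zero_complex.sel(1))
      qed simp
      then have "(\<Sum>i<m. r i / (s + c i)) = 2 ^ M / poly (linear_prod m d) s"
        by (simp only: poly_linear_prod M poly_1 mult_1_left mult_1_right)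
      with has_mellin_prim_sum[OF u refl, of s] pos
      show "has_mellin u s (a * (2 ^ m / 2) * poly P s / poly (linear_prod m d) s)"
        by (simp add: M mult_ac)
    qed
  qed
qed

lemma analytic_on_poly: "poly P analytic_on A" for P :: "complex poly"
  using poly_holomorphic_on[OF holomorphic_on_ident, of P UNIV]
  by (auto simp: analytic_on_open intro: analytic_on_subset[of _ UNIV])

lemma linear_prod_nonzero_not_Ints:
  assumes "s \<notin> \<int>" shows "poly (linear_prod N (of_int e)) s \<noteq> 0"
proof (rule poly_linear_prod_nonzero, rule notI)
  fix i assume "s + (of_int e + 2 * of_nat i) = 0"
  then have "s = of_int (- e - 2 * int i)"
    by (simp add: algebra_simps eq_neg_iff_add_eq_0)
  with assms show False
    by simp
qed

lemma half_shift_not_Ints: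
  assumes "s \<notin> \<int>" shows "(s + of_int e) / 2 \<notin> (\<int> :: complex set)"
proof
  assume "(s + of_int e) / 2 \<in> (\<int> :: complex set)"
  then obtain l where "(s + of_int e) / 2 = of_int l"
    by (rule Ints_cases)
  then have "s = of_int (2 * l - e)"
    by (simp add: field_simps)
  with assms show False
    by simp
qed

text \<open>The four arguments form two pairs with integral differences: \<open>z\<close> and z + M
  + 1 give the factors of degree M + 1, \<open>v\<close> and v + m those of degree m. Off the
  integers each quotient is a Pochhammer symbol.\<close>

lemma Gamma_quotient:
  fixes s :: complex
  assumes s: "s \<notin> \<int>" and n: "n \<ge> 2" and pq: "m = min p q" "K = max p q - min p q" and M: "M = n - 2 + m"
  shows "of_real pi powi (1 - int n) *
            (Gamma ((s + of_nat p + of_nat q) / 2) /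
             Gamma ((s + of_int \<bar>int p - int q\<bar>) / 2 - of_nat n + 1)) *
            (Gamma ((s - of_nat p - of_nat q) / 2 - of_nat n + 1) /
             Gamma ((s - of_int \<bar>int p - int q\<bar>) / 2 - of_nat n + 1))
    = poly (linear_prod (Suc M) (of_int (int K - 2 * int n + 2))) s /
      (2 * of_real pi ^ (n - 1) * 2 ^ M * (1 / 2) ^ m * poly (linear_prod m (of_int (2 - int p - int
          q - 2 * int n))) s)"
proof -
  define z where "z = (s + of_int (int K - 2 * int n + 2)) / 2"
  define v where "v = (s + of_int (2 - int p - int q - 2 * int n)) / 2"
  have nonint: "z \<notin> \<int>" "v \<notin> \<int>"
    unfolding z_def v_def using half_shift_not_Ints[OF s] by blast+
  have int: "\<bar>int p - int q\<bar> = int K" "int p = int K + 2 * int m - int q" "int M = int n + int m - 2"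
    using n by (auto simp: pq M)
  have "complex_of_int (int p) = of_int (int K + 2 * int m - int q)" "complex_of_int (int M) =
      of_int (int n + int m - 2)"
    by (simp_all only: int)
  then have sums: "complex_of_nat p = of_nat K + 2 * of_nat m - of_nat q" "complex_of_nat M = of_nat
      n + of_nat m - 2"
    by simp_all
  have args: "(s + of_nat p + of_nat q) / 2 = z + of_nat (Suc M)"
     "(s + of_int \<bar>int p - int q\<bar>) / 2 - of_nat n + 1 = z"
     "(s - of_nat p - of_nat q) / 2 - of_nat n + 1 = v"
     "(s - of_int \<bar>int p - int q\<bar>) / 2 - of_nat n + 1 = v + of_nat m"
    unfolding int(1) by (simp_all add: z_def v_def sums field_simps)
  have P: "complex_of_real pi powi (1 - int n) = 1 / of_real pi ^ (n - 1)"
    using n by (simp add: power_int_def inverse_eq_divide nat_diff_distrib power_one_over of_nat_diff)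
  have G1: "Gamma (z + of_nat (Suc M)) / Gamma z = poly (linear_prod (Suc M) (of_int (int K - 2 *
      int n + 2))) s / 2 ^ Suc M"
    using nonint nonpos_Ints_subset_Ints by (subst Gamma_shift) (auto simp:
        poly_linear_prod_pochhammer z_def)
  have G2: "Gamma v / Gamma (v + of_nat m) = 2 ^ m / poly (linear_prod m (of_int (2 - int p - int q
      - 2 * int n))) s"
  proof -
    have "Gamma v / Gamma (v + of_nat m) = 1 / (Gamma (v + of_nat m) / Gamma v)"
      by simp
    also have "Gamma (v + of_nat m) / Gamma v = pochhammer v m"
      using nonint nonpos_Ints_subset_Ints by (subst Gamma_shift) auto
    finally show ?thesis
      by (simp add: poly_linear_prod_pochhammer v_def)
  qed
  have "1 / x * (D / 2 ^ Suc M) * (2 ^ m / y) = D / (2 * x * 2 ^ M * (1 / 2) ^ m * y)" for x y D :: complex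
    by (simp add: power_one_over)
  then show ?thesis
    unfolding args P G1 G2 .
qed

text \<open>Identities of meromorphic functions are stated off a sparse set, because division and
  \<open>Gamma\<close> take conventional values at poles.\<close>

theorem theorem5p4p1:
  fixes n p q :: nat
  assumes "n = CARD('n::finite)" and "n \<ge> 2"
  shows "alpha TYPE('n) p q \<in> Units conv_algebra \<and>
         inv\<^bsub>conv_algebra\<^esub> (alpha TYPE('n) p q) = beta n p q \<and>
         (\<forall>s. Re s > 2 * real n - 2 \<longrightarrow>
            has_mellin (alpha TYPE('n) p q) s (mellin (alpha TYPE('n) p q) s)) \<and>
         (\<forall>\<^sub>\<approx>s. mellin (beta n p q) s = 1 / mellin (alpha TYPE('n) p q) s) \<and>
         (\<forall>\<^sub>\<approx>s. 1 / mellin (alpha TYPE('n) p q) s =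
            of_real pi powi (1 - int n) *
            (Gamma ((s + of_nat p + of_nat q) / 2) /
             Gamma ((s + of_int \<bar>int p - int q\<bar>) / 2 - of_nat n + 1)) *
            (Gamma ((s - of_nat p - of_nat q) / 2 - of_nat n + 1) /
             Gamma ((s - of_int \<bar>int p - int q\<bar>) / 2 - of_nat n + 1)))"
proof -
  define m where "m = min p q"
  define K where "K = max p q - min p q"
  define M where "M = n - 2 + m"
  define e where "e = int K - 2 * int n + 2"
  define k where "k = 1 - int p - int q - 2 * int n"
  define c d where "c = complex_of_int e" and "d = complex_of_int (k + 1)"
  define Q :: "complex poly" where "Q = (\<Prod>i<m. [:- of_nat (K + 1 + i), 1:])"
  define k\<alpha> k\<beta> :: complex where "k\<alpha> = 2 * of_real pi ^ (n - 1) * 2 ^ M * (1 / 2) ^ m"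
    and "k\<beta> = 1 / (2 ^ (n + m - 2) * of_real pi ^ (n - 1))"
  let ?\<alpha> = "alpha TYPE('n) p q" and ?\<beta> = "beta n p q"
  let ?D = "linear_prod (Suc M) c" and ?P = "linear_prod m d"
  have int: "int p + int q = int K + 2 * int m" "n + m = Suc (Suc M)" "int (Suc M) = int n - 1 + int
      m" "n + m - 2 = M"
    using assms(2) by (auto simp: m_def K_def M_def)
  \<comment> \<open>The normalisations match: k\<alpha> and k\<beta> multiply to 2 / 2^m, and the
    operator of the generalized function contributes 2^m / 2.\<close>
  have kk: "k\<beta> * (k\<alpha> * (2 ^ m / 2)) = 1" "k\<alpha> \<noteq> 0"
    unfolding k\<alpha>_def k\<beta>_def int by (auto simp: power_one_over)
  have degQ: "degree Q \<le> M"
    using degree_prod_neg_nat[of K m] unfolding Q_def M_def by simp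
  have "e = k + 1 + 2 * int (K + m)"
    using int by (simp add: e_def k_def)
  then have cd: "c = d + 2 * of_nat (K + m)"
    unfolding c_def d_def by simp

  define r where "r = (\<lambda>j. 2 * of_real pi ^ (n - 1) * ((- 1) ^ j * of_nat (M choose j) * poly Q (-
      of_nat j)) / fact M)"
  define A where "A = prim_sum (Suc M) r (\<lambda>j. c + 2 * of_nat j)"
  have A: "represents A ?\<alpha>"
    unfolding A_def r_def Q_def c_def e_def M_def alpha_eq[OF assms m_def K_def] by (rule
        represents_prim_sum)
  have act_A: "act ?D (A f) = (\<lambda>t. k\<alpha> * act ?P f t)" if "f \<in> \<E>" for f
    unfolding A_def r_def linear_prod_def[of "Suc M"]
    by (subst act_prim_sum_lagrange[OF degQ that], unfold Q_def pcompose_linear_prod[OF cd] act_smult)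
      (simp add: k\<alpha>_def mult_ac)
  have A_in: "A f \<in> \<E>" if "f \<in> \<E>" for f
    unfolding A_def by (rule prim_sum_in) fact
  have A_act: "A (act P f) = act P (A f)" if "f \<in> \<E>" for P f
    unfolding A_def by (rule prim_sum_act) fact

  obtain R where R: "represents R (gf_mult (\<lambda>t. of_real (t powi k)) (plus_power m))"
    "\<forall>f\<in>\<E>. act ?P (R f) = (\<lambda>t. 2 ^ m / 2 * f t)"
    "\<forall>f\<in>\<E>. \<forall>P. R (act P f) = act P (R f)"
    "\<forall>u a P s. represents (\<lambda>f t. a * R (act P f) t) u \<longrightarrow> Re (s + d) > 0 \<longrightarrow>
       has_mellin u s (a * (2 ^ m / 2) * poly P s / poly ?P s)"
    unfolding d_def by (rule plus_power_operator)
  have R_in: "R f \<in> \<E>" if "f \<in> \<E>" for f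
    using R(1) that dilation_operatorD(1) unfolding represents_def by blast
  define B where "B = (\<lambda>f t. k\<beta> * R (act ?D f) t)"
  have B: "represents B ?\<beta>"
  proof -
    let ?u = "foldr (\<lambda>j. euler_op (of_nat p + of_nat q - 2 * of_nat j)) [1..<n + m]
       (gf_mult (\<lambda>t. of_real (t powi k)) (plus_power m))"
    \<comment> \<open>The last Euler factor, j = n + m - 1, has the constant p + q - 2 (n + m - 1) =
      K - 2 n + 2, so the Euler product is exactly the denominator of \<open>alpha\<close>.\<close>
    have "complex_of_int (int p + int q - 2 * int (Suc M)) = of_int e"
      unfolding int(1,3) e_def by simp
    then have "complex_of_nat p + of_nat q - 2 * of_nat (Suc M) = c"
      by (simp add: c_def)
    then have "(\<Prod>j\<leftarrow>[1..<n + m]. [:of_nat p + of_nat q - 2 * of_nat j, 1:]) = ?D"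
      unfolding int linear_prod_foldr by simp
    then have "represents (\<lambda>f. R (act ?D f)) ?u"
      using represents_foldr_euler_op[OF R(1), of "\<lambda>j. of_nat p + of_nat q - 2 * of_nat j" "[1..<n +
          m]"] by simp
    then have "represents B (\<lambda>\<phi>\<in>\<D>. k\<beta> * ?u \<phi>)"
      unfolding B_def by (rule represents_cmult)
    moreover have "?\<beta> = (\<lambda>\<phi>\<in>\<D>. k\<beta> * ?u \<phi>)"
      unfolding beta_def Let_def m_def[symmetric] k_def k\<beta>_def ..
    ultimately show ?thesis
      by simp
  qed

  \<comment> \<open>The Euler product cancels the denominator of \<open>A\<close> and leaves the
    numerator \<open>?P\<close>; this passes through \<open>R\<close> and cancels the denominator
    there.\<close>
  have RA: "R (act ?D (A f)) = (\<lambda>t. k\<alpha> * (2 ^ m / 2 * f t))" if f: "f \<in> \<E>" for f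
  proof -
    have "R (act ?D (A f)) = R (act [:k\<alpha>:] (act ?P f))"
      unfolding act_A[OF f] act_const ..
    also have "\<dots> = act [:k\<alpha>:] (act ?P (R f))"
      using R(3) f act_in by simp
    finally show ?thesis
      using R(2) f by (simp add: act_const)
  qed
  have BA: "B (A f) = f" if "f \<in> \<E>" for f
    unfolding B_def RA[OF that] using kk(1) by (simp only: mult.assoc[symmetric]) simp
  have AB: "A (B f) = f" if f: "f \<in> \<E>" for f
  proof -
    have "A (B f) = act [:k\<beta>:] (act ?D (A (R f)))"
      using f R(3) A_act R_in act_in unfolding B_def act_const[symmetric] by simp
    also have "\<dots> = (\<lambda>t. k\<beta> * (k\<alpha> * (2 ^ m / 2 * f t)))"
      using R(2) f act_A[OF R_in[OF f]] by (simp add: act_const)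
    also have "\<dots> = f"
      using kk(1) by (simp only: mult.assoc[symmetric]) simp
    finally show ?thesis .
  qed

  define f\<alpha> where "f\<alpha> = (\<lambda>s. k\<alpha> * poly ?P s / poly ?D s)"
  define f\<beta> where "f\<beta> = (\<lambda>s. k\<beta> * (2 ^ m / 2) * poly ?D s / poly ?P s)"
  have mero: "f\<alpha> meromorphic_on UNIV" "f\<beta> meromorphic_on UNIV"
    unfolding f\<alpha>_def f\<beta>_def by (intro meromorphic_on_divide meromorphic_on_mult meromorphic_on_const
        analytic_on_imp_meromorphic_on[OF analytic_on_poly])+
  have an: "poly ?D s \<noteq> 0 \<Longrightarrow> f\<alpha> analytic_on {s}" "poly ?P s \<noteq> 0 \<Longrightarrow> f\<beta> analytic_on {s}" for s
    unfolding f\<alpha>_def f\<beta>_def by (auto intro!: analytic_intros analytic_on_poly)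
  have Re_pos: "poly (linear_prod N b) s \<noteq> 0" if "Re (s + b) > 0" for N b s
  proof (rule poly_linear_prod_nonzero)
    fix i
    have "Re (s + (b + 2 * of_nat i)) > 0"
      using that by simp
    then show "s + (b + 2 * of_nat i) \<noteq> 0"
      by (metis less_irrefl zero_complex.sel(1))
  qed
  \<comment> \<open>As c = K - 2 n + 2 with K nonnegative, this half-plane lies in the domain of
    convergence for all \<open>p\<close>, \<open>q\<close>.\<close>
  have half: "Re (s + c) > 0" if "Re s > 2 * real n - 2" for s
    using that by (simp add: c_def e_def)
  have hm\<alpha>: "has_mellin ?\<alpha> s (f\<alpha> s)" if "Re s > 2 * real n - 2" for s
  proof -
    have pos: "Re (s + (c + 2 * of_nat i)) > 0" for i
      using half[OF that] by simp
    have "has_mellin ?\<alpha> s (1 * poly 1 s * (\<Sum>i<Suc M. r i / (s + (c + 2 * of_nat i))))"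
      by (rule has_mellin_prim_sum[OF A]) (use pos in \<open>simp_all add: A_def\<close>)
    also have "(\<Sum>i<Suc M. r i / (s + (c + 2 * of_nat i))) =
        2 * of_real pi ^ (n - 1) * 2 ^ M * poly Q ((s + c) / 2) / (\<Prod>i<Suc M. (s + (c + 2 * of_nat i)))"
      unfolding r_def by (rule sum_lagrange_fractions[OF degQ]) (use pos in \<open>metis less_irrefl
          zero_complex.sel(1)\<close>)
    also have "poly Q ((s + c) / 2) = poly (pcompose Q [:c / 2, 1 / 2:]) s"
      by (simp add: poly_pcompose add_divide_distrib add.commute)
    also have "pcompose Q [:c / 2, 1 / 2:] = smult ((1 / 2) ^ m) ?P"
      unfolding Q_def by (rule pcompose_linear_prod[OF cd])
    finally show ?thesis
      by (simp add: f\<alpha>_def k\<alpha>_def poly_linear_prod mult_ac del: prod.lessThan_Suc)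
  qed
  have mellin: "mellin ?\<alpha> = remove_sings f\<alpha>" "mellin ?\<beta> = remove_sings f\<beta>"
  proof -
    show "mellin ?\<alpha> = remove_sings f\<alpha>"
      by (rule mellin_eqI[OF mero(1) an(1)[OF Re_pos[OF half]] hm\<alpha>])
    show "mellin ?\<beta> = remove_sings f\<beta>"
    proof (rule mellin_eqI[OF mero(2), of "- Re d"])
      fix s assume "Re s > - Re d"
      then have s: "Re (s + d) > 0"
        by simp
      then show "f\<beta> analytic_on {s}"
        by (intro an Re_pos)
      show "has_mellin ?\<beta> s (f\<beta> s)"
        using R(4) B s unfolding B_def f\<beta>_def by blast
    qed
  qed
  \<comment> \<open>Off the integers neither product vanishes, so \<open>remove_sings\<close>
    changes nothing and all divisions are genuine.\<close>
  have eq: "mellin ?\<alpha> s = f\<alpha> s" "mellin ?\<beta> s = f\<beta> s" "f\<beta> s = 1 / f\<alpha> s" "1 / f\<alpha> s = poly ?D s / (k\<alpha> *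
      poly ?P s)"
    if "s \<notin> \<int>" for s
  proof -
    have nz: "poly ?D s \<noteq> 0" "poly ?P s \<noteq> 0"
      unfolding c_def d_def by (rule linear_prod_nonzero_not_Ints[OF that])+
    show "mellin ?\<alpha> s = f\<alpha> s" "mellin ?\<beta> s = f\<beta> s"
      unfolding mellin by (rule remove_sings_at_analytic, rule an, rule nz)+
    show "1 / f\<alpha> s = poly ?D s / (k\<alpha> * poly ?P s)"
      by (simp add: f\<alpha>_def)
    have "k\<beta> * (2 ^ m / 2) = 1 / k\<alpha>"
      using kk by (simp add: field_simps)
    then show "f\<beta> s = 1 / f\<alpha> s"
      by (simp add: f\<alpha>_def f\<beta>_def)
  qed

  have "?\<alpha> \<in> Units conv_algebra \<and> inv\<^bsub>conv_algebra\<^esub> ?\<alpha> = ?\<beta>"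
    using A B AB BA by (rule inverse_represents)
  moreover have "has_mellin ?\<alpha> s (mellin ?\<alpha> s)" if "Re s > 2 * real n - 2" for s
    unfolding mellin using hm\<alpha>[OF that] remove_sings_at_analytic[OF an(1)[OF Re_pos[OF half[OF
        that]]]] by simp
  moreover have "\<forall>\<^sub>\<approx>s. mellin ?\<beta> s = 1 / mellin ?\<alpha> s"
    using cosparse_not_Ints by eventually_elim (simp add: eq)
  moreover have "\<forall>\<^sub>\<approx>s. 1 / mellin ?\<alpha> s = of_real pi powi (1 - int n) *
            (Gamma ((s + of_nat p + of_nat q) / 2) /
             Gamma ((s + of_int \<bar>int p - int q\<bar>) / 2 - of_nat n + 1)) *
            (Gamma ((s - of_nat p - of_nat q) / 2 - of_nat n + 1) /
             Gamma ((s - of_int \<bar>int p - int q\<bar>) / 2 - of_nat n + 1))"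
    using cosparse_not_Ints
  proof eventually_elim
    case (elim s)
    have "d = of_int (2 - int p - int q - 2 * int n)"
      by (simp add: d_def k_def)
    then show ?case
      unfolding Gamma_quotient[OF elim assms(2) m_def K_def M_def] eq[OF elim]
      by (simp only: c_def e_def k\<alpha>_def)
  qed
  ultimately show ?thesis
    by blast
qed

end
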